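(* Let $(a_{nk})_{n,k\ge0}$ be complex scalars with $\sum_k|a_{nk}|<\infty$ for each $n$. Then the following are equivalent: (i) $\sum_{k\ge0}a_{nk}\hat g(k)z^k\to g$ weakly in $A^1$, for all $g\in A^1$; (ii) $\sum_{k\ge0}a_{nk}\hat g(k)z^k\to g$ in $A^1$-norm, for all $g\in A^1$; (iii) $\sum_{k\ge0}a_{nk}\hat h(k)z^k\to h$ weak* in $\mathcal B$, for all $h\in\mathcal B$; (iv) $\sum_{k\ge0}a_{nk}\hat f(k)z^k\to f$ weakly in $\mathcal B_0$, for all $f\in\mathcal B_0$; (v) $\sum_{k\ge0}a_{nk}\hat f(k)z^k\to f$ in $\mathcal B$-norm, for all $f\in\mathcal B_0$.
   Context: $\mathbb D$ is the unit disk, $dA$ area measure, $\hat g(k)$ Taylor coefficients. The Bergman space $A^1$ consists of holomorphic $f$ on $\mathbb D$ with $\|f\|_{A^1}=\frac1\pi\int_{\mathbb D}|f|\,dA<\infty$. The Bloch space $\mathcal B$ consists of holomorphic $f$ with $\|f\|_{\mathcal B}:=|f(0)|+\sup_{\mathbb D}(1-|z|^2)|f'(z)|<\infty$, and the little Bloch space $\mathcal B_0$ is the closed subspace where $(1-|z|^2)|f'(z)|\to0$ as $|z|\to1$. Up to isomorphism $\mathcal B_0^*\cong A^1$ and $(A^1)^*\cong\mathcal B$ via $\langle g,h\rangle=\lim_{r\to1^-}\frac1\pi\int_{|z|<r}g(z)h(\overline z)\,dA(z)$; weak* in $\mathcal B$ refers to this duality with $A^1$. *)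

theory Defs
  imports "HOL-Complex_Analysis.Complex_Analysis"
begin

definition taylor_coeff :: "(complex \<Rightarrow> complex) \<Rightarrow> nat \<Rightarrow> complex" where
  "taylor_coeff g k = (deriv ^^ k) g 0 / of_nat (fact k)"

definition bergman1 :: "(complex \<Rightarrow> complex) set" where
  "bergman1 = {f. f holomorphic_on ball 0 1 \<and> (\<lambda>z. norm (f z)) integrable_on ball 0 1}"

definition bergman1_norm :: "(complex \<Rightarrow> complex) \<Rightarrow> real" where
  "bergman1_norm f = integral (ball 0 1) (\<lambda>z. norm (f z)) / pi"

definition bloch :: "(complex \<Rightarrow> complex) set" where
  "bloch = {f. f holomorphic_on ball 0 1 \<and>
              bdd_above ((\<lambda>z. (1 - (cmod z)\<^sup>2) * cmod (deriv f z)) ` ball 0 1)}"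

definition bloch_norm :: "(complex \<Rightarrow> complex) \<Rightarrow> real" where
  "bloch_norm f = cmod (f 0) + (SUP z\<in>ball 0 1. (1 - (cmod z)\<^sup>2) * cmod (deriv f z))"

definition little_bloch :: "(complex \<Rightarrow> complex) set" where
  "little_bloch = {f. f \<in> bloch \<and>
     (\<forall>e>0. \<exists>r<1. \<forall>z. r < cmod z \<and> cmod z < 1 \<longrightarrow> (1 - (cmod z)\<^sup>2) * cmod (deriv f z) < e)}"

definition pairing :: "(complex \<Rightarrow> complex) \<Rightarrow> (complex \<Rightarrow> complex) \<Rightarrow> complex" where
  "pairing g h = Lim (at_left 1)
     (\<lambda>r::real. integral (ball 0 r) (\<lambda>z. g z * h (cnj z)) / of_real pi)"

definition coeff_transform ::
  "(nat \<Rightarrow> nat \<Rightarrow> complex) \<Rightarrow> nat \<Rightarrow> (complex \<Rightarrow> complex) \<Rightarrow> complex \<Rightarrow> complex" where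
  "coeff_transform a n g = (\<lambda>z. \<Sum>k. a n k * taylor_coeff g k * z ^ k)"

text \<open>Weak convergence in A^1 (dual identified with the Bloch space via the pairing).\<close>
definition weak_conv_A1 :: "(nat \<Rightarrow> complex \<Rightarrow> complex) \<Rightarrow> (complex \<Rightarrow> complex) \<Rightarrow> bool" where
  "weak_conv_A1 F g \<longleftrightarrow> (\<forall>n. F n \<in> bergman1) \<and> g \<in> bergman1 \<and>
     (\<forall>h\<in>bloch. (\<lambda>n. pairing (F n) h) \<longlonglongrightarrow> pairing g h)"

text \<open>Weak-star convergence in the Bloch space (as the dual of A^1).\<close>
definition weakstar_conv_B :: "(nat \<Rightarrow> complex \<Rightarrow> complex) \<Rightarrow> (complex \<Rightarrow> complex) \<Rightarrow> bool" where
  "weakstar_conv_B F h \<longleftrightarrow> (\<forall>n. F n \<in> bloch) \<and> h \<in> bloch \<and>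
     (\<forall>g\<in>bergman1. (\<lambda>n. pairing g (F n)) \<longlonglongrightarrow> pairing g h)"

text \<open>Weak convergence in the little Bloch space (dual identified with A^1 via the pairing).\<close>
definition weak_conv_B0 :: "(nat \<Rightarrow> complex \<Rightarrow> complex) \<Rightarrow> (complex \<Rightarrow> complex) \<Rightarrow> bool" where
  "weak_conv_B0 F f \<longleftrightarrow> (\<forall>n. F n \<in> little_bloch) \<and> f \<in> little_bloch \<and>
     (\<forall>g\<in>bergman1. (\<lambda>n. pairing g (F n)) \<longlonglongrightarrow> pairing g f)"

end

theory Submission
  imports Defs
begin

text \<open>
  Write \<open>T\<^sub>n\<close> for the transform with multipliers \<open>a\<^sub>n\<^sub>k\<close>. Projecting onto a single Taylor
  coefficient is a contraction on \<open>A\<^sup>1\<close> and on the Bloch space, so \<open>T\<^sub>n\<close> maps \<open>A\<^sup>1\<close> into itself and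
  \<open>B\<close> into \<open>B\<^sub>0\<close>, and it is symmetric for the pairing; so (i) and (iii) agree and imply (iv). If (iv) holds, the uniform boundedness principle bounds the bilinear forms
  \<open>\<langle>g, T\<^sub>n f\<rangle>\<close> on \<open>A\<^sup>1 \<times> B\<^sub>0\<close>. The norms of \<open>A\<^sup>1\<close> and \<open>B\<close> are equivalent to dual norms for the
  pairing: derivatives are represented by the kernels \<open>2 z / (1 - w z)\<^sup>3\<close>, whose \<open>A\<^sup>1\<close> norm is
  \<open>O(1 / (1 - |w|\<^sup>2))\<close>, and the Bergman projection maps bounded functions to Bloch functions by the
  same estimate. Hence the \<open>T\<^sub>n\<close> are uniformly bounded on \<open>A\<^sup>1\<close> and on \<open>B\<^sub>0\<close>, while testing on
  monomials gives \<open>a\<^sub>n\<^sub>k \<longlonglongrightarrow> 1\<close>. Since \<open>T\<^sub>n p \<longlonglongrightarrow> p\<close> in norm for functions holomorphic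
  beyond the disc, and these are dense in both spaces, (ii) and (v) follow.
\<close>

subsection \<open>Area measure on the disc\<close>

text \<open>The pairing has to be a limit in \<open>r\<close>, since \<open>g z * h (cnj z)\<close>
  need not be integrable: \<open>g\<close> is only in \<open>A^1\<close> and Bloch functions may be
  unbounded. Condition (iv) tests \<open>B_0\<close> against \<open>A^1\<close>, whereas (ii) and
  (v) ask for norm convergence in each space. One bound on the bilinear forms serves both because
  each space norms the other, and this is shown by explicit test functions instead of abstract dual
  spaces. For the Bloch norm, kernels that evaluate derivatives suffice. For the \<open>A^1\<close>
  norm the unimodular function \<open>cnj g / |g|\<close> has to be turned into an element of
  \<open>B_0\<close> and not merely of \<open>B\<close>; this is why it is cut off to a smaller disc
  before it is projected, and why the resulting estimate must not depend on the radius of that disc.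
  Dilations rather than Taylor sections supply the dense classes, because sections do not converge
  in norm for every function in \<open>A^1\<close>. Elements of the spaces are total functions whose
  values outside the disc are arbitrary, so many identities hold only inside it and are transferred
  by congruence lemmas.\<close>

lemma measurable_Complex [measurable]:
  assumes [measurable]: "f \<in> borel_measurable M" "g \<in> borel_measurable M"
  shows "(\<lambda>x. Complex (f x) (g x)) \<in> borel_measurable M"
  unfolding Complex_eq by measurable

text \<open>Shears move one real coordinate at a time, so the plane is presented as a product to
  which Tonelli applies in either order. Agreement on boxes determines Lebesgue measure.\<close>

lemma lborel_complex: "lborel = distr (lborel \<Otimes>\<^sub>M lborel) borel (\<lambda>(x, y). Complex x y)"
proof (rule lborel_eqI)
  fix l u :: complex
  assume le: "\<And>b. b \<in> Basis \<Longrightarrow> l \<bullet> b \<le> u \<bullet> b"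
  have le': "Re l \<le> Re u" "Im l \<le> Im u"
    using le[of 1] le[of \<i>] by (auto simp: Basis_complex_def)
  have [measurable]: "(\<lambda>(x, y). Complex x y) \<in> borel_measurable (lborel \<Otimes>\<^sub>M lborel)"
    by measurable
  have eq: "(\<lambda>(x, y). Complex x y) -` box l u \<inter> space (lborel \<Otimes>\<^sub>M lborel) = {Re l<..<Re u} \<times> {Im l<..<Im u}"
    by (auto simp: box_def Basis_complex_def space_pair_measure)
  have "emeasure (distr (lborel \<Otimes>\<^sub>M lborel) borel (\<lambda>(x, y). Complex x y)) (box l u)
     = emeasure (lborel \<Otimes>\<^sub>M lborel) ({Re l<..<Re u} \<times> {Im l<..<Im u})"
    by (subst emeasure_distr) (auto simp: eq)
  also have "\<dots> = ennreal (Re u - Re l) * ennreal (Im u - Im l)"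
    using le' by (subst lborel.emeasure_pair_measure_Times) auto
  also have "\<dots> = (\<Prod>b\<in>Basis. (u - l) \<bullet> b)"
    using le' by (simp add: Basis_complex_def ennreal_mult)
  finally show "emeasure (distr (lborel \<Otimes>\<^sub>M lborel) borel (\<lambda>(x, y). Complex x y)) (box l u) = (\<Prod>b\<in>Basis. (u - l) \<bullet> b)" .
qed simp

lemma nn_integral_complex:
  assumes [measurable]: "f \<in> borel_measurable borel"
  shows "(\<integral>\<^sup>+z. f z \<partial>lborel) = (\<integral>\<^sup>+x. \<integral>\<^sup>+y. f (Complex x y) \<partial>lborel \<partial>lborel)"
    and "(\<integral>\<^sup>+z. f z \<partial>lborel) = (\<integral>\<^sup>+y. \<integral>\<^sup>+x. f (Complex x y) \<partial>lborel \<partial>lborel)"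
proof -
  have [measurable]: "(\<lambda>(x, y). Complex x y) \<in> borel_measurable (lborel \<Otimes>\<^sub>M lborel)"
    by measurable
  have *: "(\<integral>\<^sup>+z. f z \<partial>lborel) = (\<integral>\<^sup>+p. f (Complex (fst p) (snd p)) \<partial>(lborel \<Otimes>\<^sub>M lborel))"
    by (subst lborel_complex, subst nn_integral_distr) (auto simp: split_beta)
  show 1: "(\<integral>\<^sup>+z. f z \<partial>lborel) = (\<integral>\<^sup>+x. \<integral>\<^sup>+y. f (Complex x y) \<partial>lborel \<partial>lborel)"
    unfolding * by (subst lborel.nn_integral_fst[symmetric]) auto
  show "(\<integral>\<^sup>+z. f z \<partial>lborel) = (\<integral>\<^sup>+y. \<integral>\<^sup>+x. f (Complex x y) \<partial>lborel \<partial>lborel)"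
    unfolding 1 by (rule lborel_pair.Fubini') measurable
qed

section \<open>Shears and rotations of the plane\<close>

lemma nn_integral_lborel_translate:
  fixes f :: "real \<Rightarrow> ennreal"
  assumes [measurable]: "f \<in> borel_measurable borel"
  shows "(\<integral>\<^sup>+x. f (x + c) \<partial>lborel) = (\<integral>\<^sup>+x. f x \<partial>lborel)"
  using nn_integral_real_affine[of f 1 c] by (simp add: add.commute)

lemma nn_integral_shear_Re:
  assumes [measurable]: "f \<in> borel_measurable borel"
  shows "(\<integral>\<^sup>+z. f (Complex (Re z + t * Im z) (Im z)) \<partial>lborel) = (\<integral>\<^sup>+z. f z \<partial>lborel)"
  by (subst (1 2) nn_integral_complex(2)) (auto intro!: nn_integral_cong nn_integral_lborel_translate)

lemma nn_integral_shear_Im: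
  assumes [measurable]: "f \<in> borel_measurable borel"
  shows "(\<integral>\<^sup>+z. f (Complex (Re z) (Im z + t * Re z)) \<partial>lborel) = (\<integral>\<^sup>+z. f z \<partial>lborel)"
  by (subst (1 2) nn_integral_complex(1)) (auto intro!: nn_integral_cong nn_integral_lborel_translate)

text \<open>A rotation of the plane (other than by \<open>\<pi>\<close>) is a product of three shears.\<close>
lemma nn_integral_rotate:
  fixes u :: complex
  assumes [measurable]: "f \<in> borel_measurable borel" and u: "norm u = 1"
  shows "(\<integral>\<^sup>+z. f (u * z) \<partial>lborel) = (\<integral>\<^sup>+z. f z \<partial>lborel)"
proof -
  have main: "(\<integral>\<^sup>+z. f (u * z) \<partial>lborel) = (\<integral>\<^sup>+z. f z \<partial>lborel)"
    if [measurable]: "f \<in> borel_measurable borel" and u: "norm u = 1" and "Im u \<noteq> 0" for f and u :: complex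
  proof -
    \<comment> \<open>For \<open>u = cis \<theta>\<close> these are \<open>s = sin \<theta>\<close>
      and \<open>t = - tan (\<theta> / 2)\<close>: the rotation is a horizontal shear by
      \<open>t\<close>, a vertical one by \<open>s\<close>, and again a horizontal one by
      \<open>t\<close>.\<close>
    define s where "s = Im u"
    define t where "t = (Re u - 1) / s"
    have s: "s \<noteq> 0" using that by (simp add: s_def)
    have sq: "(Re u)\<^sup>2 + s\<^sup>2 = 1"
      using u unfolding s_def by (simp add: norm_complex_def)
    have 1: "1 + t * s = Re u" using s by (simp add: t_def)
    have "t * (1 + Re u) = ((Re u)\<^sup>2 - 1) / s"
      by (simp add: t_def field_simps power2_eq_square)
    also have "\<dots> = - s" using sq s by (simp add: field_simps power2_eq_square)
    finally have 2: "t + t * (Re u) = - s" by (simp add: algebra_simps)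
    have "(\<integral>\<^sup>+z. f z \<partial>lborel) = (\<integral>\<^sup>+z. f (Complex (Re z + t * Im z) (Im z)) \<partial>lborel)"
      by (rule nn_integral_shear_Re[symmetric]) measurable
    also have "\<dots> = (\<integral>\<^sup>+z. (\<lambda>z. f (Complex (Re z + t * Im z) (Im z))) (Complex (Re z) (Im z + s * Re z)) \<partial>lborel)"
      by (rule nn_integral_shear_Im[symmetric]) measurable
    also have "\<dots> = (\<integral>\<^sup>+z. (\<lambda>z. f (Complex (Re z + t * (Im z + s * Re z)) (Im z + s * Re z))) (Complex (Re z + t * Im z) (Im z)) \<partial>lborel)"
      using nn_integral_shear_Re[where t=t and f="\<lambda>z. f (Complex (Re z + t * (Im z + s * Re z)) (Im z + s * Re z))"]
      by simp
    also have "\<dots> = (\<integral>\<^sup>+z. f (u * z) \<partial>lborel)"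
    proof (rule nn_integral_cong, unfold complex.sel, rule arg_cong[of _ _ f], rule complex_eqI, unfold complex.sel)
      fix z
      have "Re z + t * Im z + t * (Im z + s * (Re z + t * Im z)) = (1 + t * s) * Re z + (t + t * (1 + t * s)) * Im z"
        by (simp add: algebra_simps)
      also have "\<dots> = Re (u * z)" unfolding 1 2 by (simp add: s_def)
      finally show "Re z + t * Im z + t * (Im z + s * (Re z + t * Im z)) = Re (u * z)" .
      have "Im z + s * (Re z + t * Im z) = (1 + t * s) * Im z + s * Re z"
        by (simp add: algebra_simps)
      also have "\<dots> = Im (u * z)" unfolding 1 by (simp add: s_def)
      finally show "Im z + s * (Re z + t * Im z) = Im (u * z)" .
    qed
    finally show ?thesis by simp
  qed
  show ?thesis
  proof (cases "Im u = 0")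
    case True
    then have "(Re u)\<^sup>2 = 1" using u by (auto simp: norm_complex_def abs_if split: if_splits)
    then consider "u = 1" | "u = -1"
      using True by (auto simp: power2_eq_1_iff complex_eq_iff)
    then show ?thesis
    proof cases
      \<comment> \<open>The half turn has vanishing sine, which excludes the shear factorisation; it
        is done as two quarter turns.\<close>
      case 2
      have "(\<integral>\<^sup>+z. f z \<partial>lborel) = (\<integral>\<^sup>+z. f (\<i> * z) \<partial>lborel)"
        by (rule main[symmetric]) auto
      also have "\<dots> = (\<integral>\<^sup>+z. f (\<i> * (\<i> * z)) \<partial>lborel)"
        by (rule main[symmetric, where f="\<lambda>z. f (\<i> * z)"]) auto
      finally show ?thesis using 2 by (simp flip: mult.assoc)
    qed simp
  next
    case False
    then show ?thesis using u main[of f u] by auto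
  qed
qed

text \<open>The spaces are defined with the gauge integral over balls. The arguments use the Bochner
  integral over this finite measure, for Fubini and dominated convergence;
  \<open>integral_disc_eq_HK\<close> and \<open>bergman1_iff\<close> translate between the
  two.\<close>

definition disc :: "complex measure" where
  "disc = restrict_space lborel (ball 0 1)"

lemma space_disc [simp]: "space disc = ball 0 1"
  by (simp add: disc_def space_restrict_space)

lemma sets_disc: "sets disc = sets (restrict_space borel (ball 0 1))"
  by (simp add: disc_def sets_restrict_space)

lemma measurable_disc_cong: "measurable disc N = measurable (restrict_space borel (ball 0 1)) N"
  by (rule measurable_cong_sets) (auto simp: sets_disc)

lemma borel_measurable_disc_continuous:
  "continuous_on (ball 0 1) f \<Longrightarrow> f \<in> borel_measurable disc"
  by (simp add: measurable_disc_cong borel_measurable_continuous_on_restrict)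

lemma borel_measurable_disc_borel:
  "f \<in> borel_measurable borel \<Longrightarrow> f \<in> borel_measurable disc"
  by (simp add: measurable_disc_cong measurable_restrict_space1)

lemma emeasure_disc_space: "emeasure disc (ball 0 1) = pi"
  by (simp add: disc_def emeasure_restrict_space emeasure_ball unit_ball_vol_2)

interpretation disc: finite_measure disc
  by standard (simp add: emeasure_disc_space)

lemma disc_eqI:
  assumes "sets M = sets disc" "\<And>f. f \<in> borel_measurable disc \<Longrightarrow> integral\<^sup>N M f = integral\<^sup>N disc f"
  shows "M = disc"
proof (rule measure_eqI)
  fix A assume "A \<in> sets M"
  then show "emeasure M A = emeasure disc A"
    using assms(2)[of "indicator A"] assms(1) by simp
qed (use assms in simp)

lemma integral_disc_cong:
  "(\<And>z. cmod z < 1 \<Longrightarrow> f z = g z) \<Longrightarrow> (\<integral>z. f z \<partial>disc) = (\<integral>z. g z \<partial>disc)"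
  by (rule Bochner_Integration.integral_cong) auto

lemma rotate_disc_measurable [measurable]: "norm u = 1 \<Longrightarrow> (\<lambda>z. u * z) \<in> measurable disc disc"
  unfolding disc_def by (rule measurable_restrict_space3) (auto simp: norm_mult)

lemma distr_rotate_disc:
  assumes u: "norm u = 1"
  shows "distr disc disc (\<lambda>z. u * z) = disc"
proof (rule disc_eqI)
  fix f :: "complex \<Rightarrow> ennreal" assume f[measurable]: "f \<in> borel_measurable disc"
  have [measurable]: "(\<lambda>z. f z * indicator (ball 0 1) z) \<in> borel_measurable borel"
    using f by (simp add: measurable_disc_cong borel_measurable_restrict_space_iff_ennreal)
  have ball: "u * z \<in> ball 0 1 \<longleftrightarrow> z \<in> ball 0 1" for z using u by (simp add: norm_mult)
  have "integral\<^sup>N (distr disc disc (\<lambda>z. u * z)) f = (\<integral>\<^sup>+z. f (u * z) \<partial>disc)"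
    using u by (subst nn_integral_distr) auto
  also have "\<dots> = (\<integral>\<^sup>+z. f (u * z) * indicator (ball 0 1) (u * z) \<partial>lborel)"
    unfolding disc_def by (subst nn_integral_restrict_space) (auto simp: indicator_def norm_mult u intro!: nn_integral_cong)
  also have "\<dots> = (\<integral>\<^sup>+z. f z * indicator (ball 0 1) z \<partial>lborel)"
    by (rule nn_integral_rotate[where f="\<lambda>z. f z * indicator (ball 0 1) z"]) (use u in auto)
  also have "\<dots> = integral\<^sup>N disc f"
    unfolding disc_def by (subst nn_integral_restrict_space) auto
  finally show "integral\<^sup>N (distr disc disc (\<lambda>z. u * z)) f = integral\<^sup>N disc f" .
qed simp

text \<open>Polar coordinates in the form of an image measure: \<open>|z|^2\<close> is uniformly
  distributed on \<open>[0,1]\<close> with total mass \<open>pi\<close>. Comparing half lines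
  suffices, and for \<open>x\<close> in \<open>[0,1)\<close> both sides are the area
  \<open>pi * (1 - x)\<close> of an annulus.\<close>

lemma distr_cmod_sq_disc:
  "distr disc borel (\<lambda>z. (cmod z)\<^sup>2) = density lborel (\<lambda>t. ennreal pi * indicator {0..1} t)"
proof (rule measure_eqI_lessThan)
  have [measurable]: "(\<lambda>z. (cmod z)\<^sup>2) \<in> borel_measurable disc"
    by (rule borel_measurable_disc_borel) measurable
  fix x :: real
  show "emeasure (distr disc borel (\<lambda>z. (cmod z)\<^sup>2)) {x<..} < \<infinity>"
    by (subst emeasure_distr) (auto simp: less_top[symmetric])
  let ?I = "{0..1} \<inter> {x<..}"
  let ?S = "{z \<in> ball (0::complex) 1. x < (cmod z)\<^sup>2}"
  have L: "emeasure (distr disc borel (\<lambda>z. (cmod z)\<^sup>2)) {x<..} = emeasure lborel ?S"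
  proof -
    have "emeasure (distr disc borel (\<lambda>z. (cmod z)\<^sup>2)) {x<..} = emeasure disc ?S"
      by (subst emeasure_distr) (auto intro!: arg_cong2[where f=emeasure])
    also have "\<dots> = emeasure lborel ?S"
      unfolding disc_def by (subst emeasure_restrict_space) auto
    finally show ?thesis .
  qed
  have R: "emeasure (density lborel (\<lambda>t. ennreal pi * indicator {0..1} t)) {x<..} = ennreal pi * emeasure lborel (?I)"
    by (simp add: emeasure_density nn_integral_cmult mult.assoc flip: indicator_inter_arith)
  consider "x < 0" | "0 \<le> x" "x < 1" | "1 \<le> x" by linarith
  then show "emeasure (distr disc borel (\<lambda>z. (cmod z)\<^sup>2)) {x<..} = emeasure (density lborel (\<lambda>t. ennreal pi * indicator {0..1} t)) {x<..}"
    unfolding L R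
  proof cases
    case 1
    then have "?S = ball 0 1" "?I = {0..1}"
      by (auto intro: less_le_trans[OF _ zero_le_power2])
    then show "emeasure lborel ?S = ennreal pi * emeasure lborel (?I)"
      by (simp add: emeasure_ball unit_ball_vol_2)
  next
    case 2
    have eq: "x < (cmod z)\<^sup>2 \<longleftrightarrow> sqrt x < cmod z" for z
      using real_sqrt_less_iff[of x "(cmod z)\<^sup>2"] by simp
    have S: "?S = ball 0 1 - cball 0 (sqrt x)" unfolding eq by auto
    have "cball (0::complex) (sqrt x) \<subseteq> ball 0 1"
      using 2 real_sqrt_lt_1_iff[of x] by (subst cball_subset_ball_iff) simp
    then have "emeasure lborel ?S = emeasure lborel (ball (0::complex) 1) - emeasure lborel (cball (0::complex) (sqrt x))"
      unfolding S using emeasure_bounded_finite[of "cball (0::complex) (sqrt x)"] by (intro emeasure_Diff) auto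
    also have "\<dots> = ennreal (pi * (1 - x))"
      using 2 by (simp add: emeasure_ball emeasure_cball unit_ball_vol_2 ennreal_minus right_diff_distrib)
    finally have S: "emeasure lborel ?S = ennreal (pi * (1 - x))" .
    have "?I = {x<..1}" using 2 by auto
    then show "emeasure lborel ?S = ennreal pi * emeasure lborel (?I)"
      unfolding S using 2 by (simp add: ennreal_mult)
  next
    case 3
    have "\<not> x < (cmod z)\<^sup>2" if "z \<in> ball 0 1" for z
      using power_le_one[of "cmod z" 2] that 3 by simp
    then have S: "?S = {}" by blast
    have "?I = {}" using 3 by auto
    then show "emeasure lborel ?S = ennreal pi * emeasure lborel (?I)"
      unfolding S by simp
  qed
qed simp_all

lemma integral_disc_radial:
  fixes F :: "real \<Rightarrow> real"
  assumes [measurable]: "F \<in> borel_measurable borel"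
  shows "(\<integral>z. F ((cmod z)\<^sup>2) \<partial>disc) = pi * (\<integral>t. indicator {0..1} t *\<^sub>R F t \<partial>lborel)"
proof -
  have [measurable]: "(\<lambda>z. (cmod z)\<^sup>2) \<in> borel_measurable disc"
    by (rule borel_measurable_disc_borel) measurable
  have "(\<integral>z. F ((cmod z)\<^sup>2) \<partial>disc) = (\<integral>t. F t \<partial>distr disc borel (\<lambda>z. (cmod z)\<^sup>2))"
    by (subst integral_distr) auto
  also have "distr disc borel (\<lambda>z. (cmod z)\<^sup>2) = density lborel (\<lambda>t. ennreal (pi * indicator {0..1} t))"
    unfolding distr_cmod_sq_disc by (intro arg_cong[where f="density lborel"] ext) (auto simp: indicator_def)
  also have "(\<integral>t. F t \<partial>density lborel (\<lambda>t. ennreal (pi * indicator {0..1} t)))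
      = (\<integral>t. pi * (indicator {0..1} t *\<^sub>R F t) \<partial>lborel)"
    by (subst integral_density) (auto simp: mult_ac)
  finally show ?thesis by simp
qed

lemma integral_disc_power_ball:
  assumes "0 \<le> r" "r \<le> 1"
  shows "(\<integral>z. indicator (ball 0 r) z * cmod z ^ (2 * k) \<partial>disc) = pi * r ^ (2 * k + 2) / (k + 1)"
proof -
  have ind: "indicator (ball 0 r) z = (indicator {..<r\<^sup>2} ((cmod z)\<^sup>2) :: real)" for z :: complex
    using assms power_mono_iff[of r "cmod z" 2] by (auto simp: indicator_def not_less[symmetric])
  have sq: "r\<^sup>2 \<le> 1" using assms by (simp add: power_le_one)
  have "(\<integral>z. indicator (ball 0 r) z * cmod z ^ (2 * k) \<partial>disc)
      = pi * (\<integral>t. indicator {0..1} t *\<^sub>R (indicator {..<r\<^sup>2} t * t ^ k) \<partial>lborel)"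
    unfolding ind power_mult by (rule integral_disc_radial) measurable
  also have "(\<integral>t. indicator {0..1} t *\<^sub>R (indicator {..<r\<^sup>2} t * t ^ k) \<partial>lborel) = (\<integral>t. t ^ k * indicator {0..r\<^sup>2} t \<partial>lborel)"
    by (rule integral_cong_AE)
       (use AE_lborel_singleton[of "r\<^sup>2"] sq in \<open>auto elim!: eventually_mono simp: indicator_def\<close>)
  also have "pi * \<dots> = pi * r ^ (2 * k + 2) / (k + 1)"
    by (simp add: integral_power flip: power_mult) (simp add: power2_eq_square mult_ac)
  finally show ?thesis .
qed

lemma integral_disc_inverse_sq:
  fixes a :: real
  assumes a: "0 \<le> a" "a < 1"
  shows "(\<integral>z. 1 / (1 - a * (cmod z)\<^sup>2)\<^sup>2 \<partial>disc) = pi / (1 - a)"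
proof -
  have pos: "0 < 1 - a * t" if "0 \<le> t" "t \<le> 1" for t
    using mult_left_le[of t a] that a by linarith
  have "(\<integral>z. 1 / (1 - a * (cmod z)\<^sup>2)\<^sup>2 \<partial>disc) = pi * (\<integral>t. indicator {0..1} t *\<^sub>R (1 / (1 - a * t)\<^sup>2) \<partial>lborel)"
    by (rule integral_disc_radial) measurable
  \<comment> \<open>The antiderivative \<open>t / (1 - a * t)\<close> differs from
    \<open>1 / (a * (1 - a * t))\<close> by a constant and makes sense for \<open>a = 0\<close> as
    well.\<close>
  also have "(\<integral>t. indicator {0..1} t *\<^sub>R (1 / (1 - a * t)\<^sup>2) \<partial>lborel) = 1 / (1 - a * 1) - 0 / (1 - a * 0)"
  proof (rule integral_FTC_atLeastAtMost)
    fix t :: real assume t: "0 \<le> t" "t \<le> 1"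
    have "((\<lambda>t. t / (1 - a * t)) has_real_derivative 1 / (1 - a * t)\<^sup>2) (at t within {0..1})"
      using pos[OF t] by (auto intro!: derivative_eq_intros simp: field_simps power2_eq_square)
    then show "((\<lambda>t. t / (1 - a * t)) has_vector_derivative 1 / (1 - a * t)\<^sup>2) (at t within {0..1})"
      by (simp add: has_real_derivative_iff_has_vector_derivative)
  next
    show "continuous_on {0..1} (\<lambda>t. 1 / (1 - a * t)\<^sup>2)"
      using pos by (intro continuous_intros) (auto simp: less_imp_neq[THEN not_sym])
  qed simp
  finally show ?thesis by simp
qed

lemma integral_disc_power: "(\<integral>z. cmod z ^ (2 * k) \<partial>disc) = pi / (k + 1)"
proof -
  have "(\<integral>z. cmod z ^ (2 * k) \<partial>disc) = (\<integral>z. indicator (ball 0 1) z * cmod z ^ (2 * k) \<partial>disc)"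
    by (intro integral_disc_cong) auto
  then show ?thesis by (simp add: integral_disc_power_ball)
qed

subsection \<open>Circle means\<close>

text \<open>Parametrised over \<open>[0,1]\<close> to have mass one, so that circle means carry no
  factor \<open>1 / (2 * pi)\<close>.\<close>

definition circ :: "real measure" where
  "circ = restrict_space lborel {0..1}"

definition circle_path :: "real \<Rightarrow> complex" where
  "circle_path t = cis (2 * pi * t)"

lemma space_circ [simp]: "space circ = {0..1}"
  by (simp add: circ_def space_restrict_space)

lemma emeasure_circ_space: "emeasure circ {0..1} = 1"
  by (simp add: circ_def emeasure_restrict_space)

interpretation circ: finite_measure circ
  by standard (simp add: emeasure_circ_space)

lemma measure_circ_space [simp]: "measure circ {0..1} = 1"
  by (simp add: measure_def emeasure_circ_space)

lemma norm_circle_path [simp]: "cmod (circle_path t) = 1"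
  by (simp add: circle_path_def)

lemma circle_path_nonzero [simp]: "circle_path t \<noteq> 0"
  by (simp add: circle_path_def)

lemma cnj_circle_path: "cnj (circle_path t) = inverse (circle_path t)"
  by (simp add: circle_path_def cis_cnj)

lemma continuous_on_circle_path [continuous_intros]: "continuous_on A circle_path"
  unfolding circle_path_def cis_conv_exp by (intro continuous_intros)

lemma measurable_circ_borel: "f \<in> borel_measurable borel \<Longrightarrow> f \<in> borel_measurable circ"
  by (simp add: circ_def measurable_restrict_space1)

lemma circle_path_measurable [measurable]: "circle_path \<in> borel_measurable circ"
  by (intro measurable_circ_borel borel_measurable_continuous_onI continuous_on_circle_path)

lemma integrable_circ_continuous:
  fixes f :: "real \<Rightarrow> 'a::{banach, second_countable_topology}"
  shows "continuous_on {0..1} f \<Longrightarrow> integrable circ f"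
  using borel_integrable_atLeastAtMost'[of 0 1 f]
  by (simp add: circ_def integrable_restrict_space set_integrable_def)

lemma integral_circ_power_int: "(\<integral>t. circle_path t powi m \<partial>circ) = of_bool (m = 0)"
proof (cases "m = 0")
  case False
  let ?c = "2 * pi * \<i> * of_int m"
  have eq: "circle_path t powi m = exp (?c * of_real t)" for t
    by (simp add: circle_path_def Complex.cis_power_int) (simp add: cis_conv_exp mult_ac)
  have c: "?c \<noteq> 0" using False by simp
  have exp1: "exp ?c = 1"
    using exp_integer_2pi[of "of_int m"] by (simp add: mult_ac)
  have "(\<integral>t. circle_path t powi m \<partial>circ) = (\<integral>t. indicator {0..1} t *\<^sub>R exp (?c * of_real t) \<partial>lborel)"
    unfolding eq circ_def by (rule integral_restrict_space) simp
  also have "\<dots> = exp (?c * of_real 1) / ?c - exp (?c * of_real 0) / ?c"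
  proof (rule integral_FTC_atLeastAtMost)
    show "((\<lambda>x. exp (?c * of_real x) / ?c) has_vector_derivative exp (?c * of_real x)) (at x within {0..1})" for x :: real
      using c by (auto intro!: derivative_eq_intros has_vector_derivative_real_field)
  qed (auto intro!: continuous_intros)
  also have "\<dots> = 0" using exp1 by simp
  finally show ?thesis using False by simp
qed simp

lemma integral_circ_monomials:
  "(\<integral>t. circle_path t ^ j * cnj (circle_path t) ^ k \<partial>circ) = of_bool (j = k)"
proof -
  have "circle_path t ^ j * cnj (circle_path t) ^ k = circle_path t powi (int j - int k)" for t
    by (simp add: cnj_circle_path power_int_diff field_simps)
  then show ?thesis by (simp add: integral_circ_power_int)
qed

lemma rotate_pair_measurable:
  "(\<lambda>(z, t). circle_path t * z) \<in> measurable (disc \<Otimes>\<^sub>M circ) disc"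
proof -
  have [measurable]: "(\<lambda>z. z) \<in> borel_measurable disc"
    by (rule borel_measurable_disc_borel) measurable
  have [measurable]: "(\<lambda>(z, t). circle_path t * z) \<in> measurable (disc \<Otimes>\<^sub>M circ) lborel"
    by simp
  show ?thesis
    by (subst (2) disc_def, rule measurable_restrict_space2) (auto simp: space_pair_measure norm_mult)
qed

interpretation disc_circ: pair_sigma_finite disc circ ..

text \<open>Fubini combined with invariance under each single rotation. This stands in for polar
  coordinates: orthogonality and norm estimates on the disc reduce to circle means.\<close>

lemma
  fixes F :: "complex \<Rightarrow> 'a::{banach, second_countable_topology}"
  assumes F: "integrable disc F"
  shows integrable_disc_average: "integrable disc (\<lambda>z. \<integral>t. F (circle_path t * z) \<partial>circ)"
    and integral_disc_average: "(\<integral>z. (\<integral>t. F (circle_path t * z) \<partial>circ) \<partial>disc) = (\<integral>z. F z \<partial>disc)"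
proof -
  have [measurable]: "F \<in> borel_measurable disc" using F by auto
  note rotate_pair_measurable [measurable]
  have [measurable]: "(\<lambda>(z, t). F (circle_path t * z)) \<in> borel_measurable (disc \<Otimes>\<^sub>M circ)"
    using measurable_comp[OF rotate_pair_measurable, of F borel] by (simp add: comp_def split_beta)
  have rot: "(\<integral>\<^sup>+z. ennreal (norm (F (circle_path t * z))) \<partial>disc) = (\<integral>\<^sup>+z. ennreal (norm (F z)) \<partial>disc)" for t
    by (subst (2) distr_rotate_disc[symmetric, of "circle_path t"], simp, subst nn_integral_distr) auto
  \<comment> \<open>Tonelli for the norm comes first; it justifies Fubini on the product.\<close>
  have "integrable (disc \<Otimes>\<^sub>M circ) (\<lambda>(z, t). F (circle_path t * z))"
  proof (rule integrableI_bounded)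
    have "(\<integral>\<^sup>+x. ennreal (norm (case x of (z, t) \<Rightarrow> F (circle_path t * z))) \<partial>(disc \<Otimes>\<^sub>M circ))
      = (\<integral>\<^sup>+t. \<integral>\<^sup>+z. ennreal (norm (F (circle_path t * z))) \<partial>disc \<partial>circ)"
      by (subst disc_circ.nn_integral_snd[symmetric]) auto
    also have "\<dots> = (\<integral>\<^sup>+z. ennreal (norm (F z)) \<partial>disc)"
      unfolding rot by (simp add: emeasure_circ_space)
    also have "\<dots> < \<infinity>" using F by (simp add: integrable_iff_bounded)
    finally show "(\<integral>\<^sup>+x. ennreal (norm (case x of (z, t) \<Rightarrow> F (circle_path t * z))) \<partial>(disc \<Otimes>\<^sub>M circ)) < \<infinity>" .
  qed measurable
  note int = this
  show "integrable disc (\<lambda>z. \<integral>t. F (circle_path t * z) \<partial>circ)"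
    using disc_circ.integrable_fst[OF int] by simp
  have "(\<integral>z. (\<integral>t. F (circle_path t * z) \<partial>circ) \<partial>disc) = (\<integral>t. (\<integral>z. F (circle_path t * z) \<partial>disc) \<partial>circ)"
    using disc_circ.Fubini_integral[OF int] by simp
  moreover have "(\<integral>z. F (circle_path t * z) \<partial>disc) = (\<integral>z. F z \<partial>disc)" for t
    by (subst (2) distr_rotate_disc[symmetric, of "circle_path t"], simp, subst integral_distr) auto
  ultimately show "(\<integral>z. (\<integral>t. F (circle_path t * z) \<partial>circ) \<partial>disc) = (\<integral>z. F z \<partial>disc)" by simp
qed

section \<open>Taylor coefficients as circle means\<close>

lemma taylor_sums:
  assumes "g holomorphic_on ball 0 1" "cmod z < 1"
  shows "(\<lambda>k. taylor_coeff g k * z ^ k) sums g z"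
  using holomorphic_power_series[OF assms(1), of z] assms(2) by (simp add: taylor_coeff_def)

lemma power_series_abs_summable_ball:
  fixes c :: "nat \<Rightarrow> complex"
  assumes "\<And>z. cmod z < 1 \<Longrightarrow> summable (\<lambda>k. c k * z ^ k)" "\<bar>r\<bar> < 1"
  shows "summable (\<lambda>k. norm (c k) * r ^ k)"
proof -
  obtain s where s: "\<bar>r\<bar> < s" "s < 1" using assms(2) dense by blast
  have "summable (\<lambda>k. norm (c k * of_real r ^ k))"
    by (rule powser_insidea[OF assms(1)[of "of_real s"]]) (use s in auto)
  then have "summable (\<lambda>k. norm (norm (c k) * r ^ k))"
    by (simp add: norm_mult norm_power abs_mult power_abs)
  then show ?thesis by (rule summable_norm_cancel)
qed

lemma taylor_abs_summable:
  assumes "g holomorphic_on ball 0 1" "\<bar>r\<bar> < 1"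
  shows "summable (\<lambda>k. norm (taylor_coeff g k) * r ^ k)"
  using power_series_abs_summable_ball[of "taylor_coeff g" r] taylor_sums[OF assms(1)] assms(2)
  by (blast intro: sums_summable)

text \<open>Orthogonality of the powers of \<open>circle_path t\<close>, applied term by term;
  absolute summability inside the disc permits the exchange. An arbitrary convergent series is
  allowed, so that uniqueness of coefficients follows as well.\<close>

lemma circ_mean_power_series:
  assumes g: "\<And>z. cmod z < 1 \<Longrightarrow> (\<lambda>k. c k * z ^ k) sums g z" and z: "cmod z < 1"
  shows "(\<integral>t. g (circle_path t * z) * cnj (circle_path t) ^ k \<partial>circ) = c k * z ^ k"
proof -
  let ?f = "\<lambda>j t. c j * z ^ j * (circle_path t ^ j * cnj (circle_path t) ^ k)"
  have "(\<lambda>j. ?f j t) sums (g (circle_path t * z) * cnj (circle_path t) ^ k)" for t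
    using sums_mult2[OF g[of "circle_path t * z"], of "cnj (circle_path t) ^ k"] z
    by (simp add: norm_mult power_mult_distrib mult_ac)
  then have eq: "g (circle_path t * z) * cnj (circle_path t) ^ k = (\<Sum>j. ?f j t)" for t
    by (simp add: sums_iff)
  have int: "integrable circ (?f j)" for j
    by (rule integrable_circ_continuous) (intro continuous_intros)
  have norm: "norm (?f j t) = norm (c j) * cmod z ^ j" for j t
    by (simp add: norm_mult norm_power)
  have summ: "summable (\<lambda>j. norm (c j) * cmod z ^ j)"
    using power_series_abs_summable_ball[of c "cmod z"] sums_summable[OF g] z by simp
  have "(\<lambda>j. \<integral>t. ?f j t \<partial>circ) sums (\<integral>t. (\<Sum>j. ?f j t) \<partial>circ)"
    by (rule sums_integral) (use summ int in \<open>auto simp only: norm intro!: AE_I2, simp_all\<close>)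
  moreover have "(\<integral>t. ?f j t \<partial>circ) = (if j = k then c k * z ^ k else 0)" for j
    by (simp add: integral_circ_monomials)
  ultimately have "(\<lambda>j. if j = k then c k * z ^ k else 0) sums (\<integral>t. (\<Sum>j. ?f j t) \<partial>circ)"
    by simp
  then show ?thesis
    unfolding eq by (rule sums_unique2) (rule sums_single[of k "\<lambda>_. c k * z ^ k"])
qed

lemma circ_mean_coeff:
  assumes g: "g holomorphic_on ball 0 1" and z: "cmod z < 1"
  shows "(\<integral>t. g (circle_path t * z) * cnj (circle_path t) ^ k \<partial>circ) = taylor_coeff g k * z ^ k"
  by (rule circ_mean_power_series[OF taylor_sums[OF g] z])

lemma taylor_coeff_unique:
  assumes c: "\<And>z. cmod z < 1 \<Longrightarrow> (\<lambda>k. c k * z ^ k) sums g z"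
  shows "taylor_coeff g k = c k"
proof -
  have "g holomorphic_on ball 0 1"
    by (rule power_series_holomorphic[of 0 1 c]) (use c in auto)
  \<comment> \<open>The same circle mean at the nonzero point \<open>1/2\<close> is evaluated once
    through the Taylor series and once through the given series.\<close>
  then show ?thesis
    using circ_mean_coeff[of g "1/2" k] circ_mean_power_series[OF c, of "1/2" k] by simp
qed

lemma holomorphic_disc_isCont: "g holomorphic_on ball 0 1 \<Longrightarrow> cmod z < 1 \<Longrightarrow> isCont g z"
  using holomorphic_on_imp_continuous_on[of g "ball 0 1"] by (simp add: continuous_on_eq_continuous_at)

lemma holomorphic_disc_bounded_cball:
  assumes g: "g holomorphic_on ball 0 1" and r: "r < 1"
  obtains B where "0 \<le> B" "\<And>z. cmod z \<le> r \<Longrightarrow> norm (g z) \<le> B"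
proof -
  have "compact (g ` cball 0 r)"
    using r by (intro compact_continuous_image continuous_on_subset[OF holomorphic_on_imp_continuous_on[OF g]]) auto
  then obtain B where "\<And>z. z \<in> cball 0 r \<Longrightarrow> norm (g z) \<le> B"
    using compact_imp_bounded bounded_iff by (metis imageI)
  then show ?thesis by (intro that[of "max B 0"]) (auto simp: le_max_iff_disj)
qed

lemma continuous_on_circle_mult:
  assumes "continuous_on (ball 0 1) g" "cmod z < 1"
  shows "continuous_on A (\<lambda>t. g (circle_path t * z))"
  by (rule continuous_on_compose2[OF assms(1)]) (use assms(2) in \<open>auto intro!: continuous_intros simp: norm_mult\<close>)

lemma taylor_coeff_le_circ_mean:
  assumes g: "g holomorphic_on ball 0 1" and z: "cmod z < 1"
  shows "norm (taylor_coeff g k) * cmod z ^ k \<le> (\<integral>t. norm (g (circle_path t * z)) \<partial>circ)"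
proof -
  have "norm (taylor_coeff g k) * cmod z ^ k = norm (\<integral>t. g (circle_path t * z) * cnj (circle_path t) ^ k \<partial>circ)"
    unfolding circ_mean_coeff[OF assms] by (simp add: norm_mult norm_power)
  also have "\<dots> \<le> (\<integral>t. norm (g (circle_path t * z) * cnj (circle_path t) ^ k) \<partial>circ)"
    by (rule integral_norm_bound)
  finally show ?thesis by (simp add: norm_mult norm_power)
qed

lemma integrable_disc_bounded:
  fixes f :: "complex \<Rightarrow> 'a::{banach, second_countable_topology}"
  assumes "f \<in> borel_measurable disc" "\<And>z. cmod z < 1 \<Longrightarrow> norm (f z) \<le> B"
  shows "integrable disc f"
  by (rule disc.integrable_const_bound[where B=B]) (use assms in \<open>auto intro!: AE_I2\<close>)

lemma integrable_disc_power: "integrable disc (\<lambda>z. cmod z ^ k)"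
  by (rule integrable_disc_bounded[where B=1])
     (auto intro!: borel_measurable_disc_borel power_le_one)

text \<open>The circle estimate averaged over the disc. Up to the factor \<open>pi\<close> the left
  side is the \<open>A^1\<close> norm of the monomial with coefficient
  \<open>taylor_coeff g k\<close>, so projecting onto one coefficient is a contraction.\<close>

lemma taylor_coeff_times_integral_le:
  assumes g: "g holomorphic_on ball 0 1" "integrable disc g"
  shows "norm (taylor_coeff g k) * (\<integral>z. cmod z ^ k \<partial>disc) \<le> (\<integral>z. norm (g z) \<partial>disc)"
proof -
  have "norm (taylor_coeff g k) * (\<integral>z. cmod z ^ k \<partial>disc) = (\<integral>z. norm (taylor_coeff g k) * cmod z ^ k \<partial>disc)"
    by simp
  also have "\<dots> \<le> (\<integral>z. \<integral>t. norm (g (circle_path t * z)) \<partial>circ \<partial>disc)"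
    by (rule integral_mono)
       (use g in \<open>auto intro!: integrable_disc_average taylor_coeff_le_circ_mean integrable_disc_power\<close>)
  also have "\<dots> = (\<integral>z. norm (g z) \<partial>disc)"
    by (rule integral_disc_average) (use g in auto)
  finally show ?thesis .
qed

lemma integral_radial_weight_monomial:
  fixes \<psi> :: "complex \<Rightarrow> complex"
  assumes g: "g holomorphic_on ball 0 1" and int: "integrable disc (\<lambda>z. \<psi> z * g z)"
    and radial: "\<And>u z. cmod u = 1 \<Longrightarrow> \<psi> (u * z) = \<psi> z"
  shows "(\<integral>z. \<psi> z * g z * cnj z ^ k \<partial>disc) = taylor_coeff g k * (\<integral>z. \<psi> z * of_real (cmod z ^ (2 * k)) \<partial>disc)"
proof -
  have "integrable disc (\<lambda>z. \<psi> z * g z * cnj z ^ k)"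
  proof (rule Bochner_Integration.integrable_bound[OF int])
    show "(\<lambda>z. \<psi> z * g z * cnj z ^ k) \<in> borel_measurable disc"
      by (rule borel_measurable_times[OF borel_measurable_integrable[OF int] borel_measurable_disc_continuous])
         (intro continuous_intros)
  qed (auto simp: norm_mult norm_power intro!: AE_I2 mult_left_le power_le_one)
  from integral_disc_average[OF this]
  have "(\<integral>z. \<psi> z * g z * cnj z ^ k \<partial>disc)
    = (\<integral>z. \<integral>t. \<psi> z * cnj z ^ k * (g (circle_path t * z) * cnj (circle_path t) ^ k) \<partial>circ \<partial>disc)"
    unfolding radial[OF norm_circle_path] complex_cnj_mult power_mult_distrib
    by (simp add: mult_ac)
  also have "\<dots> = (\<integral>z. \<psi> z * cnj z ^ k * (taylor_coeff g k * z ^ k) \<partial>disc)"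
    by (intro integral_disc_cong) (auto simp: circ_mean_coeff[OF g])
  also have "\<dots> = (\<integral>z. taylor_coeff g k * (\<psi> z * of_real (cmod z ^ (2 * k))) \<partial>disc)"
  proof (rule integral_disc_cong)
    fix z
    have "of_real (cmod z ^ (2 * k)) = (z * cnj z) ^ k"
      by (simp add: power_mult flip: complex_norm_square)
    then show "\<psi> z * cnj z ^ k * (taylor_coeff g k * z ^ k) = taylor_coeff g k * (\<psi> z * of_real (cmod z ^ (2 * k)))"
      by (simp add: power_mult_distrib mult_ac)
  qed
  finally show ?thesis by simp
qed

lemma integrable_disc_times_bounded:
  fixes f g :: "complex \<Rightarrow> complex"
  assumes f: "integrable disc f" and g: "g \<in> borel_measurable disc" "\<And>z. cmod z < 1 \<Longrightarrow> norm (g z) \<le> B"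
  shows "integrable disc (\<lambda>z. f z * g z)"
proof (rule Bochner_Integration.integrable_bound)
  show "integrable disc (\<lambda>z. B * norm (f z))" using f by auto
  show "(\<lambda>z. f z * g z) \<in> borel_measurable disc" using f g by auto
  have "norm (f z) * norm (g z) \<le> norm (f z) * \<bar>B\<bar>" if "cmod z < 1" for z
    using g(2)[OF that] by (intro mult_left_mono) auto
  then show "AE z in disc. norm (f z * g z) \<le> norm (B * norm (f z))"
    by (intro AE_I2) (auto simp: norm_mult abs_mult mult_ac)
qed

lemma sums_integral_disc_dominated:
  fixes f :: "nat \<Rightarrow> complex \<Rightarrow> complex"
  assumes int: "\<And>k. integrable disc (f k)" and G: "integrable disc G" and m: "summable m"
    and bound: "\<And>k z. cmod z < 1 \<Longrightarrow> norm (f k z) \<le> m k * norm (G z :: complex)"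
    and sums: "\<And>z. cmod z < 1 \<Longrightarrow> (\<lambda>k. f k z) sums F z"
  shows "(\<lambda>k. \<integral>z. f k z \<partial>disc) sums (\<integral>z. F z \<partial>disc)"
proof -
  have "(\<lambda>k. \<integral>z. f k z \<partial>disc) sums (\<integral>z. (\<Sum>k. f k z) \<partial>disc)"
  proof (rule sums_integral[OF int])
    show "AE z in disc. summable (\<lambda>k. norm (f k z))"
    proof (rule AE_I2)
      fix z assume z: "z \<in> space disc"
      show "summable (\<lambda>k. norm (f k z))"
        by (rule summable_comparison_test'[OF summable_mult2[OF m, of "norm (G z)"], of 0]) (use z bound in auto)
    qed
    show "summable (\<lambda>k. \<integral>z. norm (f k z) \<partial>disc)"
    proof (rule summable_comparison_test'[OF summable_mult2[OF m, of "\<integral>z. norm (G z) \<partial>disc"], of 0])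
      fix k
      have "(\<integral>z. norm (f k z) \<partial>disc) \<le> (\<integral>z. m k * norm (G z) \<partial>disc)"
        by (rule integral_mono) (use int G bound in auto)
      then show "norm (\<integral>z. norm (f k z) \<partial>disc) \<le> m k * (\<integral>z. norm (G z) \<partial>disc)"
        by simp
    qed
  qed
  moreover have "(\<integral>z. (\<Sum>k. f k z) \<partial>disc) = (\<integral>z. F z \<partial>disc)"
    using sums by (intro integral_disc_cong) (auto simp: sums_iff)
  ultimately show ?thesis by simp
qed

text \<open>The radius \<open>R\<close> covers two situations: a weight supported in a smaller disc,
  where \<open>c\<close> may come from any holomorphic function, and \<open>R = 1\<close>, where a
  dilation has already made the coefficients absolutely summable.\<close>

lemma integral_radial_weight_series:
  fixes \<psi> :: "complex \<Rightarrow> complex"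
  assumes g: "g holomorphic_on ball 0 1" and int: "integrable disc (\<lambda>z. \<psi> z * g z)"
    and radial: "\<And>u z. cmod u = 1 \<Longrightarrow> \<psi> (u * z) = \<psi> z"
    and supp: "\<And>z. R < cmod z \<Longrightarrow> cmod z < 1 \<Longrightarrow> \<psi> z = 0" and "0 \<le> R"
    and summ: "summable (\<lambda>k. norm (c k) * R ^ k)"
  shows "(\<lambda>k. c k * taylor_coeff g k * (\<integral>z. \<psi> z * of_real (cmod z ^ (2 * k)) \<partial>disc))
    sums (\<integral>z. \<psi> z * g z * (\<Sum>k. c k * cnj z ^ k) \<partial>disc)"
proof -
  let ?f = "\<lambda>k z. c k * (\<psi> z * g z * cnj z ^ k)"
  have "integrable disc (\<lambda>z. \<psi> z * g z * cnj z ^ k)" for k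
    by (rule integrable_disc_times_bounded[OF int, where B=1])
       (auto intro!: borel_measurable_disc_continuous continuous_intros simp: norm_power power_le_one)
  then have int_f: "integrable disc (?f k)" for k by auto
  have bound: "norm (?f k z) \<le> norm (c k) * R ^ k * norm (\<psi> z * g z)" if "cmod z < 1" for k z
  proof (cases "cmod z \<le> R")
    case True
    then have "cmod z ^ k \<le> R ^ k" by (simp add: power_mono)
    from mult_left_mono[OF this, of "norm (c k) * norm (\<psi> z * g z)"] show ?thesis
      by (simp add: norm_mult norm_power mult_ac)
  qed (use supp[OF _ that] in \<open>auto simp: not_le\<close>)
  have "(\<lambda>k. \<integral>z. ?f k z \<partial>disc) sums (\<integral>z. \<psi> z * g z * (\<Sum>k. c k * cnj z ^ k) \<partial>disc)"
  proof (rule sums_integral_disc_dominated[OF int_f int summ bound])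
    fix z :: complex assume z: "cmod z < 1"
    show "(\<lambda>k. ?f k z) sums (\<psi> z * g z * (\<Sum>k. c k * cnj z ^ k))"
    proof (cases "cmod z \<le> R")
      case True
      have "summable (\<lambda>k. c k * cnj z ^ k)"
        by (rule summable_comparison_test'[OF summ, of 0])
           (use True in \<open>auto simp: norm_mult norm_power intro!: mult_left_mono power_mono\<close>)
      from sums_mult[OF summable_sums[OF this], of "\<psi> z * g z"] show ?thesis
        by (simp add: mult_ac)
    qed (use supp[OF _ z] in \<open>auto simp: not_le\<close>)
  qed
  moreover have "(\<integral>z. ?f k z \<partial>disc) = c k * taylor_coeff g k * (\<integral>z. \<psi> z * of_real (cmod z ^ (2 * k)) \<partial>disc)" for k
    using integral_radial_weight_monomial[OF g int radial, of k] by (simp add: mult.assoc del: mult_cancel_left)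
  ultimately show ?thesis by (simp only: mult.assoc)
qed

text \<open>Multiplied by \<open>1 - |v|^2\<close>, the integrand at
  \<open>v = circle_path t * u\<close> is the Poisson kernel, which is the real part of
  \<open>2 / (1 - v) - 1\<close>; and the mean of \<open>1 / (1 - v)\<close> is its value at the
  origin.\<close>

lemma integral_circ_inverse_sq:
  assumes "cmod u < 1"
  shows "(\<integral>t. 1 / (cmod (1 - circle_path t * u))\<^sup>2 \<partial>circ) = 1 / (1 - (cmod u)\<^sup>2)"
proof -
  let ?h = "\<lambda>z::complex. 1 / (1 - z)"
  have hol: "?h holomorphic_on ball 0 1" by (intro holomorphic_intros) auto
  have cont: "continuous_on {0..1} (\<lambda>t. ?h (circle_path t * u))"
    by (rule continuous_on_circle_mult[OF holomorphic_on_imp_continuous_on[OF hol] assms])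
  have mean: "(\<integral>t. ?h (circle_path t * u) \<partial>circ) = 1"
    using circ_mean_coeff[OF hol assms, of 0] by (simp add: taylor_coeff_def)
  have "1 / (cmod (1 - v))\<^sup>2 = (2 * Re (?h v) - 1) / (1 - (cmod v)\<^sup>2)" if "cmod v < 1" for v
  proof -
    have "1 - v \<noteq> 0" using that by auto
    then have nz: "(cmod (1 - v))\<^sup>2 \<noteq> 0" by simp
    have "(cmod v)\<^sup>2 < 1" using that by (simp add: power_less_one_iff abs_square_less_1)
    have "Re (?h v) = (1 - Re v) / (cmod (1 - v))\<^sup>2"
      by (simp add: Re_divide' cmod_power2)
    moreover have "2 * (1 - Re v) - (cmod (1 - v))\<^sup>2 = 1 - (cmod v)\<^sup>2"
      unfolding cmod_power2 by (simp add: power2_eq_square algebra_simps)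
    ultimately have "2 * Re (?h v) - 1 = (1 - (cmod v)\<^sup>2) / (cmod (1 - v))\<^sup>2"
      using nz by (simp add: field_simps)
    then show ?thesis using \<open>(cmod v)\<^sup>2 < 1\<close> by simp
  qed
  from this[of "circle_path t * u" for t] assms
  have "(\<integral>t. 1 / (cmod (1 - circle_path t * u))\<^sup>2 \<partial>circ)
     = (\<integral>t. (2 * Re (?h (circle_path t * u)) - 1) / (1 - (cmod u)\<^sup>2) \<partial>circ)"
    by (simp add: norm_mult)
  also have "\<dots> = (2 * Re (\<integral>t. ?h (circle_path t * u) \<partial>circ) - 1) / (1 - (cmod u)\<^sup>2)"
    using integrable_circ_continuous[OF cont] by (simp del: integral_Re add: integral_Re[symmetric])
  finally show ?thesis by (simp add: mean)
qed

section \<open>Area integrals of Bergman-type kernels\<close>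

lemma mult_less_one_disc: "0 \<le> s \<Longrightarrow> s \<le> 1 \<Longrightarrow> cmod z < 1 \<Longrightarrow> s * cmod z < 1"
  using mult_left_le_one_le[of "cmod z" s] by simp

lemma cmod_mult_less_one: "cmod w < 1 \<Longrightarrow> cmod z < 1 \<Longrightarrow> cmod (w * z) < 1"
  using mult_less_one_disc[of "cmod w" z] by (simp add: norm_mult)

lemma one_minus_mult_disc:
  assumes "cmod w < 1" "cmod z < 1"
  shows "1 - cmod w \<le> cmod (1 - w * z)" "1 - w * z \<noteq> 0"
  using norm_triangle_ineq2[of 1 "w * z"] mult_left_le[of "cmod z" "cmod w"] cmod_mult_less_one[OF assms] assms(2)
  by (auto simp: norm_mult)

lemma inverse_cube_le_disc:
  assumes "cmod w < 1" "cmod z < 1"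
  shows "1 / cmod (1 - w * z) ^ 3 \<le> 1 / (1 - cmod w) ^ 3"
  using one_minus_mult_disc[OF assms] assms(1)
  by (intro divide_left_mono power_mono mult_pos_pos zero_less_power) auto

lemma integrable_disc_inverse_cube:
  assumes w: "cmod w < 1"
  shows "integrable disc (\<lambda>z. 1 / cmod (1 - w * z) ^ 3)"
  by (rule integrable_disc_bounded[where B="1 / (1 - cmod w) ^ 3"], rule borel_measurable_disc_continuous)
     (use one_minus_mult_disc(2)[OF w] inverse_cube_le_disc[OF w] in \<open>auto intro!: continuous_intros\<close>)

text \<open>On circles the exponent 3 is reduced to the explicitly integrable exponent 2
  by \<open>|1 - u| \<ge> 1 - |u|\<close>; this loses only a constant.\<close>
lemma integral_disc_inverse_cube_le:
  assumes w: "cmod w < 1"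
  shows "(\<integral>z. 1 / cmod (1 - w * z) ^ 3 \<partial>disc) \<le> 2 * pi / (1 - (cmod w)\<^sup>2)"
proof -
  note int3 = integrable_disc_inverse_cube[OF w]
  define a where "a = (cmod w)\<^sup>2"
  have a: "0 \<le> a" "a < 1" using w by (auto simp: a_def power_less_one_iff abs_square_less_1)
  have circ_le: "(\<integral>t. 1 / cmod (1 - w * (circle_path t * z)) ^ 3 \<partial>circ) \<le> 2 * (1 / (1 - a * (cmod z)\<^sup>2)\<^sup>2)"
    if z: "cmod z < 1" for z
  proof -
    define u where "u = w * z"
    have u: "cmod u < 1" using cmod_mult_less_one[OF w z] by (simp add: u_def)
    have ne: "1 - circle_path t * u \<noteq> 0" for t
      using u by (metis norm_circle_path norm_mult mult_1 norm_one order_less_irrefl right_minus_eq)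
    have "(\<integral>t. 1 / cmod (1 - w * (circle_path t * z)) ^ 3 \<partial>circ) = (\<integral>t. 1 / cmod (1 - circle_path t * u) ^ 3 \<partial>circ)"
      by (simp add: u_def mult_ac)
    also have "\<dots> \<le> (\<integral>t. 1 / (1 - cmod u) * (1 / (cmod (1 - circle_path t * u))\<^sup>2) \<partial>circ)"
    proof (rule integral_mono)
      fix t
      have "1 - cmod u \<le> cmod (1 - circle_path t * u)"
        using norm_triangle_ineq2[of 1 "circle_path t * u"] by (simp add: norm_mult)
      then have "(1 - cmod u) * (cmod (1 - circle_path t * u))\<^sup>2 \<le> cmod (1 - circle_path t * u) ^ 3"
        using mult_right_mono[of "1 - cmod u" "cmod (1 - circle_path t * u)" "(cmod (1 - circle_path t * u))\<^sup>2"]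
        by (simp add: power3_eq_cube power2_eq_square mult_ac)
      then show "1 / cmod (1 - circle_path t * u) ^ 3 \<le> 1 / (1 - cmod u) * (1 / (cmod (1 - circle_path t * u))\<^sup>2)"
        using u ne[of t] divide_left_mono[of "(1 - cmod u) * (cmod (1 - circle_path t * u))\<^sup>2" "cmod (1 - circle_path t * u) ^ 3" 1]
        by (simp add: mult_ac)
    qed (use ne u in \<open>auto intro!: integrable_circ_continuous continuous_intros\<close>)
    also have "\<dots> = 1 / (1 - cmod u) * (1 / (1 - (cmod u)\<^sup>2))"
      by (subst integral_mult_right_zero) (simp only: integral_circ_inverse_sq[OF u])
    \<comment> \<open>One more factor two makes the bound a function of \<open>|u|^2\<close> whose
      area integral is known exactly.\<close>
    also have "\<dots> \<le> 2 * (1 / (1 - (cmod u)\<^sup>2)\<^sup>2)"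
    proof -
      have pos: "1 - (cmod u)\<^sup>2 > 0" using u by (simp add: power_less_one_iff abs_square_less_1)
      have "1 - (cmod u)\<^sup>2 \<le> 2 * (1 - cmod u)"
        using zero_le_power2[of "1 - cmod u"] by (simp add: power2_eq_square algebra_simps)
      then have "1 / (1 - cmod u) \<le> 2 / (1 - (cmod u)\<^sup>2)"
        using u pos by (simp add: field_simps)
      from mult_right_mono[OF this, of "1 / (1 - (cmod u)\<^sup>2)"] pos show ?thesis
        by (simp add: power2_eq_square)
    qed
    finally show ?thesis by (simp add: u_def a_def norm_mult power_mult_distrib)
  qed
  have int: "integrable disc (\<lambda>z. 2 * (1 / (1 - a * (cmod z)\<^sup>2)\<^sup>2))"
  proof (intro integrable_mult_right integrable_disc_bounded)
    show "(\<lambda>z. 1 / (1 - a * (cmod z)\<^sup>2)\<^sup>2) \<in> borel_measurable disc"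
      by (rule borel_measurable_disc_borel) measurable
    show "norm (1 / (1 - a * (cmod z)\<^sup>2)\<^sup>2) \<le> 1 / (1 - a)\<^sup>2" if "cmod z < 1" for z
    proof -
      have "a * (cmod z)\<^sup>2 \<le> a" using a that by (intro mult_left_le) (auto simp: power_le_one)
      then have "1 / (1 - a * (cmod z)\<^sup>2)\<^sup>2 \<le> 1 / (1 - a)\<^sup>2"
        using a by (intro divide_left_mono power_mono mult_pos_pos zero_less_power) auto
      then show ?thesis by simp
    qed
  qed
  have "(\<integral>z. 1 / cmod (1 - w * z) ^ 3 \<partial>disc) = (\<integral>z. \<integral>t. 1 / cmod (1 - w * (circle_path t * z)) ^ 3 \<partial>circ \<partial>disc)"
    by (rule integral_disc_average[OF int3, symmetric])
  also have "\<dots> \<le> (\<integral>z. 2 * (1 / (1 - a * (cmod z)\<^sup>2)\<^sup>2) \<partial>disc)"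
    by (rule integral_mono) (use int circ_le integrable_disc_average[OF int3] in auto)
  also have "\<dots> = 2 * (pi / (1 - a))"
    by (subst integral_mult_right_zero) (simp only: integral_disc_inverse_sq[OF a])
  finally show ?thesis by (simp add: a_def)
qed

subsection \<open>Bergman and Bloch norms\<close>

lemma integral_disc_eq_HK:
  fixes f :: "complex \<Rightarrow> 'a::euclidean_space"
  assumes "integrable disc f"
  shows "f integrable_on ball 0 1" "integral (ball 0 1) f = (\<integral>z. f z \<partial>disc)"
proof -
  have "set_integrable lborel (ball 0 1) f"
    using assms by (simp add: disc_def integrable_restrict_space set_integrable_def)
  from set_borel_integral_eq_integral[OF this]
  show "f integrable_on ball 0 1" "integral (ball 0 1) f = (\<integral>z. f z \<partial>disc)"
    by (auto simp: disc_def integral_restrict_space set_lebesgue_integral_def)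
qed

text \<open>For nonnegative functions gauge integrability is Lebesgue integrability. Holomorphy
  supplies the Borel measurability that allows passing from the completed measure back to
  \<open>lborel\<close>.\<close>

lemma bergman1_iff: "f \<in> bergman1 \<longleftrightarrow> f holomorphic_on ball 0 1 \<and> integrable disc f"
proof (cases "f holomorphic_on ball 0 1")
  case True
  then have meas [measurable]: "f \<in> borel_measurable disc"
    by (intro borel_measurable_disc_continuous holomorphic_on_imp_continuous_on)
  have "integrable disc f" if int: "(\<lambda>z. norm (f z)) integrable_on ball 0 1"
  proof -
    have m: "(\<lambda>z. indicator (ball 0 1) z *\<^sub>R norm (f z)) \<in> borel_measurable lborel"
      using measurable_compose[OF meas borel_measurable_norm] by (simp add: measurable_disc_cong borel_measurable_restrict_space_iff)
    have "set_integrable lebesgue (ball 0 1) (\<lambda>z. norm (f z))"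
      using int by (intro nonnegative_absolutely_integrable_1) auto
    then have "integrable lborel (\<lambda>z. indicator (ball 0 1) z *\<^sub>R norm (f z))"
      unfolding set_integrable_def using integrable_completion[OF m] by simp
    then have "integrable disc (\<lambda>z. norm (f z))"
      by (simp add: disc_def integrable_restrict_space)
    then show ?thesis by (simp add: integrable_norm_iff)
  qed
  then show ?thesis
    using True integral_disc_eq_HK(1)[of "\<lambda>z. norm (f z)"] by (auto simp: bergman1_def)
qed (auto simp: bergman1_def)

lemma bergman1_holomorphic: "g \<in> bergman1 \<Longrightarrow> g holomorphic_on ball 0 1"
  and bergman1_integrable: "g \<in> bergman1 \<Longrightarrow> integrable disc g"
  by (auto simp: bergman1_iff)

lemma bergman1_norm_eq: "g \<in> bergman1 \<Longrightarrow> bergman1_norm g = (\<integral>z. norm (g z) \<partial>disc) / pi"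
  using integral_disc_eq_HK(2)[of "\<lambda>z. norm (g z)"] by (simp add: bergman1_iff bergman1_norm_def)

lemma bergman1_norm_nonneg: "g \<in> bergman1 \<Longrightarrow> 0 \<le> bergman1_norm g"
  by (simp add: bergman1_norm_eq)

lemma bergman1_bounded:
  assumes "g holomorphic_on ball 0 1" "\<And>z. cmod z < 1 \<Longrightarrow> norm (g z) \<le> B"
  shows "g \<in> bergman1"
  unfolding bergman1_iff
  using integrable_disc_bounded[OF borel_measurable_disc_continuous[OF holomorphic_on_imp_continuous_on[OF assms(1)]] assms(2)] assms(1)
  by blast

section \<open>Bloch seminorm and growth of Bloch functions\<close>

definition bloch_seminorm :: "(complex \<Rightarrow> complex) \<Rightarrow> real" where
  "bloch_seminorm f = (SUP z\<in>ball 0 1. (1 - (cmod z)\<^sup>2) * cmod (deriv f z))"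

lemma bloch_norm_eq: "bloch_norm f = cmod (f 0) + bloch_seminorm f"
  by (simp add: bloch_norm_def bloch_seminorm_def)

lemma bloch_holomorphic: "h \<in> bloch \<Longrightarrow> h holomorphic_on ball 0 1"
  by (simp add: bloch_def)

lemma bloch_deriv_bound:
  "h \<in> bloch \<Longrightarrow> cmod z < 1 \<Longrightarrow> (1 - (cmod z)\<^sup>2) * cmod (deriv h z) \<le> bloch_seminorm h"
  unfolding bloch_seminorm_def by (intro cSUP_upper) (auto simp: bloch_def)

lemma blochI:
  assumes "h holomorphic_on ball 0 1" "\<And>z. cmod z < 1 \<Longrightarrow> (1 - (cmod z)\<^sup>2) * cmod (deriv h z) \<le> B"
  shows "h \<in> bloch" "bloch_seminorm h \<le> B"
proof -
  show "h \<in> bloch"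
    unfolding bloch_def using assms by (auto intro!: bdd_aboveI2[where M=B])
  show "bloch_seminorm h \<le> B"
    unfolding bloch_seminorm_def using assms by (intro cSUP_least) auto
qed

lemma bloch_seminorm_nonneg: "h \<in> bloch \<Longrightarrow> 0 \<le> bloch_seminorm h"
  using bloch_deriv_bound[of h 0] by (auto intro: order_trans[OF norm_ge_zero])

lemma bloch_norm_nonneg: "h \<in> bloch \<Longrightarrow> 0 \<le> bloch_norm h"
  using bloch_seminorm_nonneg[of h] by (simp add: bloch_norm_eq)

lemma bloch_seminorm_le_norm: "bloch_seminorm h \<le> bloch_norm h"
  by (simp add: bloch_norm_eq)

lemma one_minus_sq_pos: "cmod z < 1 \<Longrightarrow> 0 < 1 - (cmod z)\<^sup>2"
  by (simp add: abs_square_less_1)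

lemma taylor_coeff_0: "taylor_coeff h 0 = h 0"
  by (simp add: taylor_coeff_def)

lemma taylor_coeff_deriv: "taylor_coeff (deriv h) k = of_nat (Suc k) * taylor_coeff h (Suc k)"
proof -
  have fact: "(of_nat (fact (Suc k)) :: complex) = of_nat (Suc k) * of_nat (fact k)"
    by (simp only: fact_Suc of_nat_mult of_nat_id)
  show ?thesis
    unfolding taylor_coeff_def fact funpow_Suc_right o_apply by (simp del: of_nat_Suc)
qed

lemma deriv_holomorphic_disc: "h holomorphic_on ball 0 1 \<Longrightarrow> deriv h holomorphic_on ball 0 1"
  by (intro holomorphic_deriv) auto

text \<open>A mean value estimate on the closed disc of radius \<open>|z|\<close>, where the
  derivative bound is worst on the rim. The true growth is logarithmic; this cruder rate suffices
  because the pairing will carry the weight \<open>1 - |z|^2\<close>.\<close>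

lemma bloch_growth:
  assumes h: "h \<in> bloch" and z: "cmod z < 1"
  shows "(1 - (cmod z)\<^sup>2) * cmod (h z) \<le> bloch_norm h"
proof -
  note pos = one_minus_sq_pos[OF z]
  let ?b = "bloch_seminorm h"
  have "cmod (h z - h 0) \<le> ?b / (1 - (cmod z)\<^sup>2) * cmod (z - 0)"
  proof (rule field_differentiable_bound[of "cball 0 (cmod z)" h "deriv h"])
    fix w :: complex assume w: "w \<in> cball 0 (cmod z)"
    then have w1: "cmod w < 1" using z by auto
    show "(h has_field_derivative deriv h w) (at w within cball 0 (cmod z))"
      using w1 holomorphic_derivI[OF bloch_holomorphic[OF h]] by auto
    have "(cmod w)\<^sup>2 \<le> (cmod z)\<^sup>2" using w by (intro power_mono) auto
    then have "(1 - (cmod z)\<^sup>2) * cmod (deriv h w) \<le> (1 - (cmod w)\<^sup>2) * cmod (deriv h w)"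
      by (intro mult_right_mono) auto
    also have "\<dots> \<le> ?b" by (rule bloch_deriv_bound[OF h w1])
    finally show "cmod (deriv h w) \<le> ?b / (1 - (cmod z)\<^sup>2)"
      using pos by (simp add: field_simps)
  qed auto
  also have "\<dots> \<le> ?b / (1 - (cmod z)\<^sup>2)"
    using z pos bloch_seminorm_nonneg[OF h] by (intro mult_left_le) auto
  finally have "(1 - (cmod z)\<^sup>2) * cmod (h z - h 0) \<le> ?b"
    using pos by (simp add: field_simps)
  moreover have "(1 - (cmod z)\<^sup>2) * cmod (h z) \<le> (1 - (cmod z)\<^sup>2) * cmod (h z - h 0) + (1 - (cmod z)\<^sup>2) * cmod (h 0)"
    using pos norm_triangle_ineq[of "h z - h 0" "h 0"] by (simp flip: distrib_left)
  moreover have "(1 - (cmod z)\<^sup>2) * cmod (h 0) \<le> cmod (h 0)"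
    using mult_left_le[of "1 - (cmod z)\<^sup>2" "cmod (h 0)"] by (simp add: mult.commute)
  ultimately show ?thesis by (simp add: bloch_norm_eq)
qed

subsection \<open>The duality pairing\<close>

text \<open>The pairing is rewritten as an absolutely convergent integral against
  \<open>z h'(z) + 2 h(z)\<close>, whose \<open>k\<close>-th coefficient \<open>(k + 2) h_k\<close> cancels the moments of
  the weight \<open>1 - |z|\<^sup>2\<close>.\<close>
definition bloch_kernel :: "(complex \<Rightarrow> complex) \<Rightarrow> complex \<Rightarrow> complex" where
  "bloch_kernel h z = z * deriv h z + 2 * h z"

lemma bloch_kernel_holomorphic: "h holomorphic_on ball 0 1 \<Longrightarrow> bloch_kernel h holomorphic_on ball 0 1"
  unfolding bloch_kernel_def by (intro holomorphic_intros deriv_holomorphic_disc)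

lemma taylor_coeff_bloch_kernel:
  assumes h: "h holomorphic_on ball 0 1"
  shows "taylor_coeff (bloch_kernel h) k = of_nat (k + 2) * taylor_coeff h k"
proof (rule taylor_coeff_unique)
  fix z :: complex assume z: "cmod z < 1"
  have "(\<lambda>k. z * (of_nat (Suc k) * taylor_coeff h (Suc k) * z ^ k)) sums (z * deriv h z)"
    using sums_mult[OF taylor_sums[OF deriv_holomorphic_disc[OF h] z], of z] by (simp only: taylor_coeff_deriv)
  then have "(\<lambda>k. of_nat (Suc k) * taylor_coeff h (Suc k) * z ^ Suc k) sums (z * deriv h z)"
    by (simp add: mult_ac)
  then have "(\<lambda>k. of_nat k * taylor_coeff h k * z ^ k) sums (z * deriv h z)"
    using sums_Suc_iff[of "\<lambda>k. of_nat k * taylor_coeff h k * z ^ k"] by simp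
  from sums_add[OF this sums_mult[OF taylor_sums[OF h z], of 2]]
  show "(\<lambda>k. of_nat (k + 2) * taylor_coeff h k * z ^ k) sums bloch_kernel h z"
    by (simp add: bloch_kernel_def algebra_simps)
qed

text \<open>The constant is one for \<open>z * deriv h z\<close> plus two for
  \<open>2 * h z\<close>; it reappears in \<open>pairing_bound\<close>.\<close>

lemma bloch_kernel_bound:
  assumes h: "h \<in> bloch" and z: "cmod z < 1"
  shows "(1 - (cmod z)\<^sup>2) * cmod (bloch_kernel h z) \<le> 3 * bloch_norm h"
proof -
  note pos = one_minus_sq_pos[OF z]
  have "cmod (bloch_kernel h z) \<le> cmod z * cmod (deriv h z) + 2 * cmod (h z)"
    unfolding bloch_kernel_def by (rule norm_triangle_le) (simp add: norm_mult)
  also have "\<dots> \<le> cmod (deriv h z) + 2 * cmod (h z)"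
    using mult_left_le[of "cmod z" "cmod (deriv h z)"] z by (simp add: mult.commute)
  finally have "(1 - (cmod z)\<^sup>2) * cmod (bloch_kernel h z) \<le> (1 - (cmod z)\<^sup>2) * cmod (deriv h z) + 2 * ((1 - (cmod z)\<^sup>2) * cmod (h z))"
    using pos by (auto dest: mult_left_mono[of _ _ "1 - (cmod z)\<^sup>2"] simp: algebra_simps)
  then show ?thesis
    using bloch_deriv_bound[OF h z] bloch_growth[OF h z] bloch_seminorm_le_norm[of h] by linarith
qed

definition truncated_pairing :: "(complex \<Rightarrow> complex) \<Rightarrow> (complex \<Rightarrow> complex) \<Rightarrow> real \<Rightarrow> complex" where
  "truncated_pairing g h r = integral (ball 0 r) (\<lambda>z. g z * h (cnj z) / of_real pi)"

lemma pairing_eq_Lim: "pairing g h = Lim (at_left 1) (truncated_pairing g h)"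
  by (simp add: pairing_def truncated_pairing_def[abs_def])

lemma complex_integral_of_real_disc:
  "(\<integral>z. complex_of_real (f z) \<partial>disc) = of_real (\<integral>z. f z \<partial>disc)"
  by (rule integral_complex_of_real)

lemma truncated_pairing_sums:
  assumes g: "g holomorphic_on ball 0 1" and h: "h holomorphic_on ball 0 1" and r: "0 < r" "r < 1"
  shows "(\<lambda>k. taylor_coeff g k * taylor_coeff h k * of_real r ^ (2 * k + 2) / of_nat (k + 1)) sums truncated_pairing g h r"
proof -
  let ?\<psi> = "indicator (ball 0 r) :: complex \<Rightarrow> complex"
  have sub: "cball 0 r \<subseteq> ball (0::complex) 1" using r by auto
  have cg: "continuous_on (cball 0 r) g" and ch: "continuous_on (cball 0 r) (\<lambda>z. h (cnj z))"
    using sub by (auto intro!: continuous_on_subset[OF holomorphic_on_imp_continuous_on[OF g]]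
       continuous_on_compose2[OF holomorphic_on_imp_continuous_on[OF h]] continuous_intros)
  obtain B where B: "0 \<le> B" "\<And>z. cmod z \<le> r \<Longrightarrow> norm (g z) \<le> B"
    using holomorphic_disc_bounded_cball[OF g r(2)] by blast
  have meas_ind: "?\<psi> \<in> borel_measurable disc"
    by (rule borel_measurable_disc_borel) (intro borel_measurable_indicator, simp)
  have meas_g: "g \<in> borel_measurable disc"
    by (rule borel_measurable_disc_continuous[OF holomorphic_on_imp_continuous_on[OF g]])
  have int: "integrable disc (\<lambda>z. ?\<psi> z * g z)"
  proof (rule integrable_disc_bounded)
    show "norm (?\<psi> z * g z) \<le> B" if "cmod z < 1" for z
      using B by (auto simp: indicator_def)
  qed (use meas_ind meas_g in auto)
  have summ: "summable (\<lambda>k. norm (taylor_coeff h k) * r ^ k)"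
    using taylor_abs_summable[OF h] r by simp
  have "(\<lambda>k. taylor_coeff h k * taylor_coeff g k * (\<integral>z. ?\<psi> z * of_real (cmod z ^ (2 * k)) \<partial>disc))
    sums (\<integral>z. ?\<psi> z * g z * (\<Sum>k. taylor_coeff h k * cnj z ^ k) \<partial>disc)"
    by (rule integral_radial_weight_series[OF g int _ _ _ summ])
       (use r in \<open>auto simp: norm_mult indicator_def\<close>)
  moreover have "(\<integral>z. ?\<psi> z * of_real (cmod z ^ (2 * k)) \<partial>disc) = of_real (pi * r ^ (2 * k + 2) / (k + 1))" for k
  proof -
    have "(\<integral>z. ?\<psi> z * of_real (cmod z ^ (2 * k)) \<partial>disc) = (\<integral>z. of_real (indicator (ball 0 r) z * cmod z ^ (2 * k)) \<partial>disc)"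
      by (intro integral_disc_cong) (auto simp: indicator_def)
    then show ?thesis using integral_disc_power_ball[of r k] r
      by (simp only: complex_integral_of_real_disc)
  qed
  moreover have "(\<integral>z. ?\<psi> z * g z * (\<Sum>k. taylor_coeff h k * cnj z ^ k) \<partial>disc) = (\<integral>z. ?\<psi> z * (g z * h (cnj z)) \<partial>disc)"
    using taylor_sums[OF h, of "cnj z" for z]
    by (intro integral_disc_cong) (auto simp: sums_iff)
  moreover have "(\<integral>z. ?\<psi> z * (g z * h (cnj z)) \<partial>disc) = of_real pi * truncated_pairing g h r"
  proof -
    have "set_integrable lborel (cball 0 r) (\<lambda>z. g z * h (cnj z))"
      unfolding set_integrable_def using cg ch by (intro borel_integrable_compact continuous_on_mult) auto
    then have si: "set_integrable lborel (ball 0 r) (\<lambda>z. g z * h (cnj z))"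
      by (rule set_integrable_subset) auto
    have "(\<integral>z. ?\<psi> z * (g z * h (cnj z)) \<partial>disc) = (\<integral>z. indicator (ball 0 1) z *\<^sub>R (?\<psi> z * (g z * h (cnj z))) \<partial>lborel)"
      unfolding disc_def by (rule integral_restrict_space) auto
    also have "\<dots> = (LINT z : ball 0 r|lborel. g z * h (cnj z))"
      unfolding set_lebesgue_integral_def using r
      by (intro Bochner_Integration.integral_cong) (auto simp: indicator_def)
    also have "\<dots> = integral (ball 0 r) (\<lambda>z. g z * h (cnj z))"
      by (rule set_borel_integral_eq_integral[OF si])
    finally show ?thesis by (simp add: truncated_pairing_def)
  qed
  ultimately have "(\<lambda>k. taylor_coeff h k * taylor_coeff g k * of_real (pi * r ^ (2 * k + 2) / (k + 1))) sums (of_real pi * truncated_pairing g h r)"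
    by simp
  from sums_divide[OF this, of "of_real pi"] show ?thesis
    by (simp add: mult_ac)
qed

definition disc_weight :: "complex \<Rightarrow> real" where
  "disc_weight z = 1 - (cmod z)\<^sup>2"

definition bergman_pairing :: "(complex \<Rightarrow> complex) \<Rightarrow> (complex \<Rightarrow> complex) \<Rightarrow> complex" where
  "bergman_pairing g h = (\<integral>z. g z * (of_real (disc_weight z) * bloch_kernel h (cnj z)) \<partial>disc) / of_real pi"

lemma disc_weight_measurable [measurable]: "disc_weight \<in> borel_measurable disc"
  unfolding disc_weight_def by (rule borel_measurable_disc_borel) measurable

lemma disc_weight_bounds: "cmod z < 1 \<Longrightarrow> 0 < disc_weight z" "disc_weight z \<le> 1"
  using one_minus_sq_pos[of z] by (auto simp: disc_weight_def)

lemma bloch_kernel_measurable: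
  assumes h: "h holomorphic_on ball 0 1" and "0 \<le> s" "s \<le> 1"
  shows "(\<lambda>z. bloch_kernel h (of_real s * cnj z)) \<in> borel_measurable disc"
  by (rule borel_measurable_disc_continuous, rule continuous_on_compose2[OF holomorphic_on_imp_continuous_on[OF bloch_kernel_holomorphic[OF h]]])
     (use assms in \<open>auto intro!: continuous_intros simp: norm_mult mult_less_one_disc\<close>)

text \<open>Shrinking the argument by \<open>s\<close> only increases \<open>1 - |z|^2\<close>, so
  the unshrunk weight is still dominated. Uniformity in \<open>s\<close> is what permits dominated
  convergence as the dilation tends to the identity.\<close>

lemma bloch_kernel_weighted_bound:
  assumes h: "h \<in> bloch" and s: "0 \<le> s" "s \<le> 1" and z: "cmod z < 1"
  shows "norm (of_real (disc_weight z) * bloch_kernel h (of_real s * cnj z)) \<le> 3 * bloch_norm h"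
proof -
  have le: "cmod (of_real s * cnj z) \<le> cmod z" using s by (simp add: norm_mult mult_left_le_one_le)
  have "disc_weight z \<le> 1 - (cmod (of_real s * cnj z))\<^sup>2"
    unfolding disc_weight_def using power_mono[OF le, of 2] by simp
  then have "disc_weight z * cmod (bloch_kernel h (of_real s * cnj z))
    \<le> (1 - (cmod (of_real s * cnj z))\<^sup>2) * cmod (bloch_kernel h (of_real s * cnj z))"
    by (intro mult_right_mono) auto
  also have "\<dots> \<le> 3 * bloch_norm h" using le z by (intro bloch_kernel_bound[OF h]) auto
  finally show ?thesis using disc_weight_bounds(1)[OF z] by (simp add: norm_mult)
qed

lemma bergman_pairing_integrable:
  assumes g: "g \<in> bergman1" and h: "h \<in> bloch" and s: "0 \<le> s" "s \<le> 1"
  shows "integrable disc (\<lambda>z. g z * (of_real (disc_weight z) * bloch_kernel h (of_real s * cnj z)))"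
  by (rule integrable_disc_times_bounded[OF bergman1_integrable[OF g], where B="3 * bloch_norm h"])
     (use bloch_kernel_measurable[OF bloch_holomorphic[OF h] s] bloch_kernel_weighted_bound[OF h s] in auto)

lemma integral_weight_power:
  "(\<integral>z. of_real (disc_weight z) * complex_of_real (cmod z ^ (2 * k)) \<partial>disc) = of_real (pi / ((k + 1) * (k + 2)))"
proof -
  have "(\<integral>z. disc_weight z * cmod z ^ (2 * k) \<partial>disc) = (\<integral>z. cmod z ^ (2 * k) - cmod z ^ (2 * (k + 1)) \<partial>disc)"
    by (simp add: disc_weight_def algebra_simps power2_eq_square)
  also have "\<dots> = pi / (k + 1) - pi / (k + 2)"
    using integral_disc_power[of k] integral_disc_power[of "k + 1"]
    by (subst Bochner_Integration.integral_diff[OF integrable_disc_power integrable_disc_power]) (simp add: add_ac)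
  also have "\<dots> = pi / ((k + 1) * (k + 2))"
    by (simp add: field_simps)
  finally show ?thesis
    by (simp only: complex_integral_of_real_disc flip: of_real_mult)
qed

text \<open>Both sides have the diagonal series with weights
  \<open>r ^ (2 * k + 2) / (k + 1)\<close>, since the factor \<open>k + 2\<close> of
  \<open>bloch_kernel\<close> cancels against the moment \<open>1 / ((k + 1) * (k + 2))\<close>. The
  gain is a fixed domain: truncation at \<open>r\<close> has become a dilation of \<open>h\<close>
  by the square of \<open>r\<close>.\<close>

lemma truncated_pairing_eq_integral:
  assumes g: "g \<in> bergman1" and h: "h \<in> bloch" and r: "0 < r" "r < 1"
  shows "truncated_pairing g h r = of_real (r\<^sup>2) * (\<integral>z. g z * (of_real (disc_weight z) * bloch_kernel h (of_real (r\<^sup>2) * cnj z)) \<partial>disc) / of_real pi"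
proof -
  note gh = bergman1_holomorphic[OF g] and hh = bloch_holomorphic[OF h]
  let ?c = "\<lambda>k. of_nat (k + 2) * taylor_coeff h k * of_real (r\<^sup>2) ^ k :: complex"
  let ?\<psi> = "\<lambda>z. complex_of_real (disc_weight z)"
  have r2: "0 \<le> r\<^sup>2" "r\<^sup>2 < 1" using r by (auto simp: abs_square_less_1)
  have int: "integrable disc (\<lambda>z. ?\<psi> z * g z)"
  proof -
    have "integrable disc (\<lambda>z. g z * ?\<psi> z)"
      by (rule integrable_disc_times_bounded[OF bergman1_integrable[OF g], where B=1])
         (use disc_weight_bounds in \<open>auto simp: less_imp_le\<close>)
    then show ?thesis by (simp add: mult.commute)
  qed
  have summ: "summable (\<lambda>k. norm (?c k) * 1 ^ k)"
    using taylor_abs_summable[OF bloch_kernel_holomorphic[OF hh], of "r\<^sup>2"] r2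
    by (simp add: taylor_coeff_bloch_kernel[OF hh] norm_mult norm_power power_abs)
  have "(\<lambda>k. ?c k * taylor_coeff g k * (\<integral>z. ?\<psi> z * of_real (cmod z ^ (2 * k)) \<partial>disc))
    sums (\<integral>z. ?\<psi> z * g z * (\<Sum>k. ?c k * cnj z ^ k) \<partial>disc)"
    by (rule integral_radial_weight_series[OF gh int _ _ _ summ])
       (auto simp: disc_weight_def norm_mult)
  moreover have "?c k * taylor_coeff g k * (\<integral>z. ?\<psi> z * of_real (cmod z ^ (2 * k)) \<partial>disc)
     = of_real pi * (taylor_coeff g k * taylor_coeff h k * of_real (r\<^sup>2) ^ k / of_nat (k + 1))" for k
    unfolding integral_weight_power
    by (simp add: divide_simps del: of_nat_add of_nat_Suc) (simp add: algebra_simps)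
  moreover have "(\<integral>z. ?\<psi> z * g z * (\<Sum>k. ?c k * cnj z ^ k) \<partial>disc)
     = (\<integral>z. g z * (?\<psi> z * bloch_kernel h (of_real (r\<^sup>2) * cnj z)) \<partial>disc)"
  proof (rule integral_disc_cong)
    fix z :: complex assume "cmod z < 1"
    then have "cmod (of_real (r\<^sup>2) * cnj z) < 1"
      using r2 mult_left_le_one_le[of "cmod z" "r\<^sup>2"] by (simp add: norm_mult norm_power)
    from taylor_sums[OF bloch_kernel_holomorphic[OF hh] this]
    have "(\<lambda>k. ?c k * cnj z ^ k) sums bloch_kernel h (of_real (r\<^sup>2) * cnj z)"
      by (simp add: taylor_coeff_bloch_kernel[OF hh] power_mult_distrib mult_ac)
    then show "?\<psi> z * g z * (\<Sum>k. ?c k * cnj z ^ k) = g z * (?\<psi> z * bloch_kernel h (of_real (r\<^sup>2) * cnj z))"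
      by (simp add: sums_iff)
  qed
  ultimately have "(\<lambda>k. of_real pi * (taylor_coeff g k * taylor_coeff h k * of_real (r\<^sup>2) ^ k / of_nat (k + 1)))
     sums (\<integral>z. g z * (?\<psi> z * bloch_kernel h (of_real (r\<^sup>2) * cnj z)) \<partial>disc)"
    by simp
  from sums_mult[OF this, of "of_real (r\<^sup>2) / of_real pi"]
  have "(\<lambda>k. taylor_coeff g k * taylor_coeff h k * of_real r ^ (2 * k + 2) / of_nat (k + 1))
     sums (of_real (r\<^sup>2) / of_real pi * (\<integral>z. g z * (?\<psi> z * bloch_kernel h (of_real (r\<^sup>2) * cnj z)) \<partial>disc))"
    by (simp add: mult_ac flip: power_mult) (simp add: power2_eq_square mult_ac)
  with truncated_pairing_sums[OF gh hh r] show ?thesis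
    by (simp add: sums_unique2)
qed

text \<open>Dominated convergence along sequences, with dominating function
  \<open>norm (g z) * (3 * bloch_norm h)\<close>. As \<open>Lim\<close> is meaningful only when a
  limit exists, this is what gives \<open>pairing\<close> its value.\<close>

lemma truncated_pairing_tendsto:
  assumes g: "g \<in> bergman1" and h: "h \<in> bloch"
  shows "(truncated_pairing g h \<longlongrightarrow> bergman_pairing g h) (at_left 1)"
proof (rule tendsto_at_left_sequentially[of 0])
  fix S :: "nat \<Rightarrow> real"
  assume S: "\<And>n. S n < 1" "\<And>n. 0 < S n" "S \<longlonglongrightarrow> 1"
  let ?I = "\<lambda>s z. g z * (of_real (disc_weight z) * bloch_kernel h (of_real s * cnj z))"
  have S2: "0 \<le> (S n)\<^sup>2" "(S n)\<^sup>2 \<le> 1" for n using S(1,2)[of n] by (auto simp: power_le_one)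
  have int1: "integrable disc (?I 1)" by (rule bergman_pairing_integrable[OF g h]) auto
  have lim: "(\<lambda>n. (S n)\<^sup>2) \<longlonglongrightarrow> 1" using tendsto_power[OF S(3), of 2] by simp
  have "(\<lambda>n. \<integral>z. ?I ((S n)\<^sup>2) z \<partial>disc) \<longlonglongrightarrow> (\<integral>z. ?I 1 z \<partial>disc)"
  proof (rule integral_dominated_convergence)
    show "integrable disc (\<lambda>z. norm (g z) * (3 * bloch_norm h))"
      using bergman1_integrable[OF g] by auto
    show "?I 1 \<in> borel_measurable disc" using int1 by auto
    show "?I ((S n)\<^sup>2) \<in> borel_measurable disc" for n
      using bergman_pairing_integrable[OF g h S2, of n] by auto
    show "AE z in disc. norm (?I ((S n)\<^sup>2) z) \<le> norm (g z) * (3 * bloch_norm h)" for n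
      using bloch_kernel_weighted_bound[OF h S2, of _ n]
      by (intro AE_I2) (subst norm_mult, auto intro!: mult_left_mono)
    show "AE z in disc. (\<lambda>n. ?I ((S n)\<^sup>2) z) \<longlonglongrightarrow> ?I 1 z"
    proof (rule AE_I2)
      fix z assume z: "z \<in> space disc"
      have "isCont (bloch_kernel h) (of_real 1 * cnj z)"
        using z by (intro holomorphic_disc_isCont bloch_kernel_holomorphic bloch_holomorphic[OF h]) simp
      then have "(\<lambda>n. bloch_kernel h (of_real ((S n)\<^sup>2) * cnj z)) \<longlonglongrightarrow> bloch_kernel h (of_real 1 * cnj z)"
        by (rule isCont_tendsto_compose) (intro tendsto_intros lim)
      then show "(\<lambda>n. ?I ((S n)\<^sup>2) z) \<longlonglongrightarrow> ?I 1 z" by (intro tendsto_intros)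
    qed
  qed
  then have "(\<lambda>n. of_real ((S n)\<^sup>2) * (\<integral>z. ?I ((S n)\<^sup>2) z \<partial>disc) / of_real pi) \<longlonglongrightarrow> of_real 1 * (\<integral>z. ?I 1 z \<partial>disc) / of_real pi"
    by (intro tendsto_intros lim) auto
  then show "(\<lambda>n. truncated_pairing g h (S n)) \<longlonglongrightarrow> bergman_pairing g h"
    using truncated_pairing_eq_integral[OF g h S(2) S(1)] by (simp add: bergman_pairing_def)
qed simp

lemma pairing_eq_bergman_pairing:
  assumes "g \<in> bergman1" "h \<in> bloch"
  shows "pairing g h = bergman_pairing g h"
  unfolding pairing_eq_Lim by (rule tendsto_Lim[OF _ truncated_pairing_tendsto[OF assms]]) simp

text \<open>The diagonal series determines the pairing, which can therefore be computed by summing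
  for \<open>r < 1\<close> and letting \<open>r\<close> tend to one, without returning to the
  defining integrals.\<close>

lemma pairing_eqI:
  assumes g: "g \<in> bergman1" and h: "h \<in> bloch"
    and S: "\<And>r. 0 < r \<Longrightarrow> r < 1 \<Longrightarrow> (\<lambda>k. taylor_coeff g k * taylor_coeff h k * of_real r ^ (2 * k + 2) / of_nat (k + 1)) sums S r"
    and lim: "(S \<longlongrightarrow> L) (at_left 1)"
  shows "pairing g h = L"
proof -
  have "\<forall>\<^sub>F r in at_left 1. truncated_pairing g h r = S r"
    unfolding eventually_at_left_field
  proof (intro exI[of _ 0] conjI allI impI)
    fix r :: real assume r: "0 < r" "r < 1"
    show "truncated_pairing g h r = S r"
      using truncated_pairing_sums[OF bergman1_holomorphic[OF g] bloch_holomorphic[OF h] r] S[OF r]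
      by (rule sums_unique2)
  qed simp
  with truncated_pairing_tendsto[OF g h] have "(S \<longlongrightarrow> bergman_pairing g h) (at_left 1)"
    by (rule Lim_transform_eventually)
  then show ?thesis
    using lim tendsto_unique[of "at_left (1::real)"] pairing_eq_bergman_pairing[OF g h] by auto
qed

text \<open>Only products of coefficients with equal index enter; hence a multiplier can be moved
  from one argument to the other.\<close>

lemma pairing_cong_coeff:
  assumes "g \<in> bergman1" "h \<in> bloch" "g' \<in> bergman1" "h' \<in> bloch"
    and "\<And>k. taylor_coeff g k * taylor_coeff h k = taylor_coeff g' k * taylor_coeff h' k"
  shows "pairing g h = pairing g' h'"
proof (rule pairing_eqI[OF assms(1,2)])
  show "(truncated_pairing g' h' \<longlongrightarrow> pairing g' h') (at_left 1)"
    unfolding pairing_eq_bergman_pairing[OF assms(3,4)] by (rule truncated_pairing_tendsto[OF assms(3,4)])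
qed (use truncated_pairing_sums[OF bergman1_holomorphic[OF assms(3)] bloch_holomorphic[OF assms(4)]] assms(5) in simp)

lemma pairing_bound:
  assumes g: "g \<in> bergman1" and h: "h \<in> bloch"
  shows "cmod (pairing g h) \<le> 3 * bergman1_norm g * bloch_norm h"
proof -
  have bd: "norm (of_real (disc_weight z) * bloch_kernel h (cnj z)) \<le> 3 * bloch_norm h" if "cmod z < 1" for z
    using bloch_kernel_weighted_bound[OF h, of 1 z] that by simp
  have "norm (\<integral>z. g z * (of_real (disc_weight z) * bloch_kernel h (cnj z)) \<partial>disc)
    \<le> (\<integral>z. norm (g z) * (3 * bloch_norm h) \<partial>disc)"
    by (rule Bochner_Integration.integral_norm_bound_integral)
       (use bergman_pairing_integrable[OF g h, of 1] bergman1_integrable[OF g] bd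
         in \<open>auto simp: norm_mult[of "g _"] intro!: mult_left_mono\<close>)
  then show ?thesis
    by (simp add: pairing_eq_bergman_pairing[OF g h] bergman_pairing_def bergman1_norm_eq[OF g] norm_divide divide_simps mult_ac)
qed

subsection \<open>Linear structure and completeness\<close>

lemma bergman1_add:
  assumes "f \<in> bergman1" "g \<in> bergman1"
  shows "(\<lambda>z. f z + g z) \<in> bergman1" "bergman1_norm (\<lambda>z. f z + g z) \<le> bergman1_norm f + bergman1_norm g"
proof -
  show *: "(\<lambda>z. f z + g z) \<in> bergman1"
    using assms by (auto simp: bergman1_iff intro!: holomorphic_intros)
  have "(\<integral>z. norm (f z + g z) \<partial>disc) \<le> (\<integral>z. norm (f z) + norm (g z) \<partial>disc)"
    by (rule integral_mono) (use assms * in \<open>auto simp: bergman1_iff norm_triangle_ineq\<close>)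
  also have "\<dots> = (\<integral>z. norm (f z) \<partial>disc) + (\<integral>z. norm (g z) \<partial>disc)"
    by (rule Bochner_Integration.integral_add) (use assms in \<open>auto simp: bergman1_iff\<close>)
  finally show "bergman1_norm (\<lambda>z. f z + g z) \<le> bergman1_norm f + bergman1_norm g"
    using assms * by (simp add: bergman1_norm_eq field_simps)
qed

lemma bergman1_cmult:
  assumes "f \<in> bergman1"
  shows "(\<lambda>z. c * f z) \<in> bergman1" "bergman1_norm (\<lambda>z. c * f z) = cmod c * bergman1_norm f"
proof -
  show *: "(\<lambda>z. c * f z) \<in> bergman1"
    using assms by (auto simp: bergman1_iff intro!: holomorphic_intros)
  show "bergman1_norm (\<lambda>z. c * f z) = cmod c * bergman1_norm f"
    using assms * by (simp add: bergman1_norm_eq norm_mult)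
qed

lemma bergman1_diff:
  assumes "f \<in> bergman1" "g \<in> bergman1"
  shows "(\<lambda>z. f z - g z) \<in> bergman1"
  using bergman1_add(1)[OF assms(1) bergman1_cmult(1)[OF assms(2), of "-1"]] by simp

text \<open>Membership and norm see only the disc, whereas sums of power series are identified with
  functions only inside it; the transfer is needed each time such an identification is made.\<close>

lemma bergman1_cong: "(\<And>z. cmod z < 1 \<Longrightarrow> f z = g z) \<Longrightarrow> f \<in> bergman1 \<longleftrightarrow> g \<in> bergman1"
  unfolding bergman1_iff by (intro conj_cong holomorphic_cong Bochner_Integration.integrable_cong) auto

lemma bergman1_norm_cong: "(\<And>z. cmod z < 1 \<Longrightarrow> f z = g z) \<Longrightarrow> bergman1_norm f = bergman1_norm g"
  unfolding bergman1_norm_def by (intro arg_cong2[where f="(/)"] integral_cong) auto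

lemma holomorphic_disc_field_differentiable:
  "h holomorphic_on ball 0 1 \<Longrightarrow> cmod z < 1 \<Longrightarrow> h field_differentiable at z"
  by (rule holomorphic_on_imp_differentiable_at[of _ "ball 0 1"]) auto

lemma bloch_add:
  assumes "f \<in> bloch" "g \<in> bloch"
  shows "(\<lambda>z. f z + g z) \<in> bloch" "bloch_norm (\<lambda>z. f z + g z) \<le> bloch_norm f + bloch_norm g"
proof -
  have hol: "(\<lambda>z. f z + g z) holomorphic_on ball 0 1"
    using assms by (intro holomorphic_intros bloch_holomorphic)
  have "(1 - (cmod z)\<^sup>2) * cmod (deriv (\<lambda>z. f z + g z) z) \<le> bloch_seminorm f + bloch_seminorm g" if z: "cmod z < 1" for z
  proof -
    have d: "deriv (\<lambda>z. f z + g z) z = deriv f z + deriv g z"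
      using assms z by (intro deriv_add holomorphic_disc_field_differentiable bloch_holomorphic)
    have "(1 - (cmod z)\<^sup>2) * cmod (deriv f z + deriv g z) \<le> (1 - (cmod z)\<^sup>2) * (cmod (deriv f z) + cmod (deriv g z))"
      using one_minus_sq_pos[OF z] by (intro mult_left_mono norm_triangle_ineq) auto
    then show ?thesis
      unfolding d using bloch_deriv_bound[OF assms(1) z] bloch_deriv_bound[OF assms(2) z]
      by (simp add: distrib_left)
  qed
  note * = blochI[OF hol this]
  then show "(\<lambda>z. f z + g z) \<in> bloch" by blast
  show "bloch_norm (\<lambda>z. f z + g z) \<le> bloch_norm f + bloch_norm g"
    using *(2) norm_triangle_ineq[of "f 0" "g 0"] by (simp add: bloch_norm_eq)
qed

lemma deriv_cmult_disc:
  assumes "f holomorphic_on ball 0 1" "cmod z < 1"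
  shows "deriv (\<lambda>z. c * f z) z = c * deriv f z"
  using assms by (intro deriv_cmult holomorphic_disc_field_differentiable)

lemma bloch_cmult:
  assumes "f \<in> bloch"
  shows "(\<lambda>z. c * f z) \<in> bloch" "bloch_norm (\<lambda>z. c * f z) \<le> cmod c * bloch_norm f"
proof -
  have hol: "(\<lambda>z. c * f z) holomorphic_on ball 0 1"
    using assms by (intro holomorphic_intros bloch_holomorphic)
  have "(1 - (cmod z)\<^sup>2) * cmod (deriv (\<lambda>z. c * f z) z) \<le> cmod c * bloch_seminorm f" if z: "cmod z < 1" for z
    using mult_left_mono[OF bloch_deriv_bound[OF assms z], of "cmod c"]
    by (simp add: deriv_cmult_disc[OF bloch_holomorphic[OF assms] z] norm_mult mult_ac)
  note * = blochI[OF hol this]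
  then show "(\<lambda>z. c * f z) \<in> bloch" by blast
  show "bloch_norm (\<lambda>z. c * f z) \<le> cmod c * bloch_norm f"
    using *(2) by (simp add: bloch_norm_eq norm_mult distrib_left)
qed

lemma bloch_diff:
  assumes "f \<in> bloch" "g \<in> bloch"
  shows "(\<lambda>z. f z - g z) \<in> bloch"
  using bloch_add(1)[OF assms(1) bloch_cmult(1)[OF assms(2), of "-1"]] by simp

lemma deriv_cong_disc: "(\<And>z. cmod z < 1 \<Longrightarrow> f z = g z) \<Longrightarrow> cmod z < 1 \<Longrightarrow> deriv f z = deriv g z"
  using eventually_nhds_in_open[of "ball 0 1" z]
  by (intro deriv_cong_ev) (auto elim!: eventually_mono)

lemma bloch_cong:
  assumes "\<And>z. cmod z < 1 \<Longrightarrow> f z = g z"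
  shows "f \<in> bloch \<longleftrightarrow> g \<in> bloch"
proof -
  have "(\<lambda>z. (1 - (cmod z)\<^sup>2) * cmod (deriv f z)) ` ball 0 1 = (\<lambda>z. (1 - (cmod z)\<^sup>2) * cmod (deriv g z)) ` ball 0 1"
    by (rule image_cong) (use deriv_cong_disc[OF assms] in auto)
  then show ?thesis
    using holomorphic_cong[of "ball 0 1" "ball 0 1" f g] assms by (simp add: bloch_def)
qed

lemma bloch_norm_cong:
  assumes "\<And>z. cmod z < 1 \<Longrightarrow> f z = g z"
  shows "bloch_norm f = bloch_norm g"
  unfolding bloch_norm_def using deriv_cong_disc[OF assms] assms[of 0]
  by (intro arg_cong2[where f="(+)"] SUP_cong) auto

section \<open>The little Bloch space\<close>

lemma little_bloch_bloch: "f \<in> little_bloch \<Longrightarrow> f \<in> bloch"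
  by (simp add: little_bloch_def)

lemma little_blochE:
  assumes "f \<in> little_bloch" "0 < e"
  obtains r where "r < 1" "\<And>z. r < cmod z \<Longrightarrow> cmod z < 1 \<Longrightarrow> (1 - (cmod z)\<^sup>2) * cmod (deriv f z) < e"
  using assms unfolding little_bloch_def by blast

text \<open>Two dominating functions are allowed so that scalar multiples and sums are both
  instances.\<close>

lemma little_bloch_dominated:
  assumes h: "h \<in> bloch" and f: "f \<in> little_bloch" and g: "g \<in> little_bloch" and A: "0 \<le> A"
    and le: "\<And>z. cmod z < 1 \<Longrightarrow> cmod (deriv h z) \<le> A * (cmod (deriv f z) + cmod (deriv g z))"
  shows "h \<in> little_bloch"
  unfolding little_bloch_def
proof (intro CollectI conjI allI impI h)
  fix e :: real assume e: "0 < e"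
  \<comment> \<open>The factor two accounts for the two dominating functions, and
    \<open>A + 1\<close> keeps the quotient meaningful for \<open>A = 0\<close>.\<close>
  define d where "d = e / (2 * (A + 1))"
  have d: "0 < d" "A * (2 * d) < e" using e A by (auto simp: d_def field_simps)
  obtain r where r: "r < 1" "\<And>z. r < cmod z \<Longrightarrow> cmod z < 1 \<Longrightarrow> (1 - (cmod z)\<^sup>2) * cmod (deriv f z) < d"
    using little_blochE[OF f d(1)] by blast
  obtain s where s: "s < 1" "\<And>z. s < cmod z \<Longrightarrow> cmod z < 1 \<Longrightarrow> (1 - (cmod z)\<^sup>2) * cmod (deriv g z) < d"
    using little_blochE[OF g d(1)] by blast
  have "(1 - (cmod z)\<^sup>2) * cmod (deriv h z) < e" if z: "max r s < cmod z" "cmod z < 1" for z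
  proof -
    have "(1 - (cmod z)\<^sup>2) * cmod (deriv h z) \<le> (1 - (cmod z)\<^sup>2) * (A * (cmod (deriv f z) + cmod (deriv g z)))"
      using one_minus_sq_pos[OF z(2)] by (intro mult_left_mono le z) auto
    also have "\<dots> = A * ((1 - (cmod z)\<^sup>2) * cmod (deriv f z) + (1 - (cmod z)\<^sup>2) * cmod (deriv g z))"
      by (simp add: algebra_simps)
    also have "\<dots> \<le> A * (2 * d)"
      using r(2)[of z] s(2)[of z] z by (intro mult_left_mono A) auto
    finally show ?thesis using d(2) by simp
  qed
  then show "\<exists>r<1. \<forall>z. r < cmod z \<and> cmod z < 1 \<longrightarrow> (1 - (cmod z)\<^sup>2) * cmod (deriv h z) < e"
    using r(1) s(1) by (intro exI[of _ "max r s"]) auto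
qed

text \<open>Closeness of derivatives is all that matters, since the boundary condition does not see
  the value at the origin. Used to pass from partial sums to the sum of a series.\<close>

lemma little_bloch_closed:
  assumes h: "h \<in> bloch"
    and approx: "\<And>e. 0 < e \<Longrightarrow> \<exists>f\<in>little_bloch. \<forall>z. cmod z < 1 \<longrightarrow> (1 - (cmod z)\<^sup>2) * cmod (deriv h z - deriv f z) \<le> e"
  shows "h \<in> little_bloch"
  unfolding little_bloch_def
proof (intro CollectI conjI allI impI h)
  fix e :: real assume "0 < e"
  then have e: "0 < e / 2" by simp
  obtain f where f: "f \<in> little_bloch" "\<And>z. cmod z < 1 \<Longrightarrow> (1 - (cmod z)\<^sup>2) * cmod (deriv h z - deriv f z) \<le> e / 2"
    using approx[OF e] by auto
  obtain r where r: "r < 1" "\<And>z. r < cmod z \<Longrightarrow> cmod z < 1 \<Longrightarrow> (1 - (cmod z)\<^sup>2) * cmod (deriv f z) < e / 2"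
    using little_blochE[OF f(1) e] by blast
  have "(1 - (cmod z)\<^sup>2) * cmod (deriv h z) < e" if z: "r < cmod z" "cmod z < 1" for z
  proof -
    have "(1 - (cmod z)\<^sup>2) * cmod (deriv h z) \<le> (1 - (cmod z)\<^sup>2) * (cmod (deriv h z - deriv f z) + cmod (deriv f z))"
      using one_minus_sq_pos[OF z(2)] norm_triangle_ineq[of "deriv h z - deriv f z" "deriv f z"]
      by (intro mult_left_mono) auto
    then show ?thesis using f(2)[OF z(2)] r(2)[OF z] by (simp add: distrib_left)
  qed
  then show "\<exists>r<1. \<forall>z. r < cmod z \<and> cmod z < 1 \<longrightarrow> (1 - (cmod z)\<^sup>2) * cmod (deriv h z) < e"
    using r(1) by blast
qed

lemma little_bloch_bounded_deriv:
  assumes h: "h holomorphic_on ball 0 1" and B: "\<And>z. cmod z < 1 \<Longrightarrow> cmod (deriv h z) \<le> B"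
  shows "h \<in> little_bloch"
  unfolding little_bloch_def
proof (intro CollectI conjI allI impI)
  have B0: "0 \<le> B" using B[of 0] by (auto intro: order_trans[OF norm_ge_zero])
  show "h \<in> bloch"
  proof (rule blochI(1)[OF h])
    show "(1 - (cmod z)\<^sup>2) * cmod (deriv h z) \<le> B" if "cmod z < 1" for z
      using mult_mono[of "1 - (cmod z)\<^sup>2" 1 "cmod (deriv h z)" B] B[OF that] by simp
  qed
  fix e :: real assume e: "0 < e"
  \<comment> \<open>Beyond this radius \<open>1 - |z|^2 < e / (B + 1)\<close>; clipping at zero
    handles large \<open>e\<close>.\<close>
  define r where "r = sqrt (max 0 (1 - e / (B + 1)))"
  have "r < 1" using e B0 by (auto simp: r_def)
  moreover have "(1 - (cmod z)\<^sup>2) * cmod (deriv h z) < e" if z: "r < cmod z" "cmod z < 1" for z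
  proof -
    have "max 0 (1 - e / (B + 1)) < (cmod z)\<^sup>2"
      using z(1) real_sqrt_less_iff[of _ "(cmod z)\<^sup>2"] by (simp add: r_def)
    then have "1 - (cmod z)\<^sup>2 < e / (B + 1)" by auto
    then have "(1 - (cmod z)\<^sup>2) * (B + 1) < e" using B0 by (simp add: pos_less_divide_eq)
    moreover have "(1 - (cmod z)\<^sup>2) * cmod (deriv h z) \<le> (1 - (cmod z)\<^sup>2) * (B + 1)"
      using one_minus_sq_pos[OF z(2)] B[OF z(2)] by (intro mult_left_mono) auto
    ultimately show ?thesis by linarith
  qed
  ultimately show "\<exists>r<1. \<forall>z. r < cmod z \<and> cmod z < 1 \<longrightarrow> (1 - (cmod z)\<^sup>2) * cmod (deriv h z) < e"
    by blast
qed

lemma little_bloch_cmult: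
  assumes f: "f \<in> little_bloch"
  shows "(\<lambda>z. c * f z) \<in> little_bloch"
proof (rule little_bloch_dominated[OF bloch_cmult(1)[OF little_bloch_bloch[OF f]] f f norm_ge_zero[of c]])
  show "cmod (deriv (\<lambda>z. c * f z) z) \<le> cmod c * (cmod (deriv f z) + cmod (deriv f z))" if "cmod z < 1" for z
    using deriv_cmult_disc[OF bloch_holomorphic[OF little_bloch_bloch[OF f]] that, of c]
    by (simp add: norm_mult mult_left_mono)
qed

lemma little_bloch_add:
  assumes f: "f \<in> little_bloch" and g: "g \<in> little_bloch"
  shows "(\<lambda>z. f z + g z) \<in> little_bloch"
proof (rule little_bloch_dominated[OF bloch_add(1)[OF little_bloch_bloch[OF f] little_bloch_bloch[OF g]] f g zero_le_one])
  fix z :: complex assume "cmod z < 1"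
  then have "deriv (\<lambda>z. f z + g z) z = deriv f z + deriv g z"
    by (intro deriv_add holomorphic_disc_field_differentiable bloch_holomorphic little_bloch_bloch f g)
  then show "cmod (deriv (\<lambda>z. f z + g z) z) \<le> 1 * (cmod (deriv f z) + cmod (deriv g z))"
    by (simp add: norm_triangle_ineq)
qed

lemma little_bloch_sum:
  "finite J \<Longrightarrow> (\<And>j. j \<in> J \<Longrightarrow> f j \<in> little_bloch) \<Longrightarrow> (\<lambda>z. \<Sum>j\<in>J. f j z) \<in> little_bloch"
proof (induction J rule: finite_induct)
  case empty
  show ?case by (rule little_bloch_bounded_deriv[where B=0]) auto
qed (auto intro!: little_bloch_add)

section \<open>Linearity of the pairing\<close>

lemma pairing_add_left:
  assumes "f \<in> bergman1" "g \<in> bergman1" "h \<in> bloch"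
  shows "pairing (\<lambda>z. f z + g z) h = pairing f h + pairing g h"
  using bergman_pairing_integrable[of f h 1] bergman_pairing_integrable[of g h 1] assms bergman1_add(1)[OF assms(1,2)]
  by (simp add: pairing_eq_bergman_pairing bergman_pairing_def distrib_right add_divide_distrib)

lemma pairing_cmult_left:
  assumes "f \<in> bergman1" "h \<in> bloch"
  shows "pairing (\<lambda>z. c * f z) h = c * pairing f h"
  using assms bergman1_cmult(1)[OF assms(1)]
  by (simp add: pairing_eq_bergman_pairing bergman_pairing_def mult.assoc)

lemma pairing_diff_left:
  assumes "f \<in> bergman1" "g \<in> bergman1" "h \<in> bloch"
  shows "pairing (\<lambda>z. f z - g z) h = pairing f h - pairing g h"
  using pairing_add_left[OF assms(1) bergman1_cmult(1)[OF assms(2), of "-1"] assms(3)]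
    pairing_cmult_left[OF assms(2,3), of "-1"] by simp

lemma pairing_cmult_right:
  assumes "f \<in> bergman1" "h \<in> bloch"
  shows "pairing f (\<lambda>z. c * h z) = c * pairing f h"
proof -
  have "bloch_kernel (\<lambda>z. c * h z) (cnj z) = c * bloch_kernel h (cnj z)" if "cmod z < 1" for z
    using that by (simp add: bloch_kernel_def deriv_cmult_disc[OF bloch_holomorphic[OF assms(2)]] algebra_simps)
  then have "(\<integral>z. f z * (of_real (disc_weight z) * bloch_kernel (\<lambda>z. c * h z) (cnj z)) \<partial>disc)
    = (\<integral>z. c * (f z * (of_real (disc_weight z) * bloch_kernel h (cnj z))) \<partial>disc)"
    by (intro integral_disc_cong) auto
  then show ?thesis
    using assms bloch_cmult(1)[OF assms(2)]
    by (simp add: pairing_eq_bergman_pairing bergman_pairing_def)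
qed

lemma pairing_add_right:
  assumes "f \<in> bergman1" "h \<in> bloch" "k \<in> bloch"
  shows "pairing f (\<lambda>z. h z + k z) = pairing f h + pairing f k"
proof -
  have "bloch_kernel (\<lambda>z. h z + k z) (cnj z) = bloch_kernel h (cnj z) + bloch_kernel k (cnj z)" if "cmod z < 1" for z
  proof -
    have "deriv (\<lambda>z. h z + k z) (cnj z) = deriv h (cnj z) + deriv k (cnj z)"
      using assms that by (intro deriv_add holomorphic_disc_field_differentiable bloch_holomorphic) auto
    then show ?thesis by (simp add: bloch_kernel_def algebra_simps)
  qed
  then have "(\<integral>z. f z * (of_real (disc_weight z) * bloch_kernel (\<lambda>z. h z + k z) (cnj z)) \<partial>disc)
    = (\<integral>z. f z * (of_real (disc_weight z) * bloch_kernel h (cnj z)) + f z * (of_real (disc_weight z) * bloch_kernel k (cnj z)) \<partial>disc)"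
    by (intro integral_disc_cong) (auto simp: algebra_simps)
  also have "\<dots> = (\<integral>z. f z * (of_real (disc_weight z) * bloch_kernel h (cnj z)) \<partial>disc)
     + (\<integral>z. f z * (of_real (disc_weight z) * bloch_kernel k (cnj z)) \<partial>disc)"
    using bergman_pairing_integrable[of f h 1] bergman_pairing_integrable[of f k 1] assms
    by (intro Bochner_Integration.integral_add) auto
  finally show ?thesis
    using assms bloch_add(1)[OF assms(2,3)]
    by (simp add: pairing_eq_bergman_pairing bergman_pairing_def add_divide_distrib)
qed

lemma pairing_diff_right:
  assumes "f \<in> bergman1" "h \<in> bloch" "k \<in> bloch"
  shows "pairing f (\<lambda>z. h z - k z) = pairing f h - pairing f k"
  using pairing_add_right[OF assms(1,2) bloch_cmult(1)[OF assms(3), of "-1"]]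
    pairing_cmult_right[OF assms(1,3), of "-1"] by simp

text \<open>A common Weierstrass test for both spaces: each norm controls
  \<open>(1 - |z|)^2 * |f z|\<close>, which yields uniform convergence on smaller discs and hence
  termwise differentiation.\<close>

lemma disc_series:
  fixes f :: "nat \<Rightarrow> complex \<Rightarrow> complex"
  assumes hol: "\<And>j. f j holomorphic_on ball 0 1"
    and bound: "\<And>j z. cmod z < 1 \<Longrightarrow> norm (f j z) \<le> m j / (1 - cmod z)\<^sup>2"
    and m: "summable m"
  shows "\<And>z. cmod z < 1 \<Longrightarrow> summable (\<lambda>j. norm (f j z))"
    and "(\<lambda>z. \<Sum>j. f j z) holomorphic_on ball 0 1"
    and "\<And>z. cmod z < 1 \<Longrightarrow> (\<lambda>j. deriv (f j) z) sums deriv (\<lambda>z. \<Sum>j. f j z) z"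
proof -
  have m0: "0 \<le> m j" for j using bound[of 0 j] by (auto intro: order_trans[OF norm_ge_zero])
  show "summable (\<lambda>j. norm (f j z))" if z: "cmod z < 1" for z
    by (rule summable_comparison_test'[OF summable_divide[OF m, of "(1 - cmod z)\<^sup>2"], of 0])
       (use bound[OF z] in auto)
  let ?S = "\<lambda>n z. \<Sum>j<n. f j z"
  have unif: "uniform_limit (cball 0 r) ?S (\<lambda>z. \<Sum>j. f j z) sequentially" if "r < 1" for r
  proof (rule Weierstrass_m_test)
    show "summable (\<lambda>j. m j / (1 - r)\<^sup>2)" by (rule summable_divide[OF m])
    fix j and z :: complex assume "z \<in> cball 0 r"
    then have z: "cmod z \<le> r" by simp
    have "norm (f j z) \<le> m j / (1 - cmod z)\<^sup>2" using z that by (intro bound) auto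
    also have "\<dots> \<le> m j / (1 - r)\<^sup>2"
      using z that m0 by (intro divide_left_mono power_mono mult_pos_pos zero_less_power) auto
    finally show "norm (f j z) \<le> m j / (1 - r)\<^sup>2" .
  qed
  have holS: "?S n holomorphic_on ball 0 1" for n by (intro holomorphic_intros hol)
  have unif': "\<exists>r. cmod z < r \<and> r < 1" if "cmod z < 1" for z :: complex using that dense by blast
  show "(\<lambda>z. \<Sum>j. f j z) holomorphic_on ball 0 1"
  proof (rule holomorphic_uniform_sequence[OF open_ball holS])
    fix z :: complex assume "z \<in> ball 0 1"
    then obtain r where r: "cmod z < r" "r < 1" using unif' by auto
    have sub: "cball z (r - cmod z) \<subseteq> cball 0 r"
      by (rule cball_subset_cball_iff[THEN iffD2]) (auto simp: dist_norm)
    show "\<exists>d>0. cball z d \<subseteq> ball 0 1 \<and> uniform_limit (cball z d) ?S (\<lambda>z. \<Sum>j. f j z) sequentially"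
      using r sub by (intro exI[of _ "r - cmod z"] conjI uniform_limit_on_subset[OF unif[OF r(2)]]) auto
  qed
  fix z :: complex assume z: "cmod z < 1"
  then obtain r where r: "cmod z < r" "r < 1" using unif' by auto
  have "(\<lambda>n. (deriv ^^ 1) (?S n) z) \<longlonglongrightarrow> (deriv ^^ 1) (\<lambda>z. \<Sum>j. f j z) z"
  proof (rule higher_deriv_complex_uniform_limit[where A="ball 0 r"])
    show "uniform_limit (ball 0 r) ?S (\<lambda>z. \<Sum>j. f j z) sequentially"
      by (rule uniform_limit_on_subset[OF unif[OF r(2)]]) auto
    show "\<forall>\<^sub>F n in sequentially. ?S n holomorphic_on ball 0 r"
      using r by (intro always_eventually allI holomorphic_on_subset[OF holS] subset_ball) auto
  qed (use r in auto)
  moreover have "deriv (?S n) z = (\<Sum>j<n. deriv (f j) z)" for n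
    using z hol by (intro deriv_sum holomorphic_disc_field_differentiable)
  ultimately show "(\<lambda>j. deriv (f j) z) sums deriv (\<lambda>z. \<Sum>j. f j z) z"
    by (simp add: sums_def)
qed

lemma bergman1_coeff_integral_bound:
  "g \<in> bergman1 \<Longrightarrow> norm (taylor_coeff g k) * ((\<integral>z. cmod z ^ k \<partial>disc) / pi) \<le> bergman1_norm g"
  using taylor_coeff_times_integral_le[of g k]
  by (simp add: bergman1_iff bergman1_norm_eq divide_right_mono)

lemma bergman1_coeff_bound:
  assumes "g \<in> bergman1"
  shows "norm (taylor_coeff g k) \<le> (k + 1) * bergman1_norm g"
proof -
  \<comment> \<open>Exact values are available for even powers; replacing \<open>|z|^k\<close> by
    \<open>|z|^(2k)\<close> loses at most a factor two.\<close>
  have "pi / (k + 1) = (\<integral>z. cmod z ^ (2 * k) \<partial>disc)" by (simp add: integral_disc_power)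
  also have "\<dots> \<le> (\<integral>z. cmod z ^ k \<partial>disc)"
    by (rule integral_mono[OF integrable_disc_power integrable_disc_power]) (auto intro!: power_decreasing)
  finally have "1 / (k + 1) \<le> (\<integral>z. cmod z ^ k \<partial>disc) / pi"
    by (simp add: field_simps)
  from mult_left_mono[OF this, of "norm (taylor_coeff g k)"] bergman1_coeff_integral_bound[OF assms, of k]
  have "norm (taylor_coeff g k) * (1 / (k + 1)) \<le> bergman1_norm g" by (meson norm_ge_zero order_trans)
  then show ?thesis by (simp add: field_simps)
qed

text \<open>The coefficient bound \<open>k + 1\<close> matches the expansion of
  \<open>1 / (1 - x)^2\<close>, so the growth rate follows by summing.\<close>

lemma bergman1_growth:
  assumes g: "g \<in> bergman1" and z: "cmod z < 1"
  shows "cmod (g z) \<le> bergman1_norm g / (1 - cmod z)\<^sup>2"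
proof -
  have s: "(\<lambda>k. of_nat (Suc k) * cmod z ^ k) sums (1 / (1 - cmod z)\<^sup>2)"
    using z by (intro geometric_deriv_sums) auto
  have le: "norm (taylor_coeff g k * z ^ k) \<le> bergman1_norm g * (of_nat (Suc k) * cmod z ^ k)" for k
    using mult_right_mono[OF bergman1_coeff_bound[OF g, of k], of "cmod z ^ k"]
    by (simp add: norm_mult norm_power mult_ac add_ac)
  have "g z = (\<Sum>k. taylor_coeff g k * z ^ k)"
    using taylor_sums[OF bergman1_holomorphic[OF g] z] by (simp add: sums_iff)
  also have "norm \<dots> \<le> (\<Sum>k. bergman1_norm g * (of_nat (Suc k) * cmod z ^ k))"
    by (rule norm_suminf_le[OF le]) (use sums_mult[OF s] in \<open>simp add: sums_iff\<close>)
  also have "\<dots> = bergman1_norm g * (1 / (1 - cmod z)\<^sup>2)"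
    using sums_mult[OF s] by (simp add: sums_iff)
  finally show ?thesis by simp
qed

text \<open>Completeness in series form: a summable bound on the norms gives a sum inside the space.
  Both the multipliers and the damped series used for uniform boundedness rest on it.\<close>

lemma bergman1_series:
  assumes f: "\<And>j. f j \<in> bergman1" and m: "summable m" "\<And>j. bergman1_norm (f j) \<le> m j"
  shows "\<And>z. cmod z < 1 \<Longrightarrow> summable (\<lambda>j. norm (f j z))"
    and "(\<lambda>z. \<Sum>j. f j z) \<in> bergman1" and "bergman1_norm (\<lambda>z. \<Sum>j. f j z) \<le> suminf m"
proof -
  have bd: "norm (f j z) \<le> m j / (1 - cmod z)\<^sup>2" if "cmod z < 1" for j z
    using bergman1_growth[OF f[of j] that] m(2)[of j] by (meson divide_right_mono order_trans zero_le_power2)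
  note ser = disc_series[OF bergman1_holomorphic[OF f] bd m(1)]
  show "summable (\<lambda>j. norm (f j z))" if "cmod z < 1" for z using ser(1) that by blast
  have summ: "summable (\<lambda>j. bergman1_norm (f j))"
    by (rule summable_comparison_test'[OF m(1), of 0]) (use m(2) bergman1_norm_nonneg[OF f] in auto)
  have norm_eq: "(\<integral>z. norm (f j z) \<partial>disc) = pi * bergman1_norm (f j)" for j
    using bergman1_norm_eq[OF f[of j]] by simp
  have AE: "AE z in disc. summable (\<lambda>j. norm (f j z))" using ser(1) by (intro AE_I2) auto
  have nsum: "summable (\<lambda>j. \<integral>z. norm (f j z) \<partial>disc)"
    unfolding norm_eq by (rule summable_mult[OF summ])
  have int: "integrable disc (\<lambda>z. \<Sum>j. f j z)"
    by (rule integrable_suminf[OF bergman1_integrable[OF f] AE nsum])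
  show S: "(\<lambda>z. \<Sum>j. f j z) \<in> bergman1"
    unfolding bergman1_iff using int ser(2) by blast
  have AE': "AE z in disc. summable (\<lambda>j. norm (norm (f j z)))" using AE by simp
  have nsum': "summable (\<lambda>j. \<integral>z. norm (norm (f j z)) \<partial>disc)" using nsum by simp
  have "(\<integral>z. norm (\<Sum>j. f j z) \<partial>disc) \<le> (\<integral>z. (\<Sum>j. norm (f j z)) \<partial>disc)"
    by (rule integral_mono)
       (use int integrable_suminf[OF integrable_norm[OF bergman1_integrable[OF f]] AE' nsum'] ser(1) in \<open>auto intro: summable_norm\<close>)
  also have "\<dots> = (\<Sum>j. \<integral>z. norm (f j z) \<partial>disc)"
    by (rule integral_suminf[OF integrable_norm[OF bergman1_integrable[OF f]] AE' nsum'])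
  also have "\<dots> = pi * (\<Sum>j. bergman1_norm (f j))"
    unfolding norm_eq by (rule suminf_mult[OF summ])
  also have "\<dots> \<le> pi * suminf m"
    by (intro mult_left_mono suminf_le m summ) auto
  finally show "bergman1_norm (\<lambda>z. \<Sum>j. f j z) \<le> suminf m"
    by (simp add: bergman1_norm_eq[OF S] field_simps)
qed

lemma bloch_series:
  assumes f: "\<And>j. f j \<in> bloch" and m: "summable m" "\<And>j. bloch_norm (f j) \<le> m j"
  shows "\<And>z. cmod z < 1 \<Longrightarrow> summable (\<lambda>j. norm (f j z))"
    and "(\<lambda>z. \<Sum>j. f j z) \<in> bloch" and "bloch_norm (\<lambda>z. \<Sum>j. f j z) \<le> suminf m"
    and "(\<And>j. f j \<in> little_bloch) \<Longrightarrow> (\<lambda>z. \<Sum>j. f j z) \<in> little_bloch"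
proof -
  let ?S = "\<lambda>z. \<Sum>j. f j z"
  have bd: "norm (f j z) \<le> m j / (1 - cmod z)\<^sup>2" if z: "cmod z < 1" for j z
  proof -
    have "(1 - cmod z) * (1 - cmod z) \<le> (1 - cmod z) * (1 + cmod z)"
      using z by (intro mult_left_mono) auto
    then have "(1 - cmod z)\<^sup>2 \<le> 1 - (cmod z)\<^sup>2"
      by (simp add: power2_eq_square algebra_simps)
    then have "(1 - cmod z)\<^sup>2 * norm (f j z) \<le> (1 - (cmod z)\<^sup>2) * norm (f j z)"
      by (intro mult_right_mono) auto
    also have "\<dots> \<le> m j" using bloch_growth[OF f[of j] z] m(2)[of j] by simp
    finally show ?thesis using z by (simp add: pos_le_divide_eq mult.commute)
  qed
  note ser = disc_series[OF bloch_holomorphic[OF f] bd m(1)]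
  show "summable (\<lambda>j. norm (f j z))" if "cmod z < 1" for z using ser(1) that by blast
  have b: "bloch_seminorm (f j) \<le> m j" "cmod (f j 0) \<le> m j" "cmod (f j 0) + bloch_seminorm (f j) \<le> m j" for j
    using m(2)[of j] bloch_seminorm_nonneg[OF f[of j]] by (auto simp: bloch_norm_eq intro: order_trans[rotated])
  have s1: "summable (\<lambda>j. bloch_seminorm (f j))"
    by (rule summable_comparison_test'[OF m(1), of 0]) (use b bloch_seminorm_nonneg[OF f] in auto)
  have s2: "summable (\<lambda>j. cmod (f j 0))"
    by (rule summable_comparison_test'[OF m(1), of 0]) (use b in auto)
  have db: "norm (deriv (f j) z) \<le> bloch_seminorm (f j) / (1 - (cmod z)\<^sup>2)" if z: "cmod z < 1" for j z
    using bloch_deriv_bound[OF f[of j] z] one_minus_sq_pos[OF z] by (simp add: field_simps)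
  \<comment> \<open>The case \<open>n = 0\<close> gives membership and the seminorm bound; general
    \<open>n\<close> gives approximation by partial sums and thereby the little Bloch
    property.\<close>
  have tail: "(1 - (cmod z)\<^sup>2) * cmod (deriv ?S z - (\<Sum>j<n. deriv (f j) z)) \<le> (\<Sum>j. bloch_seminorm (f (j + n)))"
    if z: "cmod z < 1" for z n
  proof -
    have "(\<lambda>j. deriv (f (j + n)) z) sums (deriv ?S z - (\<Sum>j<n. deriv (f j) z))"
      by (rule sums_split_initial_segment, rule disc_series(3)[OF bloch_holomorphic[OF f] bd m(1) z])
    then have "cmod (deriv ?S z - (\<Sum>j<n. deriv (f j) z)) = norm (\<Sum>j. deriv (f (j + n)) z)"
      by (simp add: sums_iff)
    also have "\<dots> \<le> (\<Sum>j. bloch_seminorm (f (j + n)) / (1 - (cmod z)\<^sup>2))"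
      by (rule norm_suminf_le[OF db[OF z]]) (intro summable_divide summable_ignore_initial_segment s1)
    also have "\<dots> = (\<Sum>j. bloch_seminorm (f (j + n))) / (1 - (cmod z)\<^sup>2)"
      by (intro suminf_divide summable_ignore_initial_segment s1)
    finally show ?thesis using one_minus_sq_pos[OF z] by (simp add: field_simps)
  qed
  have S: "?S \<in> bloch" "bloch_seminorm ?S \<le> (\<Sum>j. bloch_seminorm (f j))"
    using blochI[OF ser(2), of "\<Sum>j. bloch_seminorm (f j)"] tail[of _ 0] by auto
  show "?S \<in> bloch" by (rule S)
  have "bloch_norm ?S \<le> (\<Sum>j. cmod (f j 0)) + (\<Sum>j. bloch_seminorm (f j))"
    unfolding bloch_norm_eq by (intro add_mono S summable_norm s2)
  also have "\<dots> = (\<Sum>j. cmod (f j 0) + bloch_seminorm (f j))"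
    by (rule suminf_add[OF s2 s1])
  also have "\<dots> \<le> suminf m" by (intro suminf_le m b summable_add s1 s2)
  finally show "bloch_norm ?S \<le> suminf m" .
  assume little: "\<And>j. f j \<in> little_bloch"
  show "?S \<in> little_bloch"
  proof (rule little_bloch_closed[OF S(1)])
    fix e :: real assume "0 < e"
    from suminf_exist_split[OF this s1] obtain n where n: "norm (\<Sum>j. bloch_seminorm (f (j + n))) < e"
      by auto
    have "deriv (\<lambda>z. \<Sum>j<n. f j z) z = (\<Sum>j<n. deriv (f j) z)" if "cmod z < 1" for z
      using that bloch_holomorphic[OF f] by (intro deriv_sum holomorphic_disc_field_differentiable)
    then show "\<exists>g\<in>little_bloch. \<forall>z. cmod z < 1 \<longrightarrow> (1 - (cmod z)\<^sup>2) * cmod (deriv ?S z - deriv g z) \<le> e"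
      using tail[of _ n] n little_bloch_sum[of "{..<n}" f] little
      by (intro bexI[of _ "\<lambda>z. \<Sum>j<n. f j z"]) force+
  qed
qed

subsection \<open>Coefficient multipliers\<close>

lemma coeff_transform_sums:
  assumes a: "summable (\<lambda>k. norm (a n k))" and g: "g holomorphic_on ball 0 1" and z: "cmod z < 1"
  shows "(\<lambda>k. (a n k * taylor_coeff g k) * z ^ k) sums coeff_transform a n g z"
proof -
  have le: "norm (a n k) \<le> (\<Sum>k. norm (a n k))" for k
    using sum_le_suminf[OF a, of "{k}"] by simp
  have "summable (\<lambda>k. (\<Sum>k. norm (a n k)) * (norm (taylor_coeff g k) * cmod z ^ k))"
    using z by (intro summable_mult taylor_abs_summable[OF g]) auto
  then have "summable (\<lambda>k. (a n k * taylor_coeff g k) * z ^ k)"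
    by (rule summable_comparison_test'[where N=0])
       (use le in \<open>auto simp: norm_mult norm_power mult.assoc intro!: mult_right_mono\<close>)
  then show ?thesis unfolding coeff_transform_def by (rule summable_sums)
qed

lemma taylor_coeff_coeff_transform:
  assumes "summable (\<lambda>k. norm (a n k))" "g holomorphic_on ball 0 1"
  shows "taylor_coeff (coeff_transform a n g) k = a n k * taylor_coeff g k"
  by (rule taylor_coeff_unique) (rule coeff_transform_sums[where a=a and n=n, OF assms])

lemma monomial_bergman1:
  "(\<lambda>z. z ^ k) \<in> bergman1" "bergman1_norm (\<lambda>z. z ^ k) = (\<integral>z. cmod z ^ k \<partial>disc) / pi"
proof -
  show *: "(\<lambda>z. z ^ k) \<in> bergman1"
    by (rule bergman1_bounded[where B=1]) (auto intro!: holomorphic_intros simp: norm_power power_le_one)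
  show "bergman1_norm (\<lambda>z. z ^ k) = (\<integral>z. cmod z ^ k \<partial>disc) / pi"
    by (simp add: bergman1_norm_eq[OF *] norm_power)
qed

lemma deriv_monomial: "deriv (\<lambda>z. c * z ^ k) z = c * (of_nat k * z ^ (k - 1))" for c :: complex
  by (rule DERIV_imp_deriv) (auto intro!: derivative_eq_intros)

lemma monomial_little_bloch: "(\<lambda>z. c * z ^ k) \<in> little_bloch"
proof (rule little_bloch_bounded_deriv)
  fix z :: complex assume "cmod z < 1"
  then show "cmod (deriv (\<lambda>z. c * z ^ k) z) \<le> cmod c * real k"
    unfolding deriv_monomial
    by (auto simp: norm_mult norm_power intro!: mult_left_mono mult_left_le power_le_one)
qed (intro holomorphic_intros)

text \<open>The bound on the derivative is constant on circles, so it survives the circle mean that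
  isolates one coefficient of the derivative. Constants are killed by differentiation and are
  treated apart.\<close>

lemma bloch_norm_monomial_le:
  assumes h: "h \<in> bloch"
  shows "bloch_norm (\<lambda>z. taylor_coeff h k * z ^ k) \<le> bloch_norm h"
proof (cases k)
  case 0
  have "bloch_seminorm (\<lambda>z. taylor_coeff h k * z ^ k) \<le> 0"
    by (rule blochI) (auto simp: 0)
  then show ?thesis using 0 bloch_seminorm_nonneg[OF h] by (simp add: bloch_norm_eq taylor_coeff_0)
next
  case (Suc j)
  have "bloch_seminorm (\<lambda>z. taylor_coeff h k * z ^ k) \<le> bloch_seminorm h"
  proof (rule blochI)
    fix z :: complex assume z: "cmod z < 1"
    note pos = one_minus_sq_pos[OF z]
    have cont: "continuous_on {0..1} (\<lambda>t. deriv h (circle_path t * z))"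
      by (intro continuous_on_circle_mult[OF _ z] holomorphic_on_imp_continuous_on deriv_holomorphic_disc bloch_holomorphic[OF h])
    have "cmod (deriv (\<lambda>z. taylor_coeff h k * z ^ k) z) = norm (taylor_coeff (deriv h) j) * cmod z ^ j"
      unfolding deriv_monomial by (simp add: Suc taylor_coeff_deriv norm_mult norm_power mult_ac del: of_nat_Suc)
    also have "\<dots> \<le> (\<integral>t. norm (deriv h (circle_path t * z)) \<partial>circ)"
      by (rule taylor_coeff_le_circ_mean[OF deriv_holomorphic_disc[OF bloch_holomorphic[OF h]] z])
    also have "\<dots> \<le> (\<integral>t. bloch_seminorm h / (1 - (cmod z)\<^sup>2) \<partial>circ)"
    proof (rule integral_mono)
      show "norm (deriv h (circle_path t * z)) \<le> bloch_seminorm h / (1 - (cmod z)\<^sup>2)" for t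
        using bloch_deriv_bound[OF h, of "circle_path t * z"] z pos by (simp add: norm_mult field_simps)
    qed (use cont in \<open>auto intro!: integrable_circ_continuous continuous_intros\<close>)
    finally show "(1 - (cmod z)\<^sup>2) * cmod (deriv (\<lambda>z. taylor_coeff h k * z ^ k) z) \<le> bloch_seminorm h"
      using pos by (simp add: field_simps)
  qed (intro holomorphic_intros)
  then show ?thesis using Suc by (simp add: bloch_norm_eq add_increasing)
qed

lemma coeff_transform_bergman1:
  assumes a: "summable (\<lambda>k. norm (a n k))" and g: "g \<in> bergman1"
  shows "coeff_transform a n g \<in> bergman1"
proof -
  let ?f = "\<lambda>k z. a n k * taylor_coeff g k * z ^ k"
  have f: "?f k \<in> bergman1" for k by (intro bergman1_cmult monomial_bergman1)
  have "bergman1_norm (?f k) \<le> norm (a n k) * bergman1_norm g" for k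
    using mult_left_mono[OF bergman1_coeff_integral_bound[OF g, of k], of "norm (a n k)"]
    unfolding bergman1_cmult(2)[OF monomial_bergman1(1)] monomial_bergman1(2) by (simp add: norm_mult mult.assoc)
  from bergman1_series(2)[OF f summable_mult2[OF a] this]
  show ?thesis by (simp add: coeff_transform_def[abs_def])
qed

text \<open>The image is an absolutely convergent series of monomials, each in the little Bloch
  space, so the multiplier improves Bloch functions. The norm bound depends on \<open>n\<close> and
  serves only to make each single form continuous before uniform boundedness is applied.\<close>

lemma coeff_transform_bloch:
  assumes a: "summable (\<lambda>k. norm (a n k))" and h: "h \<in> bloch"
  shows "coeff_transform a n h \<in> little_bloch"
    and "bloch_norm (coeff_transform a n h) \<le> (\<Sum>k. norm (a n k)) * bloch_norm h"
proof -
  let ?f = "\<lambda>k z. a n k * taylor_coeff h k * z ^ k"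
  have f: "?f k \<in> little_bloch" for k by (rule monomial_little_bloch)
  have m: "bloch_norm (?f k) \<le> norm (a n k) * bloch_norm h" for k
  proof -
    have "bloch_norm (?f k) = bloch_norm (\<lambda>z. a n k * (taylor_coeff h k * z ^ k))" by (simp add: mult.assoc)
    also have "\<dots> \<le> norm (a n k) * bloch_norm (\<lambda>z. taylor_coeff h k * z ^ k)"
      by (intro bloch_cmult little_bloch_bloch monomial_little_bloch)
    also have "\<dots> \<le> norm (a n k) * bloch_norm h"
      by (intro mult_left_mono bloch_norm_monomial_le h) auto
    finally show ?thesis .
  qed
  note ser = bloch_series(3,4)[OF little_bloch_bloch[OF f] summable_mult2[OF a] m]
  show "coeff_transform a n h \<in> little_bloch"
    using ser(2)[OF f] by (simp add: coeff_transform_def[abs_def])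
  show "bloch_norm (coeff_transform a n h) \<le> (\<Sum>k. norm (a n k)) * bloch_norm h"
    using ser(1) suminf_mult2[OF a, of "bloch_norm h"] by (simp add: coeff_transform_def[abs_def])
qed

lemma pairing_coeff_transform:
  assumes a: "summable (\<lambda>k. norm (a n k))" and g: "g \<in> bergman1" and h: "h \<in> bloch"
  shows "pairing (coeff_transform a n g) h = pairing g (coeff_transform a n h)"
  by (rule pairing_cong_coeff)
     (use assms in \<open>auto simp: coeff_transform_bergman1 little_bloch_bloch coeff_transform_bloch
        taylor_coeff_coeff_transform bergman1_holomorphic bloch_holomorphic\<close>)

section \<open>Monomials as test functions\<close>

lemma taylor_coeff_monomial: "taylor_coeff (\<lambda>z. z ^ n) k = of_bool (k = n)"
proof (rule taylor_coeff_unique)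
  fix z :: complex
  show "(\<lambda>k. of_bool (k = n) * z ^ k) sums z ^ n"
    using sums_single[of n "\<lambda>k. z ^ k"] by (simp add: of_bool_def if_distrib[of "\<lambda>x. x * _"] cong: if_cong)
qed

lemma pairing_monomial:
  assumes h: "h \<in> bloch"
  shows "pairing (\<lambda>z. z ^ n) h = taylor_coeff h n / of_nat (n + 1)"
proof (rule pairing_eqI[OF monomial_bergman1(1) h])
  let ?S = "\<lambda>r. taylor_coeff h n * of_real r ^ (2 * n + 2) / of_nat (n + 1) :: complex"
  fix r :: real
  show "(\<lambda>k. taylor_coeff (\<lambda>z. z ^ n) k * taylor_coeff h k * of_real r ^ (2 * k + 2) / of_nat (k + 1)) sums ?S r"
    using sums_single[of n "\<lambda>k. taylor_coeff h k * of_real r ^ (2 * k + 2) / of_nat (k + 1)"]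
    by (simp add: taylor_coeff_monomial of_bool_def if_distrib[of "\<lambda>x. x * _"] if_distrib[of "\<lambda>x. x / _"] cong: if_cong)
next
  have "((\<lambda>r. taylor_coeff h n * of_real r ^ (2 * n + 2) / of_nat (n + 1)) \<longlongrightarrow> taylor_coeff h n * of_real 1 ^ (2 * n + 2) / of_nat (n + 1)) (at_left (1::real))"
    by (intro tendsto_intros) (metis of_nat_0 of_nat_eq_iff Suc_eq_plus1 nat.distinct(1))
  then show "((\<lambda>r. taylor_coeff h n * of_real r ^ (2 * n + 2) / of_nat (n + 1)) \<longlongrightarrow> taylor_coeff h n / of_nat (n + 1)) (at_left (1::real))"
    by simp
qed

subsection \<open>Dual norms\<close>

text \<open>The derivative of \<open>1 / (1 - z)^2\<close>, whose coefficients are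
  \<open>k + 1\<close>.\<close>

lemma inverse_cube_sums:
  fixes u :: complex
  assumes u: "cmod u < 1"
  shows "(\<lambda>k. of_nat ((k + 1) * (k + 2)) * u ^ k) sums (2 / (1 - u) ^ 3)"
proof -
  define h :: "complex \<Rightarrow> complex" where "h = (\<lambda>z. 1 / (1 - z)\<^sup>2)"
  have hol: "h holomorphic_on ball 0 1" unfolding h_def by (intro holomorphic_intros) auto
  have c: "taylor_coeff h k = of_nat (Suc k)" for k
    by (rule taylor_coeff_unique) (auto simp: h_def intro!: geometric_deriv_sums simp del: of_nat_Suc)
  have nz: "1 - u \<noteq> 0" using u by auto
  have "2 * v / (v\<^sup>2 * v\<^sup>2) = 2 / v ^ 3" if "v \<noteq> 0" for v :: complex
    using that by (simp add: divide_simps power2_eq_square power3_eq_cube)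
  moreover have "(h has_field_derivative 2 * (1 - u) / ((1 - u)\<^sup>2 * (1 - u)\<^sup>2)) (at u)"
    unfolding h_def using nz by (auto intro!: derivative_eq_intros)
  ultimately have "(h has_field_derivative 2 / (1 - u) ^ 3) (at u)"
    using nz by metis
  then have "deriv h u = 2 / (1 - u) ^ 3" by (rule DERIV_imp_deriv)
  moreover have "taylor_coeff (deriv h) k = of_nat ((k + 1) * (k + 2))" for k
    by (simp add: taylor_coeff_deriv c algebra_simps)
  ultimately show ?thesis
    using taylor_sums[OF deriv_holomorphic_disc[OF hol] u] by simp
qed

lemma summable_inverse_cube:
  fixes x :: real
  assumes "0 \<le> x" "x < 1"
  shows "summable (\<lambda>k. of_nat ((k + 1) * (k + 2)) * x ^ k)"
proof -
  have "summable (\<lambda>k. norm (of_nat ((k + 1) * (k + 2)) :: complex) * x ^ k)"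
    by (rule power_series_abs_summable_ball)
       (use inverse_cube_sums assms in \<open>auto simp: sums_iff simp del: of_nat_mult of_nat_add\<close>)
  then show ?thesis unfolding norm_of_nat .
qed

text \<open>The derivative in \<open>w\<close> of the Bergman kernel
  \<open>1 / (1 - w * z)^2\<close>. No conjugate falls on \<open>w\<close>, because the pairing
  evaluates its second argument at \<open>cnj z\<close>.\<close>

definition deriv_kernel :: "complex \<Rightarrow> complex \<Rightarrow> complex" where
  "deriv_kernel w z = 2 * z / (1 - w * z) ^ 3"

lemma deriv_kernel_bergman1:
  assumes w: "cmod w < 1"
  shows "deriv_kernel w \<in> bergman1" "bergman1_norm (deriv_kernel w) \<le> 4 / (1 - (cmod w)\<^sup>2)"
proof -
  have hol: "deriv_kernel w holomorphic_on ball 0 1"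
    unfolding deriv_kernel_def by (intro holomorphic_intros) (use one_minus_mult_disc[OF w] in auto)
  have le: "norm (deriv_kernel w z) \<le> 2 * (1 / cmod (1 - w * z) ^ 3)" if "cmod z < 1" for z
    using that by (auto simp: deriv_kernel_def norm_mult norm_divide norm_power intro!: divide_right_mono)
  show *: "deriv_kernel w \<in> bergman1"
    by (rule bergman1_bounded[OF hol, where B="2 * (1 / (1 - cmod w) ^ 3)"])
       (use inverse_cube_le_disc[OF w] in \<open>auto intro!: order_trans[OF le] simp del: times_divide_eq_right\<close>)
  have "(\<integral>z. norm (deriv_kernel w z) \<partial>disc) \<le> (\<integral>z. 2 * (1 / cmod (1 - w * z) ^ 3) \<partial>disc)"
    by (intro integral_mono integrable_norm bergman1_integrable[OF *] integrable_mult_right integrable_disc_inverse_cube[OF w] le) auto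
  also have "\<dots> \<le> 2 * (2 * pi / (1 - (cmod w)\<^sup>2))"
    using integral_disc_inverse_cube_le[OF w] by (subst integral_mult_right_zero) simp
  finally show "bergman1_norm (deriv_kernel w) \<le> 4 / (1 - (cmod w)\<^sup>2)"
    by (simp add: bergman1_norm_eq[OF *] divide_simps)
qed

lemma taylor_coeff_deriv_kernel:
  assumes w: "cmod w < 1"
  shows "taylor_coeff (deriv_kernel w) 0 = 0"
    and "taylor_coeff (deriv_kernel w) (Suc k) = of_nat ((k + 1) * (k + 2)) * w ^ k"
proof -
  let ?c = "\<lambda>j. case j of 0 \<Rightarrow> 0 | Suc k \<Rightarrow> complex_of_nat ((k + 1) * (k + 2)) * w ^ k"
  have "taylor_coeff (deriv_kernel w) j = ?c j" for j
  proof (rule taylor_coeff_unique)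
    fix z :: complex assume z: "cmod z < 1"
    have "(\<lambda>k. z * (of_nat ((k + 1) * (k + 2)) * (w * z) ^ k)) sums (z * (2 / (1 - w * z) ^ 3))"
      by (intro sums_mult inverse_cube_sums cmod_mult_less_one w z)
    then have "(\<lambda>k. ?c (Suc k) * z ^ Suc k) sums deriv_kernel w z"
      by (simp add: deriv_kernel_def power_mult_distrib mult_ac)
    then show "(\<lambda>k. ?c k * z ^ k) sums deriv_kernel w z"
      using sums_Suc_iff[of "\<lambda>k. ?c k * z ^ k"] by simp
  qed
  then show "taylor_coeff (deriv_kernel w) 0 = 0"
    "taylor_coeff (deriv_kernel w) (Suc k) = of_nat ((k + 1) * (k + 2)) * w ^ k" by auto
qed

lemma pairing_deriv_kernel:
  assumes h: "h \<in> bloch" and w: "cmod w < 1"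
  shows "pairing (deriv_kernel w) h = deriv h w"
proof (rule pairing_eqI[OF deriv_kernel_bergman1(1)[OF w] h])
  note dh = deriv_holomorphic_disc[OF bloch_holomorphic[OF h]]
  fix r :: real assume r: "0 < r" "r < 1"
  have "r\<^sup>2 \<le> 1" using r by (simp add: power_le_one)
  then have "cmod (of_real (r\<^sup>2) * w) < 1"
    using mult_less_one_disc[of "r\<^sup>2" w] w by (simp add: norm_mult norm_power)
  from sums_mult[OF taylor_sums[OF dh this], of "of_real r ^ 4"]
  have s: "(\<lambda>k. of_real r ^ 4 * (of_nat (Suc k) * taylor_coeff h (Suc k) * (of_real (r\<^sup>2) * w) ^ k)) sums (of_real r ^ 4 * deriv h (of_real (r\<^sup>2) * w))"
    by (simp only: taylor_coeff_deriv)
  let ?t = "\<lambda>k. taylor_coeff (deriv_kernel w) k * taylor_coeff h k * of_real r ^ (2 * k + 2) / of_nat (k + 1) :: complex"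
  have t: "?t (Suc k) = of_real r ^ 4 * (of_nat (Suc k) * taylor_coeff h (Suc k) * (of_real (r\<^sup>2) * w) ^ k)" for k
  proof -
    \<comment> \<open>Since the series starts at index one, two extra powers of \<open>r\<close>
      split off and the exponent is four: the truncated pairing is \<open>r ^ 4\<close> times the
      derivative of \<open>h\<close> at \<open>w\<close> dilated by the square of
      \<open>r\<close>.\<close>
    have e: "complex_of_real r ^ (2 * Suc k + 2) = of_real r ^ 4 * of_real (r\<^sup>2) ^ k"
      by (simp add: power2_eq_square power4_eq_xxxx power_mult_distrib mult_ac flip: power_add mult_2)
    have nz: "of_nat (k + 2) \<noteq> (0::complex)" unfolding of_nat_eq_0_iff by simp
    have "?t (Suc k) = (of_nat ((k + 1) * (k + 2)) * w ^ k) * taylor_coeff h (Suc k) * (of_real r ^ 4 * of_real (r\<^sup>2) ^ k) / of_nat (k + 2)"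
      unfolding taylor_coeff_deriv_kernel(2)[OF w] e by simp
    also have "\<dots> = of_real r ^ 4 * (of_nat (Suc k) * taylor_coeff h (Suc k) * (of_real (r\<^sup>2) * w) ^ k)"
      unfolding of_nat_mult power_mult_distrib using nz by (simp add: field_simps del: of_nat_add of_nat_Suc)
    finally show ?thesis .
  qed
  show "?t sums (of_real r ^ 4 * deriv h (of_real (r\<^sup>2) * w))"
    using s unfolding t[symmetric] using sums_Suc_iff[of ?t] taylor_coeff_deriv_kernel(1)[OF w] by simp
next
  have "isCont (deriv h) (of_real (1\<^sup>2) * w)"
    using w by (intro holomorphic_disc_isCont deriv_holomorphic_disc bloch_holomorphic[OF h]) simp
  then have "((\<lambda>r. deriv h (of_real (r\<^sup>2) * w)) \<longlongrightarrow> deriv h (of_real (1\<^sup>2) * w)) (at_left (1::real))"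
    by (rule isCont_tendsto_compose) (intro tendsto_intros)
  then have "((\<lambda>r. of_real r ^ 4 * deriv h (of_real (r\<^sup>2) * w)) \<longlongrightarrow> of_real 1 ^ 4 * deriv h (of_real (1\<^sup>2) * w)) (at_left (1::real))"
    by (intro tendsto_intros)
  then show "((\<lambda>r. of_real r ^ 4 * deriv h (of_real (r\<^sup>2) * w)) \<longlongrightarrow> deriv h w) (at_left (1::real))"
    by simp
qed

text \<open>Testing on the constant one recovers \<open>h 0\<close> at cost \<open>M\<close>, and
  testing on \<open>deriv_kernel z\<close> recovers the weighted derivative at cost
  \<open>4 * M\<close>. The four is two from the numerator of the kernel times two from
  \<open>integral_disc_inverse_cube_le\<close>.\<close>

lemma bloch_norm_le_dual:
  assumes h: "h \<in> bloch" and M: "\<And>g. g \<in> bergman1 \<Longrightarrow> cmod (pairing g h) \<le> M * bergman1_norm g"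
  shows "bloch_norm h \<le> 5 * M"
proof -
  have one: "bergman1_norm (\<lambda>z. z ^ 0) = 1"
    using monomial_bergman1(2)[of 0] integral_disc_power[of 0] by simp
  have h0: "cmod (h 0) \<le> M"
    using M[OF monomial_bergman1(1)[of 0]] unfolding pairing_monomial[OF h] one by (simp add: taylor_coeff_0)
  then have M0: "0 \<le> M" by (rule order_trans[OF norm_ge_zero])
  have "bloch_seminorm h \<le> 4 * M"
  proof (rule blochI(2)[OF bloch_holomorphic[OF h]])
    fix z :: complex assume z: "cmod z < 1"
    have "cmod (deriv h z) \<le> M * bergman1_norm (deriv_kernel z)"
      using M[OF deriv_kernel_bergman1(1)[OF z]] by (simp add: pairing_deriv_kernel[OF h z])
    also have "\<dots> \<le> M * (4 / (1 - (cmod z)\<^sup>2))"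
      by (intro mult_left_mono deriv_kernel_bergman1 z M0)
    finally show "(1 - (cmod z)\<^sup>2) * cmod (deriv h z) \<le> 4 * M"
      using one_minus_sq_pos[OF z] by (simp add: field_simps)
  qed
  then show ?thesis using h0 by (simp add: bloch_norm_eq)
qed

text \<open>Up to conjugation \<open>f\<close> is the Bergman projection of \<phi>: its value at
  \<open>w\<close> is \<open>1 / pi\<close> times the integral of
  \<open>\<phi> z / (1 - w * z)^2\<close>. Support within radius \<rho> makes the coefficients decay
  geometrically, so \<open>f\<close> has bounded derivative and lies in the little Bloch space, but
  that derivative bound degenerates as \<rho> tends to one. The bound five does not, because it
  comes from duality.\<close>

lemma bergman_projection:
  assumes \<phi>: "\<phi> \<in> borel_measurable disc" "\<And>z. norm (\<phi> z) \<le> 1" "\<And>z. \<rho> < cmod z \<Longrightarrow> \<phi> z = 0"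
    and \<rho>: "0 \<le> \<rho>" "\<rho> < 1"
  obtains f where "f \<in> little_bloch" "bloch_norm f \<le> 5"
    "\<And>g. g \<in> bergman1 \<Longrightarrow> pairing g f = (\<integral>z. \<phi> z * g z \<partial>disc) / of_real pi"
proof -
  \<comment> \<open>Moments of \<phi>; the factor \<open>k + 1\<close> added in \<open>c\<close> is
    the \<open>k\<close>-th coefficient of \<open>1 / (1 - x)^2\<close>.\<close>
  define m where "m k = (\<integral>z. \<phi> z * z ^ k \<partial>disc) / of_real pi" for k
  define c where "c k = of_nat (k + 1) * m k" for k
  define f where "f z = (\<Sum>k. c k * z ^ k)" for z
  have pk: "(\<lambda>z. z ^ k) \<in> borel_measurable disc" for k
    by (rule borel_measurable_disc_continuous) (intro continuous_intros)
  have \<phi>k: "norm (\<phi> z * z ^ k) \<le> \<rho> ^ k" for z k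
  proof (cases "\<rho> < cmod z")
    case False
    then have "norm (\<phi> z) * cmod z ^ k \<le> 1 * \<rho> ^ k" by (intro mult_mono \<phi> power_mono) auto
    then show ?thesis by (simp add: norm_mult norm_power)
  qed (use \<phi>(3) \<rho> in auto)
  have intk: "integrable disc (\<lambda>z. \<phi> z * z ^ k)" for k
    by (rule integrable_disc_bounded[OF _ \<phi>k]) (intro borel_measurable_times \<phi> pk)
  have one: "integrable disc (\<lambda>_. 1 :: complex)" by simp
  have mk: "norm (m k) \<le> \<rho> ^ k" for k
  proof -
    have "norm (\<integral>z. \<phi> z * z ^ k \<partial>disc) \<le> (\<integral>z. \<rho> ^ k \<partial>disc)"
      by (rule Bochner_Integration.integral_norm_bound_integral[OF intk _ \<phi>k]) simp
    also have "\<dots> = pi * \<rho> ^ k" by (simp add: measure_def emeasure_disc_space)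
    finally show ?thesis by (simp add: m_def norm_divide divide_simps mult.commute)
  qed
  have ck: "norm (c k) \<le> of_nat (k + 1) * \<rho> ^ k" for k
    unfolding c_def norm_mult norm_of_nat by (intro mult_mono mk) auto
  have geo1: "summable (\<lambda>k. of_nat (k + 1) * \<rho> ^ k)"
    using geometric_deriv_sums[of \<rho>] \<rho> by (simp add: sums_iff add_ac)
  have c_sums: "(\<lambda>k. c k * z ^ k) sums f z" if z: "cmod z < 1" for z
    unfolding f_def
  proof (rule summable_sums, rule summable_comparison_test'[OF geo1, of 0])
    fix k
    have "norm (c k) * cmod z ^ k \<le> (of_nat (k + 1) * \<rho> ^ k) * 1"
      by (intro mult_mono ck power_le_one) (use z \<rho> in auto)
    then show "norm (c k * z ^ k) \<le> of_nat (k + 1) * \<rho> ^ k" by (simp add: norm_mult norm_power)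
  qed
  have hol: "f holomorphic_on ball 0 1"
    by (rule power_series_holomorphic[of 0 1 c]) (use c_sums in auto)
  have fc: "taylor_coeff f k = c k" for k
    by (rule taylor_coeff_unique) (rule c_sums)
  have little: "f \<in> little_bloch"
  proof (rule little_bloch_bounded_deriv[OF hol])
    fix w :: complex assume w: "cmod w < 1"
    let ?B = "\<lambda>k. of_nat ((k + 1) * (k + 2)) * \<rho> ^ k :: real"
    have summ: "summable ?B" by (rule summable_inverse_cube[OF \<rho>])
    have le: "norm (taylor_coeff (deriv f) k * w ^ k) \<le> ?B k" for k
    proof -
      have "norm (taylor_coeff (deriv f) k * w ^ k) \<le> norm (taylor_coeff (deriv f) k)"
        using w by (simp add: norm_mult norm_power mult_left_le power_le_one)
      also have "\<dots> = of_nat (Suc k) * norm (c (Suc k))"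
        unfolding taylor_coeff_deriv fc norm_mult by (simp del: of_nat_Suc)
      also have "\<dots> \<le> of_nat (Suc k) * (of_nat (Suc k + 1) * \<rho> ^ Suc k)"
        by (intro mult_left_mono ck) auto
      also have "\<dots> \<le> of_nat (Suc k) * (of_nat (Suc k + 1) * \<rho> ^ k)"
        using \<rho> by (intro mult_left_mono) (auto simp: mult_left_le_one_le)
      finally show ?thesis by (simp add: algebra_simps)
    qed
    have "deriv f w = (\<Sum>k. taylor_coeff (deriv f) k * w ^ k)"
      using taylor_sums[OF deriv_holomorphic_disc[OF hol] w] by (simp add: sums_iff)
    also have "norm \<dots> \<le> suminf ?B"
      by (rule norm_suminf_le[OF le summ])
    finally show "cmod (deriv f w) \<le> suminf ?B" .
  qed
  note fb = little_bloch_bloch[OF little]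
  have pair: "pairing g f = (\<integral>z. \<phi> z * g z \<partial>disc) / of_real pi" if g: "g \<in> bergman1" for g
  proof (rule pairing_eqI[OF g fb])
    note gh = bergman1_holomorphic[OF g]
    \<comment> \<open>The factor \<open>k + 1\<close> in \<open>c k\<close> cancels the denominator
      of the diagonal series, which leaves the expansion of the dilated \<open>g\<close> integrated
      against \<phi>.\<close>
    let ?S = "\<lambda>r. of_real (r\<^sup>2) * (\<integral>z. \<phi> z * g (of_real (r\<^sup>2) * z) \<partial>disc) / of_real pi :: complex"
    have r2z: "cmod (of_real (r\<^sup>2) * z) < 1" if "0 < r" "r < 1" "cmod z < 1" for r :: real and z
      using mult_less_one_disc[of "r\<^sup>2" z] that by (simp add: norm_mult norm_power power_le_one)
    have gmeas: "(\<lambda>z. g (of_real (r\<^sup>2) * z)) \<in> borel_measurable disc" if r: "0 < r" "r < 1" for r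
      by (rule borel_measurable_disc_continuous, rule continuous_on_compose2[OF holomorphic_on_imp_continuous_on[OF gh]])
         (use r2z[OF r] in \<open>auto intro!: continuous_intros\<close>)
    show "(\<lambda>k. taylor_coeff g k * taylor_coeff f k * of_real r ^ (2 * k + 2) / of_nat (k + 1)) sums ?S r"
      if r: "0 < r" "r < 1" for r
    proof -
      have r2: "0 \<le> r\<^sup>2" "r\<^sup>2 < 1" using r by (auto simp: abs_square_less_1)
      let ?F = "\<lambda>k z. taylor_coeff g k * of_real (r\<^sup>2) ^ k * (\<phi> z * z ^ k)"
      have le: "norm (?F k z) \<le> norm (taylor_coeff g k) * (r\<^sup>2) ^ k" for k z
        using mult_left_mono[OF order_trans[OF \<phi>k[of z k] power_le_one[of \<rho> k]], of "norm (taylor_coeff g k) * (r\<^sup>2) ^ k"] \<rho> r2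
        by (simp add: norm_mult norm_power power_abs mult.assoc)
      have summ: "summable (\<lambda>k. norm (taylor_coeff g k) * (r\<^sup>2) ^ k)"
        using taylor_abs_summable[OF gh] r2 by simp
      have intF: "integrable disc (?F k)" for k
        by (intro integrable_mult_right intk)
      have "(\<lambda>k. \<integral>z. ?F k z \<partial>disc) sums (\<integral>z. \<phi> z * g (of_real (r\<^sup>2) * z) \<partial>disc)"
      proof (rule sums_integral_disc_dominated[OF intF one summ])
        fix z :: complex assume "cmod z < 1"
        from sums_mult[OF taylor_sums[OF gh r2z[OF r this]], of "\<phi> z"]
        show "(\<lambda>k. ?F k z) sums (\<phi> z * g (of_real (r\<^sup>2) * z))"
          by (simp add: power_mult_distrib mult_ac)
      qed (use le in simp)
      from sums_divide[OF sums_mult[OF this, of "of_real (r\<^sup>2)"], of "of_real pi"]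
      have "(\<lambda>k. of_real (r\<^sup>2) * (\<integral>z. ?F k z \<partial>disc) / of_real pi) sums ?S r" .
      moreover have "of_real (r\<^sup>2) * (\<integral>z. ?F k z \<partial>disc) / of_real pi
        = taylor_coeff g k * taylor_coeff f k * of_real r ^ (2 * k + 2) / of_nat (k + 1)" for k
      proof -
        have e: "complex_of_real r ^ (2 * k + 2) = of_real (r\<^sup>2) * of_real (r\<^sup>2) ^ k"
          by (simp add: power2_eq_square power_mult_distrib mult_ac flip: mult_2)
             (simp add: mult_2_right power_add)
        have nz: "of_nat (k + 1) \<noteq> (0::complex)" unfolding of_nat_eq_0_iff by simp
        show ?thesis
          unfolding integral_mult_right_zero fc c_def m_def e using nz
          by (simp add: mult_ac del: of_nat_add of_nat_Suc)
      qed
      ultimately show ?thesis by simp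
    qed
    \<comment> \<open>A bound for \<open>g\<close> on \<open>|z| \<le> \<rho>\<close> dominates all
      integrands: \<phi> vanishes further out, and dilation only moves points inwards.\<close>
    obtain B where B: "0 \<le> B" "\<And>z. cmod z \<le> \<rho> \<Longrightarrow> norm (g z) \<le> B"
      using holomorphic_disc_bounded_cball[OF gh \<rho>(2)] by blast
    show "(?S \<longlongrightarrow> (\<integral>z. \<phi> z * g z \<partial>disc) / of_real pi) (at_left 1)"
    proof (rule tendsto_at_left_sequentially[of 0])
      fix X :: "nat \<Rightarrow> real"
      assume X: "\<And>n. X n < 1" "\<And>n. 0 < X n" "X \<longlonglongrightarrow> 1"
      have lim: "(\<lambda>n. (X n)\<^sup>2) \<longlonglongrightarrow> 1" using tendsto_power[OF X(3), of 2] by simp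
      have "(\<lambda>n. \<integral>z. \<phi> z * g (of_real ((X n)\<^sup>2) * z) \<partial>disc) \<longlonglongrightarrow> (\<integral>z. \<phi> z * g z \<partial>disc)"
      proof (rule integral_dominated_convergence[where w="\<lambda>_. B"])
        show "(\<lambda>z. \<phi> z * g z) \<in> borel_measurable disc"
          using \<phi>(1) bergman1_integrable[OF g] by auto
        show "(\<lambda>z. \<phi> z * g (of_real ((X n)\<^sup>2) * z)) \<in> borel_measurable disc" for n
          by (intro borel_measurable_times \<phi> gmeas X)
        show "AE z in disc. norm (\<phi> z * g (of_real ((X n)\<^sup>2) * z)) \<le> B" for n
        proof (rule AE_I2)
          fix z
          show "norm (\<phi> z * g (of_real ((X n)\<^sup>2) * z)) \<le> B"
          proof (cases "\<rho> < cmod z")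
            case False
            have "(X n)\<^sup>2 * cmod z \<le> cmod z"
              using X(1,2)[of n] by (intro mult_left_le_one_le) (auto simp: power_le_one)
            then have "norm (g (of_real ((X n)\<^sup>2) * z)) \<le> B"
              using False by (intro B(2)) (auto simp: norm_mult norm_power)
            from mult_mono[OF \<phi>(2)[of z] this] show ?thesis by (simp add: norm_mult)
          qed (use \<phi>(3) B(1) in auto)
        qed
        show "AE z in disc. (\<lambda>n. \<phi> z * g (of_real ((X n)\<^sup>2) * z)) \<longlonglongrightarrow> \<phi> z * g z"
        proof (rule AE_I2)
          fix z assume z: "z \<in> space disc"
          have "isCont g (of_real 1 * z)"
            using z by (intro holomorphic_disc_isCont[OF gh]) simp
          then have "(\<lambda>n. g (of_real ((X n)\<^sup>2) * z)) \<longlonglongrightarrow> g (of_real 1 * z)"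
            by (rule isCont_tendsto_compose) (intro tendsto_intros lim)
          then show "(\<lambda>n. \<phi> z * g (of_real ((X n)\<^sup>2) * z)) \<longlonglongrightarrow> \<phi> z * g z"
            by (intro tendsto_intros) simp
        qed
      qed simp
      then have "(\<lambda>n. ?S (X n)) \<longlonglongrightarrow> of_real 1 * (\<integral>z. \<phi> z * g z \<partial>disc) / of_real pi"
        by (intro tendsto_intros lim) auto
      then show "(\<lambda>n. ?S (X n)) \<longlonglongrightarrow> (\<integral>z. \<phi> z * g z \<partial>disc) / of_real pi" by simp
    qed simp
  qed
  \<comment> \<open>Since \<open>|\<phi>| \<le> 1\<close>, the functional has norm at most one on
    \<open>A^1\<close>; the dual estimate then bounds the Bloch norm independently of
    \<rho>.\<close>
  have "cmod (pairing g f) \<le> 1 * bergman1_norm g" if g: "g \<in> bergman1" for g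
  proof -
    note gi = bergman1_integrable[OF g]
    have "norm (\<integral>z. \<phi> z * g z \<partial>disc) \<le> (\<integral>z. norm (g z) \<partial>disc)"
    proof (rule Bochner_Integration.integral_norm_bound_integral[OF _ integrable_norm[OF gi]])
      show "integrable disc (\<lambda>z. \<phi> z * g z)"
        using integrable_disc_times_bounded[OF gi \<phi>(1,2)] by (simp add: mult.commute)
      show "norm (\<phi> z * g z) \<le> norm (g z)" for z
        using mult_right_mono[OF \<phi>(2)[of z], of "norm (g z)"] by (simp add: norm_mult)
    qed
    then show ?thesis
      by (simp add: pair[OF g] bergman1_norm_eq[OF g] norm_divide divide_right_mono)
  qed
  from bloch_norm_le_dual[OF fb this] have "bloch_norm f \<le> 5" by simp
  from that[OF little this pair] show ?thesis .
qed

text \<open>The unimodular function \<open>cnj g / |g|\<close> turns the pairing into the norm. It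
  is cut off at radius \<rho> so that its projection is an admissible test function; the estimate is
  uniform in \<rho>, which is finally sent to one.\<close>

lemma bergman1_norm_le_dual:
  assumes g: "g \<in> bergman1" and M: "\<And>f. f \<in> little_bloch \<Longrightarrow> cmod (pairing g f) \<le> M * bloch_norm f"
    and M0: "0 \<le> M"
  shows "bergman1_norm g \<le> 5 * M"
proof -
  have gm: "g \<in> borel_measurable disc" using bergman1_integrable[OF g] by auto
  have part: "(\<integral>z. indicator (cball 0 \<rho>) z * norm (g z) \<partial>disc) \<le> 5 * M * pi" if \<rho>: "0 \<le> \<rho>" "\<rho> < 1" for \<rho>
  proof -
    \<comment> \<open>At zeros of \<open>g\<close> the quotient is \<open>0 / 0 = 0\<close>, so
      \<open>\<phi> z * g z = |g z|\<close> holds on the whole smaller disc.\<close>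
    define \<phi> where "\<phi> z = indicator (cball 0 \<rho>) z * (cnj (g z) / of_real (cmod (g z)))" for z
    have mi: "(indicator (cball 0 \<rho>) :: complex \<Rightarrow> complex) \<in> borel_measurable disc"
      by (rule borel_measurable_disc_borel) (intro borel_measurable_indicator, simp)
    have mc: "(\<lambda>z. cnj (g z)) \<in> borel_measurable disc"
      using gm by (rule measurable_compose) (intro borel_measurable_continuous_onI continuous_intros)
    have p1: "\<phi> \<in> borel_measurable disc"
      unfolding \<phi>_def by (intro borel_measurable_times borel_measurable_divide mi mc) (use gm in measurable)
    have p2: "norm (\<phi> z) \<le> 1" for z
      by (auto simp: \<phi>_def indicator_def norm_divide)
    have p3: "\<phi> z = 0" if "\<rho> < cmod z" for z using that by (simp add: \<phi>_def)
    obtain f where f: "f \<in> little_bloch" "bloch_norm f \<le> 5"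
      "\<And>g. g \<in> bergman1 \<Longrightarrow> pairing g f = (\<integral>z. \<phi> z * g z \<partial>disc) / of_real pi"
      using bergman_projection[OF p1 p2 p3 \<rho>] by blast
    have "\<phi> z * g z = of_real (indicator (cball 0 \<rho>) z * norm (g z))" for z
      using complex_norm_square[of "g z"]
      by (cases "g z = 0") (auto simp: \<phi>_def indicator_def field_simps power2_eq_square)
    then have "pairing g f = of_real ((\<integral>z. indicator (cball 0 \<rho>) z * norm (g z) \<partial>disc) / pi)"
      using f(3)[OF g] by (simp only: complex_integral_of_real_disc of_real_divide)
    then have "(\<integral>z. indicator (cball 0 \<rho>) z * norm (g z) \<partial>disc) / pi \<le> cmod (pairing g f)"
      by (simp flip: of_real_divide)
    also have "\<dots> \<le> M * bloch_norm f" by (rule M[OF f(1)])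
    also have "\<dots> \<le> M * 5" by (intro mult_left_mono f M0)
    finally show ?thesis by (simp add: field_simps)
  qed
  let ?\<rho> = "\<lambda>n. 1 - 1 / real (Suc n)"
  have "(\<lambda>n. \<integral>z. indicator (cball 0 (?\<rho> n)) z * norm (g z) \<partial>disc) \<longlonglongrightarrow> (\<integral>z. norm (g z) \<partial>disc)"
  proof (rule integral_dominated_convergence[where w="\<lambda>z. norm (g z)"])
    show "(\<lambda>z. indicator (cball 0 (?\<rho> n)) z * norm (g z)) \<in> borel_measurable disc" for n
      by (rule borel_measurable_times[OF borel_measurable_disc_borel measurable_compose[OF gm borel_measurable_norm]])
         (intro borel_measurable_indicator, simp)
    show "AE z in disc. (\<lambda>n. indicator (cball 0 (?\<rho> n)) z * norm (g z)) \<longlonglongrightarrow> norm (g z)"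
    proof (rule AE_I2)
      fix z assume "z \<in> space disc"
      then have "cmod z < 1" by simp
      moreover have "?\<rho> \<longlonglongrightarrow> 1 - 0"
        using LIMSEQ_inverse_real_of_nat by (intro tendsto_intros) (simp add: inverse_eq_divide)
      ultimately have "\<forall>\<^sub>F n in sequentially. cmod z < ?\<rho> n"
        using order_tendstoD(1) by fastforce
      then have "\<forall>\<^sub>F n in sequentially. norm (g z) = indicator (cball 0 (?\<rho> n)) z * norm (g z)"
        by eventually_elim simp
      then show "(\<lambda>n. indicator (cball 0 (?\<rho> n)) z * norm (g z)) \<longlonglongrightarrow> norm (g z)"
        by (rule Lim_transform_eventually[OF tendsto_const])
    qed
  qed (use gm bergman1_integrable[OF g] in \<open>auto simp: indicator_def\<close>)
  then have "(\<integral>z. norm (g z) \<partial>disc) \<le> 5 * M * pi"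
    by (rule LIMSEQ_le_const2) (use part in auto)
  then show ?thesis by (simp add: bergman1_norm_eq[OF g] field_simps)
qed

subsection \<open>Uniform boundedness\<close>

text \<open>Baire is applied once, to the product space: one of the closed sets on which all forms
  are bounded by \<open>M\<close> contains a ball, and a mixed second difference moves that ball to
  the origin.\<close>

lemma bilinear_uniform_boundedness:
  fixes \<beta> :: "nat \<Rightarrow> 'a::{real_normed_vector, complete_space} \<Rightarrow> 'b::{real_normed_vector, complete_space} \<Rightarrow> 'c::real_normed_vector"
  assumes bil: "\<And>n. bounded_bilinear (\<beta> n)"
    and pointwise: "\<And>x y. \<exists>M. \<forall>n. norm (\<beta> n x y) \<le> M"
  shows "\<exists>K. \<forall>n x y. norm (\<beta> n x y) \<le> K * norm x * norm y"
proof -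
  define E where "E M = {p. \<forall>n. norm (\<beta> n (fst p) (snd p)) \<le> real M}" for M :: nat
  have "closed (E M)" for M
  proof -
    have "E M = (\<Inter>n. {p. norm (\<beta> n (fst p) (snd p)) \<le> real M})" by (auto simp: E_def)
    also have "closed \<dots>"
      by (intro closed_INT ballI closed_Collect_le continuous_on_norm continuous_on_const
          bounded_bilinear.continuous_on[OF bil] continuous_on_fst continuous_on_snd continuous_on_id)
    finally show ?thesis .
  qed
  moreover have "(\<Union>M. E M) = UNIV"
  proof -
    have "\<exists>M. p \<in> E M" for p
    proof -
      obtain B where "\<And>n. norm (\<beta> n (fst p) (snd p)) \<le> B" using pointwise by blast
      moreover obtain M :: nat where "B \<le> real M" using real_arch_simple by blast
      ultimately have "p \<in> E M" unfolding E_def by (blast intro: order_trans)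
      then show ?thesis by blast
    qed
    then show ?thesis by blast
  qed
  ultimately have "\<exists>M. interior (E M) \<noteq> {}"
    using Baire_category_alt[of "euclidean :: ('a \<times> 'b) topology" "range E"]
    by (auto simp: completely_metrizable_space_euclidean)
  then obtain M p r where "0 < r" "ball p r \<subseteq> E M"
    by (metis all_not_in_conv mem_interior)
  then have E: "norm (\<beta> n (fst p + u) (snd p + v)) \<le> real M" if "norm u + norm v < r" for n u v
  proof -
    have "dist p (fst p + u, snd p + v) < r"
      using that norm_Pair_le[of "- u" "- v"] by (cases p) (simp add: dist_norm)
    then have "(fst p + u, snd p + v) \<in> E M" using \<open>ball p r \<subseteq> E M\<close> by auto
    then show ?thesis by (simp add: E_def)
  qed
  \<comment> \<open>With a quarter of the radius, \<open>norm u + norm v \<le> r / 2\<close> stays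
    strictly inside the ball, and \<open>small\<close> also covers vectors of norm exactly
    \<open>s\<close>.\<close>
  define s where "s = r / 4"
  have s: "0 < s" using \<open>0 < r\<close> by (simp add: s_def)
  have small: "norm (\<beta> n u v) \<le> 4 * real M" if "norm u \<le> s" "norm v \<le> s" for n u v
  proof -
    interpret bounded_bilinear "\<beta> n" by (rule bil)
    \<comment> \<open>In the mixed second difference all terms involving \<open>p\<close> cancel;
      four values bounded by \<open>M\<close> remain.\<close>
    have "\<beta> n u v = (\<beta> n (fst p + u) (snd p + v) - \<beta> n (fst p + u) (snd p + 0))
       - (\<beta> n (fst p + 0) (snd p + v) - \<beta> n (fst p + 0) (snd p + 0))"
      by (simp add: add_left add_right)
    also have "norm \<dots> \<le> (real M + real M) + (real M + real M)"
      by (intro order_trans[OF norm_triangle_ineq4] add_mono E) (use that s in \<open>auto simp: s_def\<close>)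
    finally show ?thesis by simp
  qed
  show ?thesis
  proof (intro exI allI)
    fix n x y
    interpret bounded_bilinear "\<beta> n" by (rule bil)
    show "norm (\<beta> n x y) \<le> (4 * real M / s\<^sup>2) * norm x * norm y"
    proof (cases "x = 0 \<or> y = 0")
      case False
      have "norm (\<beta> n ((s / norm x) *\<^sub>R x) ((s / norm y) *\<^sub>R y)) \<le> 4 * real M"
        by (rule small) (use s False in auto)
      then show ?thesis
        using s False by (simp add: scaleR_left scaleR_right field_simps power2_eq_square)
    qed (auto simp: zero_left zero_right)
  qed
qed

section \<open>Uniform bound for the forms given by the multipliers\<close>

lemma taylor_coeff_cong:
  assumes "g holomorphic_on ball 0 1" "\<And>z. cmod z < 1 \<Longrightarrow> f z = g z"
  shows "taylor_coeff f k = taylor_coeff g k"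
  by (rule taylor_coeff_unique) (simp add: assms taylor_sums)

lemma pairing_cong:
  assumes "g \<in> bergman1" "h \<in> bloch"
    and "\<And>z. cmod z < 1 \<Longrightarrow> g' z = g z" "\<And>z. cmod z < 1 \<Longrightarrow> h' z = h z"
  shows "pairing g' h' = pairing g h"
proof (rule pairing_cong_coeff)
  show "g' \<in> bergman1" using bergman1_cong[of g' g] assms by blast
  show "h' \<in> bloch" using bloch_cong[of h' h] assms by blast
  show "taylor_coeff g' k * taylor_coeff h' k = taylor_coeff g k * taylor_coeff h k" for k
    using taylor_coeff_cong[of g g' k] taylor_coeff_cong[of h h' k] assms bergman1_holomorphic bloch_holomorphic by simp
qed (use assms in auto)

text \<open>Two sequences in the unit balls map \<open>\<ell>\<^sup>\<infinity> \<times> \<ell>\<^sup>\<infinity>\<close> into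
  \<open>A\<^sup>1 \<times> B\<^sub>0\<close>, so that the uniform boundedness principle is only needed on a Banach
  space that is available as a type. Bounded continuous functions on the real line, evaluated at the
  natural numbers, serve as \<open>\<ell>\<^sup>\<infinity>\<close> because completeness of \<open>bcontfun\<close> is only
  registered for metric domains.\<close>
definition damped_series :: "(nat \<Rightarrow> complex \<Rightarrow> complex) \<Rightarrow> (real \<Rightarrow>\<^sub>C real) \<Rightarrow> complex \<Rightarrow> complex" where
  "damped_series g c z = (\<Sum>j. of_real (c (real j) * (1 / 2) ^ j) * g j z)"

lemma damped_summable: "summable (\<lambda>j. norm c * (1 / 2 :: real) ^ j)"
  by (intro summable_mult) auto

lemma damped_suminf: "(\<Sum>j. norm c * (1 / 2 :: real) ^ j) = 2 * norm c"
  by (subst suminf_mult) (auto simp: suminf_geometric)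

lemma damped_coeff_le:
  fixes c :: "real \<Rightarrow>\<^sub>C real"
  assumes "x \<le> 1" "0 \<le> x"
  shows "cmod (of_real (c (real j) * (1 / 2) ^ j)) * x \<le> norm c * (1 / 2) ^ j"
proof -
  have "\<bar>c (real j)\<bar> * (1 / 2) ^ j * x \<le> norm c * (1 / 2) ^ j * 1"
    using norm_bounded[of c "real j"] assms by (intro mult_mono) auto
  then show ?thesis by (simp add: norm_mult norm_power abs_mult norm_divide)
qed

lemma damped_bergman1:
  fixes c :: "real \<Rightarrow>\<^sub>C real"
  assumes g: "\<And>j. g j \<in> bergman1" "\<And>j. bergman1_norm (g j) \<le> 1"
  shows "damped_series g c \<in> bergman1" "bergman1_norm (damped_series g c) \<le> 2 * norm c"
    "\<And>z. cmod z < 1 \<Longrightarrow> summable (\<lambda>j. norm (of_real (c (real j) * (1 / 2) ^ j) * g j z))"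
proof -
  have f: "(\<lambda>z. of_real (c (real j) * (1 / 2) ^ j) * g j z) \<in> bergman1" for j
    by (intro bergman1_cmult g)
  have m: "bergman1_norm (\<lambda>z. of_real (c (real j) * (1 / 2) ^ j) * g j z) \<le> norm c * (1 / 2) ^ j" for j
    unfolding bergman1_cmult(2)[OF g(1)] by (intro damped_coeff_le g bergman1_norm_nonneg)
  note ser = bergman1_series[OF f damped_summable m]
  show "damped_series g c \<in> bergman1" "bergman1_norm (damped_series g c) \<le> 2 * norm c"
    using ser(2,3) unfolding damped_suminf damped_series_def[abs_def] by auto
  show "summable (\<lambda>j. norm (of_real (c (real j) * (1 / 2) ^ j) * g j z))" if "cmod z < 1" for z
    by (rule ser(1)[OF that])
qed

lemma damped_little_bloch:
  fixes c :: "real \<Rightarrow>\<^sub>C real"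
  assumes g: "\<And>j. g j \<in> little_bloch" "\<And>j. bloch_norm (g j) \<le> 1"
  shows "damped_series g c \<in> little_bloch" "bloch_norm (damped_series g c) \<le> 2 * norm c"
    "\<And>z. cmod z < 1 \<Longrightarrow> summable (\<lambda>j. norm (of_real (c (real j) * (1 / 2) ^ j) * g j z))"
proof -
  note gb = little_bloch_bloch[OF g(1)]
  have m: "bloch_norm (\<lambda>z. of_real (c (real j) * (1 / 2) ^ j) * g j z) \<le> norm c * (1 / 2) ^ j" for j
    by (rule order_trans[OF bloch_cmult(2)[OF gb]]) (intro damped_coeff_le g bloch_norm_nonneg gb)
  note ser = bloch_series[OF bloch_cmult(1)[OF gb] damped_summable m]
  show "damped_series g c \<in> little_bloch"
    using ser(4) little_bloch_cmult[OF g(1)] unfolding damped_series_def[abs_def] by blast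
  show "bloch_norm (damped_series g c) \<le> 2 * norm c"
    using ser(3) unfolding damped_suminf damped_series_def[abs_def] by auto
  show "summable (\<lambda>j. norm (of_real (c (real j) * (1 / 2) ^ j) * g j z))" if "cmod z < 1" for z
    by (rule ser(1)[OF that])
qed

lemma damped_series_add:
  fixes c d :: "real \<Rightarrow>\<^sub>C real"
  assumes "summable (\<lambda>j. norm (of_real (c (real j) * (1 / 2) ^ j) * g j z))"
    and "summable (\<lambda>j. norm (of_real (d (real j) * (1 / 2) ^ j) * g j z))"
  shows "damped_series g (c + d) z = damped_series g c z + damped_series g d z"
  using suminf_add[OF assms[THEN summable_norm_cancel]]
  by (simp add: damped_series_def algebra_simps)

lemma damped_series_scaleR:
  fixes c :: "real \<Rightarrow>\<^sub>C real"
  assumes "summable (\<lambda>j. norm (of_real (c (real j) * (1 / 2) ^ j) * g j z))"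
  shows "damped_series g (r *\<^sub>R c) z = of_real r * damped_series g c z"
  using suminf_mult[OF assms[THEN summable_norm_cancel], of "of_real r"]
  by (simp add: damped_series_def mult_ac)

text \<open>Coordinate vectors single out one function, scaled by its damping factor. Through them a
  bound on the parameter space speaks about the individual functions.\<close>

lemma damped_series_unit:
  fixes c :: "real \<Rightarrow>\<^sub>C real"
  assumes "\<And>i. apply_bcontfun c (real i) = of_bool (i = j)"
  shows "damped_series g c z = of_real ((1 / 2) ^ j) * g j z"
proof -
  have "(\<lambda>i. if i = j then of_real ((1 / 2) ^ i) * g i z else 0) sums (of_real ((1 / 2) ^ j) * g j z)"
    by (rule sums_single)
  moreover have "(if i = j then of_real ((1 / 2) ^ i) * g i z else 0) = of_real (c (real i) * (1 / 2) ^ i) * g i z" for i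
    by (simp add: assms)
  ultimately show ?thesis by (simp add: damped_series_def sums_iff)
qed

text \<open>Without a bound there are pairs in the unit balls whose values exceed
  \<open>8 ^ j\<close>; they become the terms of two damped series. On the \<open>j\<close>-th
  coordinate vectors the value is damped by \<open>4 ^ j\<close> in total, so the bilinear bound
  would force \<open>2 ^ j < K\<close> for every \<open>j\<close>.\<close>

lemma pairing_uniform_bound:
  fixes a :: "nat \<Rightarrow> nat \<Rightarrow> complex"
  assumes a: "\<And>n. summable (\<lambda>k. norm (a n k))"
    and conv: "\<And>g f. g \<in> bergman1 \<Longrightarrow> f \<in> little_bloch \<Longrightarrow> convergent (\<lambda>n. pairing g (coeff_transform a n f))"
  obtains K where "0 \<le> K"
    "\<And>n g f. g \<in> bergman1 \<Longrightarrow> f \<in> little_bloch \<Longrightarrow> cmod (pairing g (coeff_transform a n f)) \<le> K * bergman1_norm g * bloch_norm f"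
proof -
  let ?B = "\<lambda>n g f. pairing g (coeff_transform a n f)"
  have "\<exists>K. \<forall>n. \<forall>g\<in>bergman1. \<forall>f\<in>little_bloch. bergman1_norm g \<le> 1 \<longrightarrow> bloch_norm f \<le> 1 \<longrightarrow> cmod (?B n g f) \<le> K"
  proof (rule ccontr)
    assume "\<not> ?thesis"
    then have "\<exists>n g f. g \<in> bergman1 \<and> f \<in> little_bloch \<and> bergman1_norm g \<le> 1 \<and> bloch_norm f \<le> 1 \<and> 8 ^ j < cmod (?B n g f)" for j :: nat
      by (meson not_le)
    then obtain N g f where gf: "\<And>j. g j \<in> bergman1" "\<And>j. bergman1_norm (g j) \<le> 1"
      "\<And>j. f j \<in> little_bloch" "\<And>j. bloch_norm (f j) \<le> 1" and big: "\<And>j. 8 ^ j < cmod (?B (N j) (g j) (f j))"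
      by metis
    note G = damped_bergman1[of g, OF gf(1,2)] and F = damped_little_bloch[of f, OF gf(3,4)]
    let ?G = "damped_series g" and ?F = "damped_series f"
    note Fb = little_bloch_bloch[OF F(1)]
    note T = coeff_transform_bergman1[OF a G(1)] and T' = little_bloch_bloch[OF coeff_transform_bloch(1)[OF a Fb]]
    define \<beta> where "\<beta> n c d = ?B n (?G c) (?F d)" for n and c d :: "real \<Rightarrow>\<^sub>C real"
    \<comment> \<open>For linearity in the second argument the multiplier is moved to the first one,
      so that only linearity of \<open>pairing\<close> and of \<open>damped_series\<close>
      enters.\<close>
    have \<beta>': "\<beta> n c d = pairing (coeff_transform a n (?G c)) (?F d)" for n c d
      unfolding \<beta>_def by (rule pairing_coeff_transform[where a=a and n=n, OF a G(1) Fb, symmetric])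
    have bil: "bounded_bilinear (\<beta> n)" for n
    proof
      fix c c' d d' and r :: real
      show "\<beta> n (c + c') d = \<beta> n c d + \<beta> n c' d"
        unfolding \<beta>_def pairing_add_left[OF G(1) G(1) T', symmetric]
        by (rule pairing_cong) (use G T' damped_series_add in \<open>auto intro: bergman1_add\<close>)
      show "\<beta> n c (d + d') = \<beta> n c d + \<beta> n c d'"
        unfolding \<beta>' pairing_add_right[OF T Fb Fb, symmetric]
        by (rule pairing_cong) (use F Fb T damped_series_add in \<open>auto intro: bloch_add\<close>)
      show "\<beta> n (r *\<^sub>R c) d = r *\<^sub>R \<beta> n c d"
        unfolding \<beta>_def scaleR_conv_of_real pairing_cmult_left[OF G(1) T', symmetric]
        by (rule pairing_cong) (use G T' damped_series_scaleR in \<open>auto intro: bergman1_cmult\<close>)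
      show "\<beta> n c (r *\<^sub>R d) = r *\<^sub>R \<beta> n c d"
        unfolding \<beta>' scaleR_conv_of_real pairing_cmult_right[OF T Fb, symmetric]
        by (rule pairing_cong) (use F Fb T damped_series_scaleR in \<open>auto intro: bloch_cmult\<close>)
      let ?A = "\<Sum>k. norm (a n k)"
      have A: "0 \<le> ?A" by (intro suminf_nonneg a) auto
      have "norm (\<beta> n c d) \<le> norm c * norm d * (12 * ?A)" for c d
      proof -
        have "norm (\<beta> n c d) \<le> 3 * bergman1_norm (?G c) * bloch_norm (coeff_transform a n (?F d))"
          unfolding \<beta>_def by (rule pairing_bound[OF G(1) T'])
        also have "\<dots> \<le> 3 * (2 * norm c) * (?A * (2 * norm d))"
        proof (intro mult_mono G(2) order_refl)
          show "bloch_norm (coeff_transform a n (?F d)) \<le> ?A * (2 * norm d)"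
            using coeff_transform_bloch(2)[where a=a and n=n, OF a Fb[of d]] mult_left_mono[OF F(2)[of d] A] by linarith
        qed (auto intro: bergman1_norm_nonneg G bloch_norm_nonneg T')
        finally show ?thesis by (simp add: mult_ac)
      qed
      then show "\<exists>K. \<forall>c d. norm (\<beta> n c d) \<le> norm c * norm d * K" by blast
    qed
    have "\<exists>M. \<forall>n. norm (\<beta> n c d) \<le> M" for c d
      using convergent_imp_Bseq[OF conv[OF G(1) F(1)]] unfolding \<beta>_def Bseq_def by blast
    from bilinear_uniform_boundedness[of \<beta>, OF bil this]
    obtain K where K: "\<And>n c d. norm (\<beta> n c d) \<le> K * norm c * norm d" by blast
    have "2 ^ j < K" for j :: nat
    proof -
      \<comment> \<open>A tent of height one at \<open>j\<close> that vanishes at all other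
        integers: sampled at the natural numbers it is the \<open>j\<close>-th coordinate
        vector.\<close>
      define h where "h x = max 0 (1 - \<bar>x - real j\<bar>)" for x
      define e where "e = Bcontfun h"
      have "h \<in> bcontfun"
        by (rule bcontfun_normI[where b=1]) (auto simp: h_def intro!: continuous_intros)
      then have eh: "apply_bcontfun e x = h x" for x
        by (simp add: e_def Bcontfun_inverse)
      then have e: "apply_bcontfun e (real i) = of_bool (i = j)" for i
        by (auto simp: h_def max_def abs_if)
      have e1: "norm e \<le> 1" by (rule norm_bound) (simp add: eh h_def)
      have e2: "1 \<le> norm e" using norm_bounded[of e "real j"] by (simp add: e)
      have "\<beta> (N j) e e = pairing (coeff_transform a (N j) (?G e)) (\<lambda>z. of_real ((1 / 2) ^ j) * f j z)"
        unfolding \<beta>' by (intro arg_cong2[where f=pairing] ext refl damped_series_unit e)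
      also have "\<dots> = of_real ((1 / 2) ^ j) * pairing (coeff_transform a (N j) (?G e)) (f j)"
        by (intro pairing_cmult_right T little_bloch_bloch gf)
      also have "pairing (coeff_transform a (N j) (?G e)) (f j) = ?B (N j) (?G e) (f j)"
        by (intro pairing_coeff_transform a G little_bloch_bloch gf)
      also have "\<dots> = ?B (N j) (\<lambda>z. of_real ((1 / 2) ^ j) * g j z) (f j)"
        by (intro arg_cong2[where f=pairing] ext refl damped_series_unit e)
      also have "\<dots> = of_real ((1 / 2) ^ j) * ?B (N j) (g j) (f j)"
        by (intro pairing_cmult_left gf little_bloch_bloch coeff_transform_bloch a)
      finally have "norm (\<beta> (N j) e e) = (1 / 4) ^ j * cmod (?B (N j) (g j) (f j))"
        by (simp add: norm_mult norm_power norm_divide power_divide flip: power_mult_distrib)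
      moreover have "(1 / 4) ^ j * 8 ^ j < (1 / 4) ^ j * cmod (?B (N j) (g j) (f j))"
        by (intro mult_strict_left_mono big) auto
      moreover have "(1 / 4) ^ j * 8 ^ j = (2 :: real) ^ j"
        by (simp flip: power_mult_distrib)
      moreover have "norm e = 1" using e1 e2 by simp
      ultimately show ?thesis using K[of "N j" e e] by simp
    qed
    then show False using real_arch_pow[of 2 K] by (meson not_less_iff_gr_or_eq one_less_numeral_iff semiring_norm(76))
  qed
  then obtain K where K: "\<And>n g f. g \<in> bergman1 \<Longrightarrow> f \<in> little_bloch \<Longrightarrow> bergman1_norm g \<le> 1 \<Longrightarrow> bloch_norm f \<le> 1 \<Longrightarrow> cmod (?B n g f) \<le> K"
    by blast
  have "cmod (?B n g f) \<le> \<bar>K\<bar> * bergman1_norm g * bloch_norm f" if g: "g \<in> bergman1" and f: "f \<in> little_bloch" for n g f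
  proof -
    note fb = little_bloch_bloch[OF f] and sym = pairing_coeff_transform[where a=a and n=n, OF a]
    note tf = little_bloch_bloch[OF coeff_transform_bloch(1)[where a=a and n=n, OF a fb]]
    define s t where "s = bergman1_norm g" and "t = bloch_norm f"
    have T: "?B n (\<lambda>z. of_real x * g z) (\<lambda>z. of_real y * f z) = of_real x * (of_real y * ?B n g f)" for x y
      using pairing_cmult_left[OF g] pairing_cmult_right[OF coeff_transform_bergman1[where a=a and n=n, OF a g] fb, of "of_real y"]
        sym[OF g fb] sym[OF g bloch_cmult(1)[OF fb]] tf little_bloch_bloch[OF coeff_transform_bloch(1)[where a=a and n=n, OF a bloch_cmult(1)[OF fb]]]
      by simp
    show ?thesis
    \<comment> \<open>Arguments of norm zero cannot be normalised; there the two pairing bounds, one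
      for each position of the multiplier, force the value to vanish.\<close>
    proof (cases "s = 0 \<or> t = 0")
      case True
      have "cmod (?B n g f) \<le> 3 * s * bloch_norm (coeff_transform a n f)"
        unfolding s_def by (rule pairing_bound[OF g tf])
      moreover have "cmod (?B n g f) \<le> 3 * bergman1_norm (coeff_transform a n g) * t"
        unfolding t_def sym[OF g fb, symmetric]
        by (rule pairing_bound[OF coeff_transform_bergman1[where a=a and n=n, OF a g] fb])
      ultimately show ?thesis using True by (auto simp: s_def t_def)
    next
      case False
      then have st: "0 < s" "0 < t"
        using bergman1_norm_nonneg[OF g] bloch_norm_nonneg[OF fb] by (auto simp: s_def t_def less_le)
      have "bloch_norm (\<lambda>z. of_real (1 / t) * f z) \<le> cmod (of_real (1 / t)) * t"
        unfolding t_def by (rule bloch_cmult[OF fb])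
      moreover have "bergman1_norm (\<lambda>z. of_real (1 / s) * g z) = cmod (of_real (1 / s)) * s"
        unfolding s_def by (rule bergman1_cmult[OF g])
      ultimately have "cmod (?B n (\<lambda>z. of_real (1 / s) * g z) (\<lambda>z. of_real (1 / t) * f z)) \<le> K"
        using st by (intro K bergman1_cmult(1) g little_bloch_cmult f) (simp_all add: norm_divide)
      then have "cmod (?B n g f) \<le> K * s * t"
        unfolding T using st by (simp add: norm_mult norm_divide field_simps)
      also have "\<dots> \<le> \<bar>K\<bar> * s * t" using st by (intro mult_right_mono) auto
      finally show ?thesis by (simp add: s_def t_def)
    qed
  qed
  then show ?thesis by (intro that[of "\<bar>K\<bar>"]) auto
qed

subsection \<open>Density and norm convergence\<close>

text \<open>Dilation is written as the multiplier with entries \<open>r ^ k\<close>, so that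
  membership in the spaces and Taylor coefficients come from the general multiplier lemmas.\<close>

definition dilate :: "real \<Rightarrow> (complex \<Rightarrow> complex) \<Rightarrow> complex \<Rightarrow> complex" where
  "dilate r = coeff_transform (\<lambda>_ k. of_real r ^ k) 0"

lemma dilate_summable: "0 < r \<Longrightarrow> r < 1 \<Longrightarrow> summable (\<lambda>k. norm (complex_of_real r ^ k))"
  by (simp add: norm_power)

lemma dilate_eq:
  assumes g: "g holomorphic_on ball 0 1" and r: "0 < r" "r < 1" and z: "cmod z < 1"
  shows "dilate r g z = g (of_real r * z)"
proof -
  have "cmod (of_real r * z) < 1" using mult_less_one_disc[of r z] r z by (simp add: norm_mult)
  from taylor_sums[OF g this]
  have "(\<lambda>k. (of_real r ^ k * taylor_coeff g k) * z ^ k) sums g (of_real r * z)"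
    by (simp add: power_mult_distrib mult_ac)
  with coeff_transform_sums[where a="\<lambda>_ k. of_real r ^ k" and n=0, OF dilate_summable[OF r] g z]
  show ?thesis unfolding dilate_def by (rule sums_unique2)
qed

lemma taylor_coeff_dilate:
  "g holomorphic_on ball 0 1 \<Longrightarrow> 0 < r \<Longrightarrow> r < 1 \<Longrightarrow> taylor_coeff (dilate r g) k = of_real r ^ k * taylor_coeff g k"
  unfolding dilate_def by (rule taylor_coeff_coeff_transform) (simp_all add: norm_power)

lemma nn_integral_dilate_le:
  fixes f :: "complex \<Rightarrow> ennreal"
  assumes f: "f \<in> borel_measurable disc" and r: "0 < r" "r < 1"
  shows "(\<integral>\<^sup>+z. ennreal (r\<^sup>2) * f (of_real r * z) \<partial>disc) \<le> (\<integral>\<^sup>+z. f z \<partial>disc)"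
proof -
  define F where "F z = f z * indicator (ball 0 1) z" for z
  have F [measurable]: "F \<in> borel_measurable borel"
    unfolding F_def using f by (simp add: measurable_disc_cong borel_measurable_restrict_space_iff_ennreal)
  have [measurable]: "(\<lambda>z. of_real r * z) \<in> borel_measurable (borel :: complex measure)"
    by (intro borel_measurable_continuous_onI continuous_intros)
  have "(\<integral>\<^sup>+z. ennreal (r\<^sup>2) * f (of_real r * z) \<partial>disc) = (\<integral>\<^sup>+z. ennreal (r\<^sup>2) * f (of_real r * z) * indicator (ball 0 1) z \<partial>lborel)"
    unfolding disc_def by (subst nn_integral_restrict_space) auto
  also have "\<dots> \<le> (\<integral>\<^sup>+z. ennreal (r\<^sup>2) * F (of_real r * z) \<partial>lborel)"
    using mult_less_one_disc[of r] r
    by (intro nn_integral_mono) (auto simp: F_def indicator_def norm_mult)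
  also have "\<dots> = (\<integral>\<^sup>+z. F z \<partial>lborel)"
    by (subst (2) lborel_affine[of r 0])
       (use r in \<open>simp_all add: nn_integral_density nn_integral_distr scaleR_conv_of_real\<close>)
  also have "\<dots> = (\<integral>\<^sup>+z. f z \<partial>disc)"
    unfolding disc_def F_def by (subst nn_integral_restrict_space) auto
  finally show ?thesis .
qed

text \<open>The factor \<open>r\<^sup>2\<close> is the Jacobian of the dilation: it makes Scheffe's lemma applicable.\<close>
lemma bergman1_dense:
  assumes g: "g \<in> bergman1" and e: "0 < e"
  obtains p where "p \<in> bergman1" "summable (\<lambda>k. norm (taylor_coeff p k))" "bergman1_norm (\<lambda>z. p z - g z) < e"
proof -
  note gh = bergman1_holomorphic[OF g]
  define r where "r n = 1 - 1 / real (n + 2)" for n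
  have r: "0 < r n" "r n < 1" for n by (auto simp: r_def)
  have r_lim: "r \<longlonglongrightarrow> 1"
  proof -
    have "(\<lambda>n. 1 - inverse (real (Suc (Suc n)))) \<longlonglongrightarrow> 1 - 0"
      by (intro tendsto_intros LIMSEQ_Suc[OF LIMSEQ_inverse_real_of_nat])
    then show ?thesis by (simp add: r_def[abs_def] inverse_eq_divide)
  qed
  define p where "p n = (\<lambda>z. of_real ((r n)\<^sup>2) * dilate (r n) g z)" for n
  have p1: "p n \<in> bergman1" for n
    unfolding p_def dilate_def
    by (intro bergman1_cmult coeff_transform_bergman1 dilate_summable r g)
  have p_eq: "p n z = of_real ((r n)\<^sup>2) * g (of_real (r n) * z)" if "cmod z < 1" for n z
    unfolding p_def dilate_eq[OF gh r that] ..
  have gi: "integrable disc g" by (rule bergman1_integrable[OF g])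
  have "(\<lambda>n. \<integral>\<^sup>+z. ennreal (norm (p n z - g z)) \<partial>disc) \<longlonglongrightarrow> 0"
  proof (rule Scheffe_lemma2[OF _ gi])
    show "p n \<in> borel_measurable disc" for n using bergman1_integrable[OF p1] by auto
    show "AE z in disc. (\<lambda>n. p n z) \<longlonglongrightarrow> g z"
    proof (rule AE_I2)
      fix z assume "z \<in> space disc"
      then have z: "cmod z < 1" by simp
      have "isCont g (of_real 1 * z)"
        using z by (intro holomorphic_disc_isCont[OF gh]) simp
      then have "(\<lambda>n. g (of_real (r n) * z)) \<longlonglongrightarrow> g (of_real 1 * z)"
        by (rule isCont_tendsto_compose) (intro tendsto_intros r_lim)
      then have "(\<lambda>n. of_real ((r n)\<^sup>2) * g (of_real (r n) * z)) \<longlonglongrightarrow> of_real (1\<^sup>2) * g (of_real 1 * z)"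
        by (intro tendsto_intros r_lim)
      then show "(\<lambda>n. p n z) \<longlonglongrightarrow> g z" by (simp add: p_eq[OF z])
    qed
    fix n
    have "(\<integral>\<^sup>+z. ennreal (norm (p n z)) \<partial>disc) = (\<integral>\<^sup>+z. ennreal ((r n)\<^sup>2) * ennreal (norm (g (of_real (r n) * z))) \<partial>disc)"
      by (intro nn_integral_cong) (simp add: p_eq norm_mult norm_power flip: ennreal_mult)
    also have "\<dots> \<le> (\<integral>\<^sup>+z. ennreal (norm (g z)) \<partial>disc)"
      by (rule nn_integral_dilate_le[OF _ r]) (use gi in auto)
    finally show "(\<integral>\<^sup>+z. ennreal (norm (p n z)) \<partial>disc) \<le> (\<integral>\<^sup>+z. ennreal (norm (g z)) \<partial>disc)" .
  qed
  moreover have "(\<integral>\<^sup>+z. ennreal (norm (p n z - g z)) \<partial>disc) = ennreal (pi * bergman1_norm (\<lambda>z. p n z - g z))" for n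
    using bergman1_diff[OF p1 g, of n]
    by (subst nn_integral_eq_integral) (auto simp: bergman1_norm_eq bergman1_iff)
  ultimately have "(\<lambda>n. ennreal (pi * bergman1_norm (\<lambda>z. p n z - g z))) \<longlonglongrightarrow> ennreal 0" by simp
  then have "(\<lambda>n. pi * bergman1_norm (\<lambda>z. p n z - g z)) \<longlonglongrightarrow> 0"
    by (subst (asm) tendsto_ennreal_iff) (auto intro!: always_eventually mult_nonneg_nonneg bergman1_norm_nonneg bergman1_diff p1 g)
  then have "\<forall>\<^sub>F n in sequentially. pi * bergman1_norm (\<lambda>z. p n z - g z) < pi * e"
    by (rule order_tendstoD) (use e in auto)
  then obtain n where n: "bergman1_norm (\<lambda>z. p n z - g z) < e"
    using eventually_happens'[OF sequentially_bot] by (auto simp del: mult_less_cancel_left simp: mult_less_cancel_left_pos)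
  have "taylor_coeff (p n) k = of_real ((r n)\<^sup>2) * (of_real (r n) ^ k * taylor_coeff g k)" for k
  proof (rule taylor_coeff_unique)
    fix z :: complex assume z: "cmod z < 1"
    have "(\<lambda>k. of_real ((r n)\<^sup>2) * (taylor_coeff (dilate (r n) g) k * z ^ k)) sums (of_real ((r n)\<^sup>2) * dilate (r n) g z)"
      unfolding dilate_def
      by (intro sums_mult taylor_sums z bergman1_holomorphic coeff_transform_bergman1 dilate_summable r g)
    then show "(\<lambda>k. of_real ((r n)\<^sup>2) * (of_real (r n) ^ k * taylor_coeff g k) * z ^ k) sums p n z"
      by (simp add: p_def taylor_coeff_dilate[OF gh r] mult_ac)
  qed
  then have "norm (taylor_coeff (p n) k) = (r n)\<^sup>2 * (norm (taylor_coeff g k) * r n ^ k)" for k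
    using r[of n] by (simp add: norm_mult norm_power)
  then have "summable (\<lambda>k. norm (taylor_coeff (p n) k))"
    using taylor_abs_summable[OF gh, of "r n"] r[of n] by (simp add: summable_mult)
  from that[OF p1 this n] show ?thesis .
qed

lemma deriv_dilate:
  assumes f: "f holomorphic_on ball 0 1" and r: "0 < r" "r < 1" and z: "cmod z < 1"
  shows "deriv (dilate r f) z = of_real r * deriv f (of_real r * z)"
proof -
  have rz: "cmod (of_real r * z) < 1" using mult_less_one_disc[of r z] r z by (simp add: norm_mult)
  have "deriv (dilate r f) z = deriv (\<lambda>z. f (of_real r * z)) z"
    by (rule deriv_cong_disc[OF dilate_eq[OF f r] z])
  also have "\<dots> = of_real r * deriv f (of_real r * z)"
  proof (rule DERIV_imp_deriv)
    have "(f has_field_derivative deriv f (of_real r * z)) (at (of_real r * z))"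
      by (rule holomorphic_derivI[OF f]) (use rz in auto)
    from DERIV_chain2[where f=f and g="\<lambda>z. of_real r * z" and x=z and Db="of_real r" and s=UNIV, OF this]
    moreover have "((\<lambda>z. of_real r * z) has_field_derivative of_real r) (at z)"
      by (auto intro!: derivative_eq_intros)
    ultimately show "((\<lambda>z. f (of_real r * z)) has_field_derivative of_real r * deriv f (of_real r * z)) (at z)"
      by (simp add: mult.commute)
  qed
  finally show ?thesis .
qed

text \<open>For dilations near the identity the derivatives differ little on a compact disc by
  uniform continuity jointly in \<open>(r, z)\<close>; near the boundary both weighted derivatives
  are small. The weight \<open>k + 1\<close> in the summability is the bound later used for the
  Bloch norm of \<open>z ^ k\<close>.\<close>

lemma little_bloch_dense:
  assumes f: "f \<in> little_bloch" and e: "0 < e"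
  obtains p where "p \<in> little_bloch" "summable (\<lambda>k. (k + 1) * norm (taylor_coeff p k))" "bloch_norm (\<lambda>z. p z - f z) < e"
proof -
  note fb = little_bloch_bloch[OF f]
  note fh = bloch_holomorphic[OF fb]
  have e4: "0 < e / 4" using e by simp
  obtain \<rho>0 where \<rho>0: "\<rho>0 < 1" "\<And>z. \<rho>0 < cmod z \<Longrightarrow> cmod z < 1 \<Longrightarrow> (1 - (cmod z)\<^sup>2) * cmod (deriv f z) < e / 4"
    using little_blochE[OF f e4] by blast
  define \<rho> where "\<rho> = max \<rho>0 0"
  have \<rho>: "0 \<le> \<rho>" "\<rho> < 1" "\<And>z. \<rho> < cmod z \<Longrightarrow> cmod z < 1 \<Longrightarrow> (1 - (cmod z)\<^sup>2) * cmod (deriv f z) < e / 4"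
    using \<rho>0 by (auto simp: \<rho>_def)
  \<comment> \<open>Midway between \<rho> and one. This leaves room for a dilation factor
    \<open>r < 1\<close> with \<open>\<rho> \<le> r * \<sigma>\<close>, so that points beyond
    \<sigma> remain beyond \<rho> after dilation.\<close>
  define \<sigma> where "\<sigma> = (1 + \<rho>) / 2"
  have \<sigma>: "\<rho> < \<sigma>" "0 < \<sigma>" "\<sigma> < 1" using \<rho> by (auto simp: \<sigma>_def)
  let ?U = "\<lambda>p. of_real (fst p) * deriv f (of_real (fst p) * snd p)"
  let ?K = "{0..1::real} \<times> cball (0::complex) \<sigma>"
  have "continuous_on ?K ?U"
  proof (intro continuous_intros continuous_on_compose2[OF holomorphic_on_imp_continuous_on[OF deriv_holomorphic_disc[OF fh]]])
    show "(\<lambda>p. complex_of_real (fst p) * snd p) ` ?K \<subseteq> ball 0 1"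
      using mult_less_one_disc \<sigma> by (force simp: norm_mult)
  qed
  then have "uniformly_continuous_on ?K ?U"
    by (rule compact_uniformly_continuous) (intro compact_Times compact_Icc compact_cball)
  then obtain d where d: "0 < d" "\<And>p q. p \<in> ?K \<Longrightarrow> q \<in> ?K \<Longrightarrow> dist q p < d \<Longrightarrow> dist (?U q) (?U p) < e / 4"
    using e4 unfolding uniformly_continuous_on_def by metis
  \<comment> \<open>The three lower bounds provide positivity, \<open>1 - r < d\<close>, and
    \<open>\<rho> \<le> r * \<sigma>\<close>.\<close>
  define r where "r = max (max (1 / 2) (1 - d / 2)) (\<rho> / \<sigma>)"
  have r: "0 < r" "r < 1" "1 - r < d" "\<rho> \<le> r * \<sigma>"
  proof -
    have "1 / 2 \<le> r" "1 - d / 2 \<le> r" "\<rho> / \<sigma> \<le> r" unfolding r_def by (simp_all only: max.coboundedI1 max.coboundedI2 order_refl max.cobounded1 max.cobounded2)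
    then show "0 < r" "1 - r < d" "\<rho> \<le> r * \<sigma>" using d(1) \<sigma> by (auto simp: pos_divide_le_eq)
    show "r < 1" using d(1) \<sigma> by (simp add: r_def)
  qed
  let ?p = "dilate r f"
  have p: "?p \<in> little_bloch" unfolding dilate_def by (intro coeff_transform_bloch dilate_summable r fb)
  have diff: "(\<lambda>z. ?p z - f z) holomorphic_on ball 0 1"
    by (intro holomorphic_intros fh bloch_holomorphic little_bloch_bloch p)
  have "bloch_seminorm (\<lambda>z. ?p z - f z) \<le> e / 2"
  proof (rule blochI(2)[OF diff])
    fix z :: complex assume z: "cmod z < 1"
    note pos = one_minus_sq_pos[OF z]
    have rz: "cmod (of_real r * z) \<le> cmod z" using r by (simp add: norm_mult mult_left_le_one_le)
    have dd: "deriv (\<lambda>z. ?p z - f z) z = of_real r * deriv f (of_real r * z) - deriv f z"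
      unfolding deriv_dilate[OF fh r(1,2) z, symmetric]
      by (intro deriv_diff holomorphic_disc_field_differentiable z fh bloch_holomorphic little_bloch_bloch p)
    show "(1 - (cmod z)\<^sup>2) * cmod (deriv (\<lambda>z. ?p z - f z) z) \<le> e / 2"
    proof (cases "cmod z \<le> \<sigma>")
      case True
      have "dist (?U (r, z)) (?U (1, z)) < e / 4"
        by (rule d) (use True r in \<open>auto simp: dist_Pair_Pair dist_real_def\<close>)
      then have "cmod (of_real r * deriv f (of_real r * z) - deriv f z) \<le> e / 4"
        by (simp add: dist_norm)
      from mult_mono[of "1 - (cmod z)\<^sup>2" 1, OF _ this] show ?thesis
        unfolding dd using e by simp
    next
      case False
      have "r * \<sigma> < r * cmod z" using False r(1) by simp
      with r(4) have "\<rho> < r * cmod z" by (rule le_less_trans)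
      then have "\<rho> < cmod (of_real r * z)" using r(1) by (simp add: norm_mult)
      then have 1: "(1 - (cmod (of_real r * z))\<^sup>2) * cmod (deriv f (of_real r * z)) < e / 4"
        using rz z by (intro \<rho>) auto
      have "(1 - (cmod z)\<^sup>2) * cmod (of_real r * deriv f (of_real r * z)) \<le> (1 - (cmod (of_real r * z))\<^sup>2) * cmod (deriv f (of_real r * z))"
        using power_mono[OF rz, of 2] less_imp_le[OF one_minus_sq_pos[OF le_less_trans[OF rz z]]] r by (intro mult_mono) (auto simp: norm_mult mult_left_le_one_le)
      moreover have "(1 - (cmod z)\<^sup>2) * cmod (deriv f z) < e / 4"
        using False \<sigma> z by (intro \<rho>) auto
      moreover have "(1 - (cmod z)\<^sup>2) * cmod (of_real r * deriv f (of_real r * z) - deriv f z)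
        \<le> (1 - (cmod z)\<^sup>2) * (cmod (of_real r * deriv f (of_real r * z)) + cmod (deriv f z))"
        using pos by (intro mult_left_mono norm_triangle_ineq4) auto
      ultimately show ?thesis unfolding dd using 1 by (simp add: distrib_left)
    qed
  qed
  moreover have "?p 0 = f 0" using dilate_eq[OF fh r(1,2), of 0] by simp
  ultimately have n: "bloch_norm (\<lambda>z. ?p z - f z) < e" using e by (simp add: bloch_norm_eq)
  \<comment> \<open>The coefficients of \<open>bloch_kernel f\<close> carry the factor
    \<open>k + 2\<close>, which absorbs the required weight \<open>k + 1\<close>.\<close>
  have "summable (\<lambda>k. norm (taylor_coeff (bloch_kernel f) k) * r ^ k)"
    by (rule taylor_abs_summable[OF bloch_kernel_holomorphic[OF fh]]) (use r in auto)
  then have "summable (\<lambda>k. (k + 1) * norm (taylor_coeff ?p k))"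
  proof (rule summable_comparison_test'[where N=0])
    fix k
    have "real (k + 1) * (norm (taylor_coeff f k) * r ^ k) \<le> real (k + 2) * (norm (taylor_coeff f k) * r ^ k)"
      using r by (intro mult_right_mono) auto
    then show "norm ((k + 1) * norm (taylor_coeff ?p k)) \<le> norm (taylor_coeff (bloch_kernel f) k) * r ^ k"
      unfolding taylor_coeff_bloch_kernel[OF fh] taylor_coeff_dilate[OF fh r(1,2)] norm_mult norm_of_nat norm_power
      using r by (simp add: mult_ac)
  qed
  from that[OF p this n] show ?thesis .
qed

text \<open>Dominated convergence for series, with \<open>(C + 1) * w k\<close> dominating uniformly
  in \<open>n\<close>. The weights will be coefficients of an approximant times a bound on the norms
  of monomials.\<close>

lemma multiplier_error_tendsto:
  fixes a :: "nat \<Rightarrow> nat \<Rightarrow> complex" and w :: "nat \<Rightarrow> real"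
  assumes lim: "\<And>k. (\<lambda>n. a n k) \<longlonglongrightarrow> 1" and bound: "\<And>n k. norm (a n k) \<le> C"
    and w: "summable w" "\<And>k. 0 \<le> w k"
  shows "\<And>n. summable (\<lambda>k. norm (a n k - 1) * w k)"
    and "(\<lambda>n. \<Sum>k. norm (a n k - 1) * w k) \<longlonglongrightarrow> 0"
proof -
  have le: "norm (norm (a n k - 1) * w k) \<le> (C + 1) * w k" for n k
    using norm_triangle_ineq4[of "a n k" 1] bound[of n k] w(2)[of k] by (auto simp: abs_mult intro!: mult_right_mono)
  show "summable (\<lambda>k. norm (a n k - 1) * w k)" for n
    by (rule summable_comparison_test'[OF summable_mult[OF w(1), of "C + 1"], of 0]) (rule le)
  have "(\<lambda>n. norm (a n k - 1) * w k) \<longlonglongrightarrow> norm (1 - 1 :: complex) * w k" for k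
    by (intro tendsto_intros lim)
  then have lim0: "(\<lambda>n. norm (a n k - 1) * w k) \<longlonglongrightarrow> 0" for k by simp
  have "\<forall>\<^sub>F (k, n) in at_top \<times>\<^sub>F sequentially. norm (norm (a n k - 1) * w k) \<le> (C + 1) * w k"
    by (rule always_eventually) (use le in auto)
  from tannerys_theorem[OF lim0 this summable_mult[OF w(1)]]
  show "(\<lambda>n. \<Sum>k. norm (a n k - 1) * w k) \<longlonglongrightarrow> 0" by simp
qed

lemma coeff_transform_minus_id:
  assumes a: "summable (\<lambda>k. norm (a n k))" and g: "g holomorphic_on ball 0 1" and z: "cmod z < 1"
  shows "coeff_transform a n g z - g z = (\<Sum>k. (a n k - 1) * taylor_coeff g k * z ^ k)"
  using sums_diff[OF coeff_transform_sums[where a=a and n=n, OF a g z] taylor_sums[OF g z]]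
  by (simp add: sums_iff algebra_simps)

lemma coeff_transform_diff:
  assumes a: "summable (\<lambda>k. norm (a n k))" and g: "g holomorphic_on ball 0 1" and h: "h holomorphic_on ball 0 1" and z: "cmod z < 1"
  shows "coeff_transform a n (\<lambda>z. g z - h z) z = coeff_transform a n g z - coeff_transform a n h z"
proof -
  have c: "taylor_coeff (\<lambda>z. g z - h z) k = taylor_coeff g k - taylor_coeff h k" for k
    by (rule taylor_coeff_unique) (use sums_diff[OF taylor_sums[OF g] taylor_sums[OF h]] in \<open>auto simp: algebra_simps\<close>)
  have gh: "(\<lambda>z. g z - h z) holomorphic_on ball 0 1" by (intro holomorphic_intros g h)
  show ?thesis
    using coeff_transform_sums[where a=a and n=n, OF a gh z]
      sums_diff[OF coeff_transform_sums[where a=a and n=n, OF a g z] coeff_transform_sums[where a=a and n=n, OF a h z]]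
    unfolding c by (simp add: sums_iff algebra_simps)
qed

lemma tendsto_zeroI_approx:
  fixes x :: "nat \<Rightarrow> real"
  assumes "\<And>n. 0 \<le> x n" and C: "0 < C"
    and approx: "\<And>e. 0 < e \<Longrightarrow> \<exists>y. y \<longlonglongrightarrow> 0 \<and> (\<forall>n. x n \<le> C * e + y n)"
  shows "x \<longlonglongrightarrow> 0"
proof (rule LIMSEQ_I)
  fix e :: real assume e: "0 < e"
  obtain y where y: "y \<longlonglongrightarrow> 0" "\<And>n. x n \<le> C * (e / (2 * C)) + y n"
    using approx[of "e / (2 * C)"] e C by auto
  have "\<forall>\<^sub>F n in sequentially. y n < e / 2" by (rule order_tendstoD[OF y(1)]) (use e in auto)
  then obtain N where N: "\<And>n. N \<le> n \<Longrightarrow> y n < e / 2" by (auto simp: eventually_sequentially)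
  have "norm (x n - 0) < e" if "N \<le> n" for n
    using y(2)[of n] N[OF that] assms(1)[of n] C by simp
  then show "\<exists>N. \<forall>n\<ge>N. norm (x n - 0) < e" by blast
qed

lemma bergman1_norm_monomial_le_1: "bergman1_norm (\<lambda>z. z ^ k) \<le> 1"
proof -
  have "(\<integral>z. cmod z ^ k \<partial>disc) \<le> (\<integral>z. 1 \<partial>disc)"
    by (rule integral_mono[OF integrable_disc_power]) (auto simp: power_le_one)
  then show ?thesis by (simp add: monomial_bergman1 measure_def emeasure_disc_space)
qed

text \<open>A crude bound, as these norms are in fact bounded; linear growth is harmless because
  coefficients of dilated functions decay geometrically.\<close>

lemma bloch_norm_power_le: "bloch_norm (\<lambda>z. z ^ k) \<le> k + 1"
proof -
  have "bloch_seminorm (\<lambda>z. 1 * z ^ k) \<le> k"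
  proof (rule blochI(2))
    fix z :: complex assume z: "cmod z < 1"
    have "(1 - (cmod z)\<^sup>2) * (real k * cmod z ^ (k - 1)) \<le> 1 * (real k * 1)"
      using z by (intro mult_mono) (auto simp: power_le_one mult_le_one)
    then show "(1 - (cmod z)\<^sup>2) * cmod (deriv (\<lambda>z. 1 * z ^ k) z) \<le> k"
      unfolding deriv_monomial by (simp add: norm_mult norm_power)
  qed (intro holomorphic_intros)
  moreover have "cmod (0 ^ k) \<le> 1" by (simp add: norm_power power_le_one)
  ultimately show ?thesis by (simp add: bloch_norm_eq)
qed

lemma coeff_transform_tendsto_bergman1:
  fixes a :: "nat \<Rightarrow> nat \<Rightarrow> complex"
  assumes a: "\<And>n. summable (\<lambda>k. norm (a n k))"
    and lim: "\<And>k. (\<lambda>n. a n k) \<longlonglongrightarrow> 1" and bound: "\<And>n k. norm (a n k) \<le> C"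
    and T: "\<And>n g. g \<in> bergman1 \<Longrightarrow> bergman1_norm (coeff_transform a n g) \<le> K * bergman1_norm g" and K: "0 \<le> K"
    and g: "g \<in> bergman1"
  shows "(\<lambda>n. bergman1_norm (\<lambda>z. coeff_transform a n g z - g z)) \<longlonglongrightarrow> 0"
proof (rule tendsto_zeroI_approx[where C="K + 1"])
  note Tg = coeff_transform_bergman1[where a=a, OF a]
  show "0 \<le> bergman1_norm (\<lambda>z. coeff_transform a n g z - g z)" for n
    by (intro bergman1_norm_nonneg bergman1_diff Tg g)
  fix e :: real assume "0 < e"
  then obtain p where p: "p \<in> bergman1" "summable (\<lambda>k. norm (taylor_coeff p k))" "bergman1_norm (\<lambda>z. p z - g z) < e"
    using bergman1_dense[OF g] by blast
  note ph = bergman1_holomorphic[OF p(1)] and gh = bergman1_holomorphic[OF g]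
  note err = multiplier_error_tendsto[where a=a, OF lim bound p(2) norm_ge_zero]
  let ?y = "\<lambda>n. \<Sum>k. norm (a n k - 1) * norm (taylor_coeff p k)"
  have y: "bergman1_norm (\<lambda>z. coeff_transform a n p z - p z) \<le> ?y n" for n
  proof -
    have "bergman1_norm (\<lambda>z. coeff_transform a n p z - p z) = bergman1_norm (\<lambda>z. \<Sum>k. (a n k - 1) * taylor_coeff p k * z ^ k)"
      by (rule bergman1_norm_cong) (rule coeff_transform_minus_id[where a=a and n=n, OF a ph])
    also have "\<dots> \<le> ?y n"
    proof (rule bergman1_series(3)[OF bergman1_cmult(1)[OF monomial_bergman1(1)] err(1)])
      show "bergman1_norm (\<lambda>z. (a n k - 1) * taylor_coeff p k * z ^ k) \<le> norm (a n k - 1) * norm (taylor_coeff p k)" for k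
        unfolding bergman1_cmult(2)[OF monomial_bergman1(1)] norm_mult
        by (intro mult_left_le bergman1_norm_monomial_le_1) auto
    qed
    finally show ?thesis .
  qed
  have "bergman1_norm (\<lambda>z. coeff_transform a n g z - g z) \<le> (K + 1) * e + ?y n" for n
  proof -
    let ?d = "\<lambda>z. p z - g z"
    have d: "?d \<in> bergman1" by (rule bergman1_diff[OF p(1) g])
    have nd: "(\<lambda>z. (-1) * coeff_transform a n ?d z) \<in> bergman1" by (intro bergman1_cmult Tg d)
    have pp: "(\<lambda>z. coeff_transform a n p z - p z) \<in> bergman1" by (intro bergman1_diff Tg p)
    \<comment> \<open>Writing \<open>T\<close> for the multiplier:
      \<open>T g - g = - T (p - g) + (T p - p) + (p - g)\<close>. The outer terms cost at most
      \<open>K + 1\<close> times the approximation error, and the middle one tends to zero.\<close>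
    have "bergman1_norm (\<lambda>z. coeff_transform a n g z - g z)
      = bergman1_norm (\<lambda>z. ((-1) * coeff_transform a n ?d z + (coeff_transform a n p z - p z)) + ?d z)"
      by (rule bergman1_norm_cong) (simp add: coeff_transform_diff[where a=a and n=n, OF a ph gh])
    also have "\<dots> \<le> bergman1_norm (\<lambda>z. (-1) * coeff_transform a n ?d z) + bergman1_norm (\<lambda>z. coeff_transform a n p z - p z) + bergman1_norm ?d"
      using bergman1_add(2)[OF bergman1_add(1)[OF nd pp] d] bergman1_add(2)[OF nd pp] by linarith
    also have "bergman1_norm (\<lambda>z. (-1) * coeff_transform a n ?d z) = bergman1_norm (coeff_transform a n ?d)"
      by (subst bergman1_cmult(2)[OF Tg[OF d]]) simp
    also have "bergman1_norm (coeff_transform a n ?d) \<le> K * bergman1_norm ?d" by (rule T[OF d])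
    finally have "bergman1_norm (\<lambda>z. coeff_transform a n g z - g z) \<le> (K + 1) * bergman1_norm ?d + ?y n"
      using y[of n] by (simp add: algebra_simps)
    also have "\<dots> \<le> (K + 1) * e + ?y n"
      using K p(3) by (intro add_right_mono mult_left_mono) auto
    finally show ?thesis .
  qed
  with err(2) show "\<exists>y. y \<longlonglongrightarrow> 0 \<and> (\<forall>n. bergman1_norm (\<lambda>z. coeff_transform a n g z - g z) \<le> (K + 1) * e + y n)"
    by blast
qed (use K in simp)

lemma coeff_transform_tendsto_bloch:
  fixes a :: "nat \<Rightarrow> nat \<Rightarrow> complex"
  assumes a: "\<And>n. summable (\<lambda>k. norm (a n k))"
    and lim: "\<And>k. (\<lambda>n. a n k) \<longlonglongrightarrow> 1" and bound: "\<And>n k. norm (a n k) \<le> C"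
    and T: "\<And>n f. f \<in> little_bloch \<Longrightarrow> bloch_norm (coeff_transform a n f) \<le> K * bloch_norm f" and K: "0 \<le> K"
    and f: "f \<in> little_bloch"
  shows "(\<lambda>n. bloch_norm (\<lambda>z. coeff_transform a n f z - f z)) \<longlonglongrightarrow> 0"
proof (rule tendsto_zeroI_approx[where C="K + 1"])
  note fb = little_bloch_bloch[OF f]
  note Tb = little_bloch_bloch[OF coeff_transform_bloch(1)[where a=a, OF a]]
  show "0 \<le> bloch_norm (\<lambda>z. coeff_transform a n f z - f z)" for n
    by (intro bloch_norm_nonneg bloch_diff Tb fb)
  fix e :: real assume "0 < e"
  then obtain p where p: "p \<in> little_bloch" "summable (\<lambda>k. (k + 1) * norm (taylor_coeff p k))" "bloch_norm (\<lambda>z. p z - f z) < e"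
    using little_bloch_dense[OF f] by blast
  note pb = little_bloch_bloch[OF p(1)]
  note ph = bloch_holomorphic[OF pb] and fh = bloch_holomorphic[OF fb]
  note err = multiplier_error_tendsto[where a=a, OF lim bound p(2)]
  let ?y = "\<lambda>n. \<Sum>k. norm (a n k - 1) * ((k + 1) * norm (taylor_coeff p k))"
  note mono = little_bloch_bloch[OF monomial_little_bloch]
  have mono1: "(\<lambda>z. z ^ k) \<in> bloch" for k using mono[of 1 k] by simp
  have y: "bloch_norm (\<lambda>z. coeff_transform a n p z - p z) \<le> ?y n" for n
  proof -
    have "bloch_norm (\<lambda>z. coeff_transform a n p z - p z) = bloch_norm (\<lambda>z. \<Sum>k. (a n k - 1) * taylor_coeff p k * z ^ k)"
      by (rule bloch_norm_cong) (rule coeff_transform_minus_id[where a=a and n=n, OF a ph])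
    also have "\<dots> \<le> ?y n"
    proof (rule bloch_series(3)[OF mono err(1)])
      fix k
      have "bloch_norm (\<lambda>z. (a n k - 1) * taylor_coeff p k * z ^ k) \<le> norm ((a n k - 1) * taylor_coeff p k) * bloch_norm (\<lambda>z. z ^ k)"
        by (rule bloch_cmult(2)[OF mono1])
      also have "\<dots> \<le> norm ((a n k - 1) * taylor_coeff p k) * (k + 1)"
        by (intro mult_left_mono bloch_norm_power_le) auto
      finally show "bloch_norm (\<lambda>z. (a n k - 1) * taylor_coeff p k * z ^ k) \<le> norm (a n k - 1) * ((k + 1) * norm (taylor_coeff p k))"
        by (simp add: norm_mult mult_ac)
    qed auto
    finally show ?thesis .
  qed
  have "bloch_norm (\<lambda>z. coeff_transform a n f z - f z) \<le> (K + 1) * e + ?y n" for n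
  proof -
    let ?d = "\<lambda>z. p z - f z"
    have d: "?d \<in> little_bloch" using little_bloch_add[OF p(1) little_bloch_cmult[OF f, of "-1"]] by simp
    note db = little_bloch_bloch[OF d]
    have nd: "(\<lambda>z. (-1) * coeff_transform a n ?d z) \<in> bloch" by (intro bloch_cmult Tb db)
    have pp: "(\<lambda>z. coeff_transform a n p z - p z) \<in> bloch" by (intro bloch_diff Tb pb)
    have "bloch_norm (\<lambda>z. coeff_transform a n f z - f z)
      = bloch_norm (\<lambda>z. ((-1) * coeff_transform a n ?d z + (coeff_transform a n p z - p z)) + ?d z)"
      by (rule bloch_norm_cong) (simp add: coeff_transform_diff[where a=a and n=n, OF a ph fh])
    also have "\<dots> \<le> bloch_norm (\<lambda>z. (-1) * coeff_transform a n ?d z) + bloch_norm (\<lambda>z. coeff_transform a n p z - p z) + bloch_norm ?d"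
      using bloch_add(2)[OF bloch_add(1)[OF nd pp] db] bloch_add(2)[OF nd pp] by linarith
    also have "bloch_norm (\<lambda>z. (-1) * coeff_transform a n ?d z) \<le> bloch_norm (coeff_transform a n ?d)"
      using bloch_cmult(2)[OF Tb[OF db], of "-1"] by simp
    also have "bloch_norm (coeff_transform a n ?d) \<le> K * bloch_norm ?d" by (rule T[OF d])
    finally have "bloch_norm (\<lambda>z. coeff_transform a n f z - f z) \<le> (K + 1) * bloch_norm ?d + ?y n"
      using y[of n] by (simp add: algebra_simps)
    also have "\<dots> \<le> (K + 1) * e + ?y n"
      using K p(3) by (intro add_right_mono mult_left_mono) auto
    finally show ?thesis .
  qed
  with err(2) show "\<exists>y. y \<longlonglongrightarrow> 0 \<and> (\<forall>n. bloch_norm (\<lambda>z. coeff_transform a n f z - f z) \<le> (K + 1) * e + y n)"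
    by auto
qed (use K in simp)

text \<open>The bilinear bound is read twice, with \<open>f\<close> varying for the
  \<open>A^1\<close> norm and with \<open>g\<close> varying for the Bloch norm; each dual estimate
  costs a factor five. Monomials are eigenvectors with eigenvalue \<open>a n k\<close>, which bounds
  the entries, and pairing \<open>z ^ k\<close> with its own image isolates their limit.\<close>

lemma weak_convergence_consequences:
  fixes a :: "nat \<Rightarrow> nat \<Rightarrow> complex"
  assumes a: "\<And>n. summable (\<lambda>k. norm (a n k))"
    and weak: "\<And>g f. g \<in> bergman1 \<Longrightarrow> f \<in> little_bloch \<Longrightarrow> (\<lambda>n. pairing g (coeff_transform a n f)) \<longlonglongrightarrow> pairing g f"
  obtains K where "0 \<le> K" "\<And>n k. norm (a n k) \<le> K" "\<And>k. (\<lambda>n. a n k) \<longlonglongrightarrow> 1"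
    "\<And>n g. g \<in> bergman1 \<Longrightarrow> bergman1_norm (coeff_transform a n g) \<le> K * bergman1_norm g"
    "\<And>n f. f \<in> little_bloch \<Longrightarrow> bloch_norm (coeff_transform a n f) \<le> K * bloch_norm f"
proof -
  obtain K where K0: "0 \<le> K" and K: "\<And>n g f. g \<in> bergman1 \<Longrightarrow> f \<in> little_bloch \<Longrightarrow>
      cmod (pairing g (coeff_transform a n f)) \<le> K * bergman1_norm g * bloch_norm f"
    using pairing_uniform_bound[where a=a, OF a convergentI[OF weak]] by blast
  note Tb = little_bloch_bloch[OF coeff_transform_bloch(1)[where a=a, OF a]]
  have TA: "bergman1_norm (coeff_transform a n g) \<le> 5 * K * bergman1_norm g" if g: "g \<in> bergman1" for n g
  proof -
    have "bergman1_norm (coeff_transform a n g) \<le> 5 * (K * bergman1_norm g)"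
    proof (rule bergman1_norm_le_dual)
      show "cmod (pairing (coeff_transform a n g) f) \<le> K * bergman1_norm g * bloch_norm f" if f: "f \<in> little_bloch" for f
        using K[OF g f, of n] pairing_coeff_transform[where a=a and n=n, OF a g little_bloch_bloch[OF f]] by simp
    qed (use K0 bergman1_norm_nonneg[OF g] coeff_transform_bergman1[where a=a, OF a g] in auto)
    then show ?thesis by simp
  qed
  have TB: "bloch_norm (coeff_transform a n f) \<le> 5 * K * bloch_norm f" if f: "f \<in> little_bloch" for n f
  proof -
    have "bloch_norm (coeff_transform a n f) \<le> 5 * (K * bloch_norm f)"
      by (rule bloch_norm_le_dual[OF Tb[OF little_bloch_bloch[OF f]]]) (use K[OF _ f] in \<open>simp add: mult_ac\<close>)
    then show ?thesis by simp
  qed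
  have mono: "(\<lambda>z. z ^ k) \<in> little_bloch" for k using monomial_little_bloch[of 1 k] by simp
  note hm = bergman1_holomorphic[OF monomial_bergman1(1)]
  have "norm (a n k) \<le> 5 * K" for n k
  proof -
    \<comment> \<open>The norm of the monomial is to be cancelled; its positivity is read off from
      the coefficient bound.\<close>
    have "1 \<le> (k + 1) * bergman1_norm (\<lambda>z. z ^ k)"
      using bergman1_coeff_bound[OF monomial_bergman1(1)[of k], of k] by (simp add: taylor_coeff_monomial add.commute)
    then have pos: "0 < bergman1_norm (\<lambda>z. z ^ k)"
      using bergman1_norm_nonneg[OF monomial_bergman1(1)[of k]] by (cases "bergman1_norm (\<lambda>z. z ^ k) = 0") auto
    have "coeff_transform a n (\<lambda>z. z ^ k) z = a n k * z ^ k" for z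
      using sums_single[of k "\<lambda>j. a n j * z ^ j"]
      by (simp add: coeff_transform_def taylor_coeff_monomial sums_iff of_bool_def if_distrib[of "\<lambda>x. _ * x"] if_distrib[of "\<lambda>x. x * _"] cong: if_cong)
    then have eq: "coeff_transform a n (\<lambda>z. z ^ k) = (\<lambda>z. a n k * z ^ k)" by (rule ext)
    have "norm (a n k) * bergman1_norm (\<lambda>z. z ^ k) = bergman1_norm (coeff_transform a n (\<lambda>z. z ^ k))"
      unfolding eq by (rule bergman1_cmult(2)[OF monomial_bergman1(1), symmetric])
    also have "\<dots> \<le> 5 * K * bergman1_norm (\<lambda>z. z ^ k)" by (rule TA[OF monomial_bergman1(1)])
    finally show ?thesis using pos by simp
  qed
  moreover have "(\<lambda>n. a n k) \<longlonglongrightarrow> 1" for k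
  proof -
    have nz: "of_nat (k + 1) \<noteq> (0::complex)" unfolding of_nat_eq_0_iff by simp
    have "pairing (\<lambda>z. z ^ k) (coeff_transform a n (\<lambda>z. z ^ k)) = a n k / of_nat (k + 1)" for n
      by (simp add: pairing_monomial[OF Tb[OF little_bloch_bloch[OF mono]]]
          taylor_coeff_coeff_transform[where a=a and n=n, OF a hm] taylor_coeff_monomial)
    moreover have "pairing (\<lambda>z. z ^ k) (\<lambda>z. z ^ k) = 1 / of_nat (k + 1)"
      by (simp add: pairing_monomial[OF little_bloch_bloch[OF mono]] taylor_coeff_monomial)
    ultimately have "(\<lambda>n. a n k / of_nat (k + 1)) \<longlonglongrightarrow> 1 / of_nat (k + 1)"
      using weak[OF monomial_bergman1(1) mono, of k k] by simp
    from tendsto_mult[OF this tendsto_const[of "of_nat (k + 1)"]] show ?thesis using nz by simp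
  qed
  ultimately show ?thesis using K0 TA TB by (intro that[of "5 * K"]) auto
qed

section \<open>Equivalence of the five conditions\<close>

theorem theorem5p4:
  fixes a :: "nat \<Rightarrow> nat \<Rightarrow> complex"
  assumes "\<And>n. summable (\<lambda>k. norm (a n k))"
  defines "C1 \<equiv> (\<forall>g\<in>bergman1. weak_conv_A1 (\<lambda>n. coeff_transform a n g) g)"
      and "C2 \<equiv> (\<forall>g\<in>bergman1. (\<forall>n. coeff_transform a n g \<in> bergman1) \<and>
                   (\<lambda>n. bergman1_norm (\<lambda>z. coeff_transform a n g z - g z)) \<longlonglongrightarrow> 0)"
      and "C3 \<equiv> (\<forall>h\<in>bloch. weakstar_conv_B (\<lambda>n. coeff_transform a n h) h)"
      and "C4 \<equiv> (\<forall>f\<in>little_bloch. weak_conv_B0 (\<lambda>n. coeff_transform a n f) f)"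
      and "C5 \<equiv> (\<forall>f\<in>little_bloch. (\<forall>n. coeff_transform a n f \<in> bloch) \<and>
                   (\<lambda>n. bloch_norm (\<lambda>z. coeff_transform a n f z - f z)) \<longlonglongrightarrow> 0)"
  shows "(C1 \<longleftrightarrow> C2) \<and> (C2 \<longleftrightarrow> C3) \<and> (C3 \<longleftrightarrow> C4) \<and> (C4 \<longleftrightarrow> C5)"
proof -
  note a = assms(1)
  note TA = coeff_transform_bergman1[where a=a, OF a] and TB0 = coeff_transform_bloch(1)[where a=a, OF a]
  note TB = little_bloch_bloch[OF TB0]
  note sym = pairing_coeff_transform[where a=a, OF a]
  have 12: C1 if C2
    unfolding C1_def weak_conv_A1_def
  proof (intro ballI conjI allI)
    fix g h assume g: "g \<in> bergman1" and h: "h \<in> bloch"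
    have "(\<lambda>n. pairing (coeff_transform a n g) h - pairing g h) \<longlonglongrightarrow> 0"
    proof (rule Lim_null_comparison)
      show "\<forall>\<^sub>F n in sequentially. cmod (pairing (coeff_transform a n g) h - pairing g h)
          \<le> 3 * bergman1_norm (\<lambda>z. coeff_transform a n g z - g z) * bloch_norm h"
        unfolding pairing_diff_left[OF TA[OF g] g h, symmetric]
        by (intro always_eventually allI pairing_bound bergman1_diff TA g h)
      show "(\<lambda>n. 3 * bergman1_norm (\<lambda>z. coeff_transform a n g z - g z) * bloch_norm h) \<longlonglongrightarrow> 0"
        using that g by (intro tendsto_mult_left_zero tendsto_mult_right_zero) (simp add: C2_def)
    qed
    then show "(\<lambda>n. pairing (coeff_transform a n g) h) \<longlonglongrightarrow> pairing g h"
      by (rule LIM_zero_cancel)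
  qed (use TA in auto)
  \<comment> \<open>By symmetry of the multiplier both conditions assert convergence of the same
    numbers for the same pairs of functions.\<close>
  have 13: "C1 \<longleftrightarrow> C3"
    unfolding C1_def C3_def weak_conv_A1_def weakstar_conv_B_def using TA TB sym by auto
  \<comment> \<open>Restriction to little Bloch functions; their images stay in the little Bloch
    space by \<open>TB0\<close>.\<close>
  have 34: C4 if C3
    using that little_bloch_bloch TB0 unfolding C3_def C4_def weakstar_conv_B_def weak_conv_B0_def by blast
  have 54: C4 if C5
    unfolding C4_def weak_conv_B0_def
  proof (intro ballI conjI allI)
    fix f g assume f: "f \<in> little_bloch" and g: "g \<in> bergman1"
    note fb = little_bloch_bloch[OF f]
    have "(\<lambda>n. pairing g (coeff_transform a n f) - pairing g f) \<longlonglongrightarrow> 0"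
    proof (rule Lim_null_comparison)
      show "\<forall>\<^sub>F n in sequentially. cmod (pairing g (coeff_transform a n f) - pairing g f)
          \<le> 3 * bergman1_norm g * bloch_norm (\<lambda>z. coeff_transform a n f z - f z)"
        unfolding pairing_diff_right[OF g TB[OF fb] fb, symmetric]
        by (intro always_eventually allI pairing_bound bloch_diff TB fb g)
      show "(\<lambda>n. 3 * bergman1_norm g * bloch_norm (\<lambda>z. coeff_transform a n f z - f z)) \<longlonglongrightarrow> 0"
        using that f by (intro tendsto_mult_right_zero) (simp add: C5_def)
    qed
    then show "(\<lambda>n. pairing g (coeff_transform a n f)) \<longlonglongrightarrow> pairing g f"
      by (rule LIM_zero_cancel)
  qed (use TB0 little_bloch_bloch in auto)
  \<comment> \<open>The only implication that uses uniform boundedness: it leads from the weak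
    condition on the smaller space back to both norm statements and so closes all the
    cycles.\<close>
  have 4: "C2 \<and> C5" if C4
  proof -
    have "(\<lambda>n. pairing g (coeff_transform a n f)) \<longlonglongrightarrow> pairing g f" if "g \<in> bergman1" "f \<in> little_bloch" for g f
      using \<open>C4\<close> that by (auto simp: C4_def weak_conv_B0_def)
    from weak_convergence_consequences[where a=a, OF a this]
    obtain K where K: "0 \<le> K" "\<And>n k. norm (a n k) \<le> K" "\<And>k. (\<lambda>n. a n k) \<longlonglongrightarrow> 1"
      "\<And>n g. g \<in> bergman1 \<Longrightarrow> bergman1_norm (coeff_transform a n g) \<le> K * bergman1_norm g"
      "\<And>n f. f \<in> little_bloch \<Longrightarrow> bloch_norm (coeff_transform a n f) \<le> K * bloch_norm f"
      by metis
    show ?thesis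
      unfolding C2_def C5_def
      using TA TB[OF little_bloch_bloch] coeff_transform_tendsto_bergman1[where a=a, OF a K(3,2,4,1)]
        coeff_transform_tendsto_bloch[where a=a, OF a K(3,2,5,1)] by blast
  qed
  show ?thesis using 12 13 34 54 4 by blast
qed

end
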